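(* Let $0 \le k < d$ be integers and let $\varepsilon, \alpha, \eta > 0$ be real numbers. Then there exist constants $C$ and $C'$, depending only on $d,k,\varepsilon,\alpha,\eta$ (with $C'$ depending only on $d,k,\varepsilon,\alpha$), such that for every positive integer $N$ and every set $S \subseteq [N]^d$ which occupies fewer than $\alpha p^k$ residue classes modulo $p$ for every prime $p$, at least one of the following holds: (i) $|S| \le C' N^{k-1+\varepsilon}$; (ii) there exists a polynomial $f \in \mathbb{Z}[x_1,\ldots,x_d]$ of degree at most $C$, all of whose coefficients are bounded in absolute value by $N^C$, which vanishes at more than $(1-\eta)|S|$ points of $S$.
   Context: $[N]$ denotes the set of integers $\{0,1,\ldots,N\}$. A set $S \subseteq \mathbb{Z}^d$ is said to occupy $m$ residue classes modulo a prime $p$ if the image of $S$ under the reduction map $\mathbb{Z}^d \to (\mathbb{Z}/p\mathbb{Z})^d$ has exactly $m$ elements. *)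

theory Defs
  imports Complex_Main "HOL-Computational_Algebra.Primes"
begin

definition grid :: "nat \<Rightarrow> nat \<Rightarrow> int list set" where
  "grid d N = {x. length x = d \<and> (\<forall>a\<in>set x. 0 \<le> a \<and> a \<le> int N)}"

definition residue_classes :: "nat \<Rightarrow> int list set \<Rightarrow> nat" where
  "residue_classes p S = card ((\<lambda>x. map (\<lambda>a. a mod int p) x) ` S)"

definition monomials_upto :: "nat \<Rightarrow> real \<Rightarrow> nat list set" where
  "monomials_upto d D = {e. length e = d \<and> real (sum_list e) \<le> D}"

text \<open>A polynomial in Z[x_1..x_d] of degree at most D is given by its coefficient
  function c on the monomials of degree at most D; evaluation at a point x.\<close>
definition mpoly_eval :: "nat \<Rightarrow> real \<Rightarrow> (nat list \<Rightarrow> int) \<Rightarrow> int list \<Rightarrow> int" where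
  "mpoly_eval d D c x = (\<Sum>e\<in>monomials_upto d D. c e * prod_list (map2 (\<lambda>a n. a ^ n) x e))"

end

theory Submission
  imports Defs "HOL-Real_Asymp.Real_Asymp" "HOL-Analysis.Convex" "HOL-Library.FuncSet"
begin

text \<open>
  Weight a prime \<open>p \<le> N^e\<close> by \<open>ln p / p\<close>; the total weight is of order \<open>ln N\<close>, while a set of primes
  with \<open>\<Sum> ln p = O(ln N)\<close> has negligible weight. If an integer polynomial of bounded degree and height
  vanishes on a set \<open>A\<close>, its value at \<open>x\<close> is divisible by every \<open>p\<close> for which \<open>x\<close> is congruent to a point
  of \<open>A\<close>; once \<open>\<Sum> ln p\<close> over these primes exceeds \<open>R ln N\<close>, it vanishes at \<open>x\<close> too.

  By induction on \<open>k\<close>, a large ill-distributed set \<open>S\<close> contains \<open>A\<close> with \<open>|A| = O(R^k)\<close> such that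
  vanishing on \<open>A\<close> forces vanishing on most of \<open>S\<close>. Up to few exceptions, \<open>S\<close> splits into \<open>d\<close> parts,
  each with a coordinate whose slices are negligible in size. By Gallagher's larger sieve most of these
  slices occupy \<open>O(p^(k-1))\<close> classes for most \<open>p\<close>, so the induction hypothesis applies to them. Being
  large, they cannot be concentrated in few classes either, and therefore \<open>O(R)\<close> slices, chosen
  greedily, already meet the classes of most points of \<open>S\<close> for enough primes. Since \<open>k < d\<close>, the number
  of monomials of degree at most \<open>r\<close> exceeds \<open>2|A|\<close> when \<open>r\<close> is a large constant and \<open>R = 2r + 1\<close>, and
  Siegel's lemma gives a polynomial vanishing on \<open>A\<close>.
\<close>

section \<open>Weights of primes\<close>

text \<open>Two measures of primes compete. Divisibility is paid in \<open>ln p\<close>, since it is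
  compared with \<open>ln N\<close>; but a class modulo \<open>p\<close> is met by only about a
  fraction \<open>1/p\<close> of the slices, so a random slice gains about \<open>ln p / p\<close>.
  The primes are cut off at \<open>N^e\<close> so that \<open>\<Sum> ln p \<le> N^(2e)\<close>,
  exactly what a slice of relative size \<open>N^(-2e)\<close> absorbs. Points that lie on a larger
  slice in every direction number \<open>O(N^(2ed))\<close>, negligible because \<open>e\<close> is
  chosen with \<open>2ed < \<epsilon>\<close>. The obstacle in the induction is that a slice
  inherits the residue bound only for most primes. The statement proved by induction therefore
  tolerates exceptional primes of relative weight \<open>\<gamma>\<close>. The order of quantifiers
  matters too: the number of slices needed is linear in \<open>R\<close> with a factor chosen before
  \<open>R\<close>, so that \<open>k\<close> levels cost \<open>O(R^k)\<close> points, against a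
  number of monomials of order \<open>R^d\<close>.\<close>

lemma sum_ln_primes_le:
  fixes z :: int and G :: "nat set"
  assumes "finite G" "\<And>p. p \<in> G \<Longrightarrow> prime p" "\<And>p. p \<in> G \<Longrightarrow> int p dvd z" "z \<noteq> 0"
  shows "(\<Sum>p\<in>G. ln (real p)) \<le> ln \<bar>real_of_int z\<bar>"
proof -
  \<comment> \<open>Distinct primes are coprime, so their product divides \<open>z\<close>. Later
    uses read the bound backwards: an integer with too many prime divisors for its size is
    0.\<close>
  have "(\<Prod>p\<in>G. p) dvd nat \<bar>z\<bar>"
    using assms
  proof (induction G rule: finite_induct)
    case (insert p G)
    have "coprime p (\<Prod>G)"
      by (rule prod_coprime_right) (metis insert.hyps(2) insert.prems(1) insertCI primes_coprime)
    moreover have "p dvd nat \<bar>z\<bar>" "\<Prod>G dvd nat \<bar>z\<bar>"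
      using insert by (auto simp: dvd_nat_abs_iff simp del: of_nat_prod)
    ultimately show ?case unfolding prod.insert[OF insert.hyps(1,2)] by (intro divides_mult) auto
  qed auto
  then have le: "(\<Prod>p\<in>G. p) \<le> nat \<bar>z\<bar>"
    using assms(4) by (intro dvd_imp_le) auto
  have pos: "p > 0" if "p \<in> G" for p using assms(2) that prime_gt_0_nat by blast
  have "(\<Sum>p\<in>G. ln (real p)) = ln (\<Prod>p\<in>G. real p)"
    using pos by (subst ln_prod) (auto simp: assms(1))
  also have "\<dots> = ln (real (\<Prod>p\<in>G. p))" by simp
  also have "\<dots> \<le> ln (real (nat \<bar>z\<bar>))"
    using le prod_pos[of G "\<lambda>p. p"] pos by (intro ln_mono) (auto simp del: of_nat_prod)
  finally show ?thesis by simp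
qed

section \<open>A lower bound of Mertens type from the factorization of \<open>n!\<close>\<close>

lemma multiplicity_eq_card_powers:
  fixes p m n :: nat
  assumes "prime p" "m > 0" "m \<le> n"
  shows "multiplicity p m = card {j\<in>{1..n}. p ^ j dvd m}"
proof -
  have iff: "p ^ j dvd m \<longleftrightarrow> j \<le> multiplicity p m" for j
    by (rule power_dvd_iff_le_multiplicity) (use assms not_prime_unit in auto)
  have "multiplicity p m < p ^ multiplicity p m"
    using assms(1) by (intro power_gt_expt prime_gt_Suc_0_nat)
  also have "\<dots> \<le> m" using assms(2) by (simp add: dvd_imp_le multiplicity_dvd)
  finally have "multiplicity p m < m" .
  then have "{j\<in>{1..n}. p ^ j dvd m} = {1..multiplicity p m}"
    using assms(3) unfolding iff by auto
  then show ?thesis by simp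
qed

text \<open>Summing multiplicities counts the multiples of each \<open>p^j\<close> up to
  \<open>n\<close>, at most \<open>n / p^j\<close> of them; the geometric series costs a factor 2
  because \<open>p \<ge> 2\<close>.\<close>

lemma sum_multiplicity_le:
  fixes p n :: nat
  assumes "prime p"
  shows "(\<Sum>m=1..n. real (multiplicity p m)) \<le> 2 * n / p"
proof -
  have p2: "p \<ge> 2" using assms prime_ge_2_nat by blast
  have "(\<Sum>m=1..n. real (multiplicity p m)) = (\<Sum>m=1..n. \<Sum>j=1..n. if p ^ j dvd m then 1 else 0)"
    using assms by (intro sum.cong refl)
      (use multiplicity_eq_card_powers[of p _ n] in \<open>simp add: sum.If_cases Int_def\<close>)
  also have "\<dots> = (\<Sum>j=1..n. real (card {m\<in>{1..n}. p ^ j dvd m}))"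
    by (subst sum.swap) (simp add: sum.If_cases Int_def)
  also have "\<dots> \<le> (\<Sum>j=1..n. n * (1 / p) ^ j)"
  proof (rule sum_mono)
    fix j assume "j \<in> {1..n}"
    have "{m\<in>{1..n}. p ^ j dvd m} \<subseteq> (\<lambda>i. p ^ j * i) ` {1..n div p ^ j}"
    proof
      fix m assume m: "m \<in> {m\<in>{1..n}. p ^ j dvd m}"
      then obtain i where i: "m = p ^ j * i" by auto
      with m p2 have "i \<ge> 1" "i \<le> n div p ^ j" by (auto simp: less_eq_div_iff_mult_less_eq mult.commute Suc_le_eq)
      with i show "m \<in> (\<lambda>i. p ^ j * i) ` {1..n div p ^ j}" by auto
    qed
    then have "card {m\<in>{1..n}. p ^ j dvd m} \<le> card ((\<lambda>i. p ^ j * i) ` {1..n div p ^ j})"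
      by (intro card_mono) auto
    also have "\<dots> \<le> n div p ^ j" by (metis card_atLeastAtMost card_image_le diff_Suc_1 finite_atLeastAtMost)
    finally have "real (card {m\<in>{1..n}. p ^ j dvd m}) \<le> real (n div p ^ j)" by simp
    also have "\<dots> \<le> n / real (p ^ j)" by (rule of_nat_div_le_of_nat)
    finally show "real (card {m\<in>{1..n}. p ^ j dvd m}) \<le> n * (1 / p) ^ j"
      by (simp add: power_one_over)
  qed
  also have "\<dots> = n * (\<Sum>j=1..n. (1 / real p) ^ j)" by (simp add: sum_distrib_left)
  also have "\<dots> \<le> n * (2 / p)"
  proof (rule mult_left_mono)
    \<comment> \<open>The subtracted tail makes the induction close; its step amounts to
      \<open>2 / p \<le> 1\<close>.\<close>
    have "(\<Sum>j=1..n. (1 / real p) ^ j) \<le> 2 / p - 2 / p * (1 / p) ^ n"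
    proof (induction n)
      case (Suc n)
      have "(1 / real p) ^ n * (1 / p) \<le> 2 / p * (1 / p) ^ n - 2 / p * ((1 / p) ^ n * (1 / p))"
      proof -
        have "1 / real p \<le> 1 / 2" using p2 by (simp add: field_simps)
        then have "(1 / real p) ^ n * (1 / p) * (2 * (1 / p)) \<le> (1 / real p) ^ n * (1 / p) * 1"
          by (intro mult_left_mono) auto
        then show ?thesis by (simp add: algebra_simps)
      qed
      with Suc show ?case by (simp add: mult.commute)
    qed auto
    also have "\<dots> \<le> 2 / p" by simp
    finally show "(\<Sum>j=1..n. (1 / real p) ^ j) \<le> 2 / p" .
  qed simp
  finally show ?thesis by (simp add: mult.commute)
qed

text \<open>The sum runs over all primes up to \<open>n\<close>, so that the index set is the same
  for every \<open>m \<le> n\<close> and the sums over \<open>m\<close> and \<open>p\<close> can be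
  exchanged.\<close>

lemma ln_eq_sum_multiplicity:
  fixes m n :: nat
  assumes "m > 0" "m \<le> n"
  shows "ln (real m) = (\<Sum>p | prime p \<and> p \<le> n. real (multiplicity p m) * ln p)"
proof -
  have fin: "finite {p::nat. prime p \<and> p \<le> n}" by simp
  have pos: "p > 0" if "p \<in> prime_factors m" for p
    using that prime_factors_gt_0_nat by blast
  have "real m = (\<Prod>p\<in>prime_factors m. real p ^ multiplicity p m)"
    using arg_cong[OF prime_factorization_nat[of m], of real] assms(1) by simp
  then have "ln (real m) = (\<Sum>p\<in>prime_factors m. ln (real p ^ multiplicity p m))"
    using pos by (simp add: ln_prod)
  also have "\<dots> = (\<Sum>p\<in>prime_factors m. real (multiplicity p m) * ln p)"
    using pos by (intro sum.cong refl) (simp add: ln_realpow)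
  also have "\<dots> = (\<Sum>p | prime p \<and> p \<le> n. real (multiplicity p m) * ln p)"
  proof (rule sum.mono_neutral_left[OF fin])
    show "prime_factors m \<subseteq> {p. prime p \<and> p \<le> n}"
      using assms by (auto simp: prime_factors_dvd intro: order_trans[OF dvd_imp_le])
  qed (use assms in \<open>auto simp: prime_factors_dvd not_dvd_imp_multiplicity_0\<close>)
  finally show ?thesis .
qed

lemma ln_fact_lower: "n \<ge> 1 \<Longrightarrow> real n * ln n - n \<le> ln (fact n)"
proof -
  assume n: "n \<ge> 1"
  \<comment> \<open>A single term of the exponential series, \<open>n^n / n! \<le> exp n\<close>,
    gives Stirling's lower bound up to lower order.\<close>
  have "(\<Sum>k<Suc n. real n ^ k /\<^sub>R fact k) \<le> exp (real n)"
    unfolding exp_def by (rule sum_le_suminf) (auto intro: summable_exp)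
  moreover have "real n ^ n /\<^sub>R fact n \<le> (\<Sum>k<Suc n. real n ^ k /\<^sub>R fact k)"
    by (rule member_le_sum) auto
  ultimately have "real n ^ n \<le> exp (real n) * fact n"
    by (simp add: field_simps)
  then have "ln (real n ^ n) \<le> ln (exp (real n) * fact n)"
    using n by (subst ln_le_cancel_iff) auto
  then show ?thesis using n by (simp add: ln_mult ln_realpow)
qed

text \<open>\<open>ln (n!)\<close> is at least \<open>n ln n - n\<close>, and each prime accounts
  for at most \<open>2 n ln p / p\<close> of it.\<close>

lemma mertens_lower:
  fixes n :: nat
  assumes "n \<ge> 1"
  shows "(ln n - 1) / 2 \<le> (\<Sum>p | prime p \<and> p \<le> n. ln (real p) / p)"
proof -
  have "real n * ln n - n \<le> ln (fact n)" by (rule ln_fact_lower[OF assms])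
  also have "ln (fact n) = (\<Sum>m=1..n. ln (real m))"
    by (simp add: fact_prod) (subst ln_prod, auto)
  also have "\<dots> = (\<Sum>m=1..n. \<Sum>p | prime p \<and> p \<le> n. real (multiplicity p m) * ln p)"
    by (intro sum.cong refl ln_eq_sum_multiplicity) auto
  also have "\<dots> = (\<Sum>p | prime p \<and> p \<le> n. (\<Sum>m=1..n. real (multiplicity p m)) * ln p)"
    by (subst sum.swap) (simp add: sum_distrib_right)
  also have "\<dots> \<le> (\<Sum>p | prime p \<and> p \<le> n. 2 * n / p * ln p)"
    by (intro sum_mono mult_right_mono sum_multiplicity_le) (auto simp: prime_gt_0_nat Suc_le_eq)
  also have "\<dots> = 2 * n * (\<Sum>p | prime p \<and> p \<le> n. ln (real p) / p)"
    by (simp add: sum_distrib_left)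
  finally have "real n * (ln n - 1) \<le> real n * (2 * (\<Sum>p | prime p \<and> p \<le> n. ln (real p) / p))"
    by (simp add: algebra_simps)
  then have "ln n - 1 \<le> 2 * (\<Sum>p | prime p \<and> p \<le> n. ln (real p) / p)"
    using assms by (subst (asm) mult_le_cancel_left_pos) auto
  then show ?thesis by simp
qed

section \<open>Weights of the primes up to a small power of \<open>N\<close>\<close>

definition sieve_primes :: "real \<Rightarrow> nat \<Rightarrow> nat set" where
  "sieve_primes e N = {p. prime p \<and> real p \<le> real N powr e}"

definition prime_weight :: "nat set \<Rightarrow> real" where
  "prime_weight G = (\<Sum>p\<in>G. ln (real p) / real p)"

definition total_weight :: "real \<Rightarrow> nat \<Rightarrow> real" where
  "total_weight e N = prime_weight (sieve_primes e N)"

lemma sieve_primes_prime: "p \<in> sieve_primes e N \<Longrightarrow> prime p"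
  by (simp add: sieve_primes_def)

lemma sieve_primes_ge_2: "p \<in> sieve_primes e N \<Longrightarrow> p \<ge> 2"
  by (simp add: sieve_primes_def prime_ge_2_nat)

lemma sieve_primes_eq: "sieve_primes e N = {p. prime p \<and> p \<le> nat \<lfloor>real N powr e\<rfloor>}"
  by (auto simp: sieve_primes_def le_nat_iff le_floor_iff)

lemma finite_sieve_primes [simp]: "finite (sieve_primes e N)"
  by (simp add: sieve_primes_eq)

lemma weight_nonneg: "p \<in> sieve_primes e N \<Longrightarrow> 0 \<le> ln (real p) / real p"
  using sieve_primes_ge_2[of p e N] by simp

lemma total_weight_lower:
  assumes "e > 0"
  shows "\<forall>\<^sub>F N in sequentially. total_weight e N \<ge> e / 4 * ln N"
proof -
  have "\<forall>\<^sub>F N::nat in sequentially. real N powr e \<ge> 2" using assms by real_asymp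
  \<comment> \<open>The main term is \<open>e/2 * ln N\<close>; halving it absorbs the rounding of
    \<open>N^e\<close> and the additive constants.\<close>
  moreover have "\<forall>\<^sub>F N::nat in sequentially. (ln (real N powr e / 2) - 1) / 2 \<ge> e / 4 * ln N"
    using assms by real_asymp
  ultimately show ?thesis
  proof eventually_elim
    case (elim N)
    define n where "n = nat \<lfloor>real N powr e\<rfloor>"
    have n: "real n \<ge> real N powr e / 2" "n \<ge> 1"
      using elim(1) unfolding n_def by linarith+
    have "e / 4 * ln N \<le> (ln (real n) - 1) / 2"
      using elim n by (smt (verit, best) divide_right_mono ln_mono half_gt_zero)
    also have "\<dots> \<le> total_weight e N"
      unfolding total_weight_def prime_weight_def sieve_primes_eq n_def[symmetric]
      by (rule mertens_lower[OF n(2)])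
    finally show ?case .
  qed
qed

text \<open>There are at most \<open>N^e\<close> primes, each contributing at most
  \<open>e ln N\<close>; doubling the exponent swallows the logarithm. The exponent
  \<open>2e\<close> reappears in \<open>spread\<close>.\<close>

lemma sum_ln_sieve_primes_upper:
  assumes "e > 0"
  shows "\<forall>\<^sub>F N in sequentially. (\<Sum>p\<in>sieve_primes e N. ln (real p)) \<le> real N powr (2 * e)"
proof -
  have "\<forall>\<^sub>F N::nat in sequentially. real N powr e * (e * ln N) \<le> real N powr (2 * e)"
    using assms by real_asymp
  moreover have "\<forall>\<^sub>F N::nat in sequentially. N \<ge> 1" by (rule eventually_ge_at_top)
  ultimately show ?thesis
  proof eventually_elim
    case (elim N)
    have "(\<Sum>p\<in>sieve_primes e N. ln (real p)) \<le> (\<Sum>p\<in>sieve_primes e N. e * ln N)"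
    proof (rule sum_mono)
      fix p assume p: "p \<in> sieve_primes e N"
      then have "ln (real p) \<le> ln (real N powr e)"
        using sieve_primes_ge_2[OF p] by (intro ln_mono) (auto simp: sieve_primes_def)
      then show "ln (real p) \<le> e * ln N" using elim by (simp add: ln_powr)
    qed
    also have "\<dots> = card (sieve_primes e N) * (e * ln N)" by simp
    also have "\<dots> \<le> real N powr e * (e * ln N)"
    proof (rule mult_right_mono)
      have "sieve_primes e N \<subseteq> {1..nat \<lfloor>real N powr e\<rfloor>}"
        by (auto simp: sieve_primes_eq Suc_le_eq prime_gt_0_nat)
      then have "card (sieve_primes e N) \<le> nat \<lfloor>real N powr e\<rfloor>"
        by (metis card_atLeastAtMost card_mono diff_Suc_1 finite_atLeastAtMost)
      then show "real (card (sieve_primes e N)) \<le> real N powr e"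
        by (smt (verit) of_nat_le_iff of_nat_floor powr_ge_zero)
    qed (use assms elim in auto)
    also have "\<dots> \<le> real N powr (2 * e)" by (rule elim)
    finally show ?case .
  qed
qed

text \<open>Splitting at \<open>p = sqrt W\<close>: small primes contribute at most 1 each.\<close>
lemma prime_weight_le_sqrt:
  assumes "finite G" "\<And>p. p \<in> G \<Longrightarrow> prime p" "(\<Sum>p\<in>G. ln (real p)) \<le> W" "W > 0"
  shows "prime_weight G \<le> 2 * sqrt W"
proof -
  let ?G1 = "{p\<in>G. real p \<le> sqrt W}" and ?G2 = "{p\<in>G. \<not> real p \<le> sqrt W}"
  have p1: "p \<ge> 1" if "p \<in> G" for p using assms(2)[OF that] prime_ge_1_nat by blast
  have "prime_weight G = (\<Sum>p\<in>?G1. ln (real p) / p) + (\<Sum>p\<in>?G2. ln (real p) / p)"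
    unfolding prime_weight_def by (subst sum.union_disjoint[symmetric]) (auto simp: assms(1) intro: sum.cong)
  also have "(\<Sum>p\<in>?G1. ln (real p) / p) \<le> (\<Sum>p\<in>?G1. 1)"
  proof (rule sum_mono)
    fix p assume "p \<in> ?G1"
    then have "p \<ge> 1" using p1 by auto
    then show "ln (real p) / p \<le> 1" using ln_bound[of "real p"] by (simp add: divide_le_eq)
  qed
  also have "(\<Sum>p\<in>?G1. 1) \<le> sqrt W"
  proof -
    have "?G1 \<subseteq> {1..nat \<lfloor>sqrt W\<rfloor>}" using p1 by (auto simp: le_nat_floor)
    then have "card ?G1 \<le> nat \<lfloor>sqrt W\<rfloor>"
      by (metis (no_types, lifting) card_atLeastAtMost card_mono diff_Suc_1 finite_atLeastAtMost)
    then show ?thesis using assms(4)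
      by (smt (verit) of_nat_le_iff of_nat_floor real_sqrt_ge_zero real_of_card)
  qed
  also have "(\<Sum>p\<in>?G2. ln (real p) / p) \<le> (\<Sum>p\<in>?G2. ln (real p) / sqrt W)"
    using assms(4) p1 by (intro sum_mono divide_left_mono) (auto intro!: mult_pos_pos simp: Suc_le_eq)
  also have "\<dots> = (\<Sum>p\<in>?G2. ln (real p)) / sqrt W" by (simp add: sum_divide_distrib)
  also have "\<dots> \<le> W / sqrt W"
  proof (rule divide_right_mono)
    have "(\<Sum>p\<in>?G2. ln (real p)) \<le> (\<Sum>p\<in>G. ln (real p))"
      by (rule sum_mono2) (use assms p1 in auto)
    then show "(\<Sum>p\<in>?G2. ln (real p)) \<le> W" using assms(3) by simp
  qed (use assms in auto)
  also have "W / sqrt W = sqrt W" using assms(4) by (simp add: real_div_sqrt)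
  finally show ?thesis by simp
qed

text \<open>The weight of such a \<open>G\<close> is \<open>O(sqrt (ln N))\<close>, of smaller order
  than the total weight, which is at least \<open>e/4 * ln N\<close>.\<close>

lemma light_primes:
  assumes "e > 0" "\<tau> > 0" "W > 0"
  shows "\<forall>\<^sub>F N in sequentially. \<forall>G\<subseteq>sieve_primes e N. 
           (\<Sum>p\<in>G. ln (real p)) \<le> W * ln N \<longrightarrow> prime_weight G \<le> \<tau> * total_weight e N"
proof -
  have "\<forall>\<^sub>F N::nat in sequentially. 2 * sqrt (W * ln N) \<le> \<tau> * (e / 4 * ln N)"
    using assms by real_asymp
  moreover have "\<forall>\<^sub>F N::nat in sequentially. W * ln N > 0"
    using assms by real_asymp
  ultimately show ?thesis using total_weight_lower[OF assms(1)]
  proof eventually_elim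
    case (elim N)
    show ?case
    proof (intro allI impI)
      fix G assume G: "G \<subseteq> sieve_primes e N" "(\<Sum>p\<in>G. ln (real p)) \<le> W * ln N"
      then have "prime_weight G \<le> 2 * sqrt (W * ln N)"
        by (intro prime_weight_le_sqrt) (auto intro: finite_subset sieve_primes_prime elim)
      also have "\<dots> \<le> \<tau> * total_weight e N"
        using elim assms by (smt (verit) mult_left_mono)
      finally show "prime_weight G \<le> \<tau> * total_weight e N" .
    qed
  qed
qed

section \<open>The larger sieve\<close>

lemma card_fibers:
  assumes "finite T" "finite B"
  shows "card {x\<in>T. f x \<in> B} = (\<Sum>b\<in>B. card {x\<in>T. f x = b})"
proof -
  have "{x\<in>T. f x \<in> B} = (\<Union>b\<in>B. {x\<in>T. f x = b})" by auto
  then show ?thesis using assms by (simp add: card_UN_disjoint disjoint_iff)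
qed

text \<open>Cauchy-Schwarz over the fibres above \<open>B\<close>; the squares of the fibre sizes
  count colliding pairs.\<close>

lemma card_fibers_le_pairs:
  assumes "finite T" "finite B"
  shows "(real (card {x\<in>T. f x \<in> B}))\<^sup>2 \<le> card B * real (card {(x, y)\<in>T \<times> T. f x = f y})"
proof -
  have "(real (card {x\<in>T. f x \<in> B}))\<^sup>2 \<le> card B * (\<Sum>b\<in>B. (real (card {x\<in>T. f x = b}))\<^sup>2)"
    using sum_squared_le_sum_of_squares[of "\<lambda>b. real (card {x\<in>T. f x = b})" B]
    by (simp add: card_fibers assms mult.commute)
  also have "(\<Sum>b\<in>B. (real (card {x\<in>T. f x = b}))\<^sup>2)
      = real (\<Sum>b\<in>B. card ({x\<in>T. f x = b} \<times> {x\<in>T. f x = b}))"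
    by (simp add: card_cartesian_product power2_eq_square)
  also have "(\<Sum>b\<in>B. card ({x\<in>T. f x = b} \<times> {x\<in>T. f x = b}))
      = card (\<Union>b\<in>B. {x\<in>T. f x = b} \<times> {x\<in>T. f x = b})"
    using assms by (intro card_UN_disjoint[symmetric]) auto
  also have "\<dots> \<le> card {(x, y)\<in>T \<times> T. f x = f y}"
  proof (rule card_mono)
    show "finite {(x, y)\<in>T \<times> T. f x = f y}"
      by (rule finite_subset[of _ "T \<times> T"]) (use assms in auto)
  qed auto
  finally show ?thesis by (simp add: mult_left_mono)
qed

text \<open>All these primes divide \<open>a - b\<close>, a nonzero integer of absolute value at
  most \<open>N\<close>.\<close>

lemma sum_ln_congruent:
  fixes a b :: int
  assumes "finite G" "\<And>p. p \<in> G \<Longrightarrow> prime p" "a \<in> {0..int N}" "b \<in> {0..int N}" "a \<noteq> b"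
  shows "(\<Sum>p | p \<in> G \<and> a mod int p = b mod int p. ln (real p)) \<le> ln N"
proof -
  have "(\<Sum>p | p \<in> G \<and> a mod int p = b mod int p. ln (real p)) \<le> ln \<bar>real_of_int (a - b)\<bar>"
    using assms by (intro sum_ln_primes_le) (auto simp: mod_eq_dvd_iff)
  also have "\<dots> \<le> ln N"
    using assms by (intro ln_mono) (auto simp: abs_if)
  finally show ?thesis .
qed

text \<open>Gallagher's double count of primes and pairs. A pair with different
  \<open>\<phi>\<close> values collides only modulo primes with
  \<open>\<Sum> ln p \<le> ln N\<close>; a pair with equal values collides modulo every prime, but
  there are at most \<open>card T * M\<close> of these.\<close>

lemma larger_sieve:
  fixes \<phi> :: "'a \<Rightarrow> int" and M :: real
  assumes "finite T" "\<phi> ` T \<subseteq> {0..int N}" "N \<ge> 1"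
    and M: "\<And>x. x \<in> T \<Longrightarrow> real (card {y\<in>T. \<phi> y = \<phi> x}) \<le> M"
    and G: "finite G" "\<And>p. p \<in> G \<Longrightarrow> prime p"
  shows "(\<Sum>p\<in>G. ln (real p) * real (card {(x, y)\<in>T \<times> T. \<phi> x mod int p = \<phi> y mod int p}))
    \<le> (card T)\<^sup>2 * ln N + card T * M * (\<Sum>p\<in>G. ln (real p))"
proof -
  let ?Q = "\<Sum>p\<in>G. ln (real p)"
  have Q0: "?Q \<ge> 0" using G(2) prime_ge_1_nat by (intro sum_nonneg) auto
  have "(\<Sum>p\<in>G. ln (real p) * real (card {(x, y)\<in>T \<times> T. \<phi> x mod int p = \<phi> y mod int p}))
      = (\<Sum>p\<in>G. \<Sum>z\<in>T \<times> T. if \<phi> (fst z) mod int p = \<phi> (snd z) mod int p then ln (real p) else 0)"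
  proof (rule sum.cong[OF refl])
    fix p
    have "{(x, y)\<in>T \<times> T. \<phi> x mod int p = \<phi> y mod int p}
        = {z \<in> T \<times> T. \<phi> (fst z) mod int p = \<phi> (snd z) mod int p}" by auto
    then show "ln (real p) * real (card {(x, y)\<in>T \<times> T. \<phi> x mod int p = \<phi> y mod int p})
      = (\<Sum>z\<in>T \<times> T. if \<phi> (fst z) mod int p = \<phi> (snd z) mod int p then ln (real p) else 0)"
      using assms(1) by (simp add: sum.If_cases Int_def)
  qed
  also have "\<dots> = (\<Sum>z\<in>T \<times> T. \<Sum>p | p \<in> G \<and> \<phi> (fst z) mod int p = \<phi> (snd z) mod int p. ln (real p))"
    using G(1) by (subst sum.swap) (simp add: sum.If_cases Int_def)
  also have "\<dots> \<le> (\<Sum>z\<in>T \<times> T. ln N + (if \<phi> (snd z) = \<phi> (fst z) then ?Q else 0))"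
  proof (rule sum_mono)
    fix z assume z: "z \<in> T \<times> T"
    show "(\<Sum>p | p \<in> G \<and> \<phi> (fst z) mod int p = \<phi> (snd z) mod int p. ln (real p))
        \<le> ln N + (if \<phi> (snd z) = \<phi> (fst z) then ?Q else 0)"
    proof (cases "\<phi> (fst z) = \<phi> (snd z)")
      case False
      have "\<phi> (fst z) \<in> {0..int N}" "\<phi> (snd z) \<in> {0..int N}" using z assms(2) by auto
      then show ?thesis using sum_ln_congruent[OF G _ _ False] False by simp
    qed (use assms(3) in auto)
  qed
  also have "\<dots> = (card T)\<^sup>2 * ln N + (\<Sum>x\<in>T. \<Sum>y\<in>T. if \<phi> y = \<phi> x then ?Q else 0)"
    by (simp add: sum.distrib card_cartesian_product power2_eq_square sum.cartesian_product case_prod_unfold)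
  also have "(\<Sum>x\<in>T. \<Sum>y\<in>T. if \<phi> y = \<phi> x then ?Q else 0) = (\<Sum>x\<in>T. card {y\<in>T. \<phi> y = \<phi> x} * ?Q)"
    using assms(1) by (simp add: sum.If_cases Int_def)
  also have "\<dots> \<le> (\<Sum>x\<in>T. M * ?Q)"
    using M Q0 by (intro sum_mono mult_right_mono) auto
  finally show ?thesis by simp
qed

text \<open>Cauchy-Schwarz and the larger sieve bound the weighted second moment of the number of
  points caught by \<open>B p\<close>; the fibre condition tames the diagonal term.
  \<open>\<delta>\<close> is chosen before \<open>D\<close>, which only affects how large
  \<open>N\<close> must be.\<close>

lemma few_residues:
  fixes e \<theta> :: real
  assumes "e > 0" "\<theta> > 0"
  shows "\<exists>\<delta>::real>0. \<forall>D. \<forall>\<^sub>F N in sequentially. \<forall>(T::'a set) (\<phi>::'a \<Rightarrow> int) (B::nat \<Rightarrow> int set).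
    finite T \<longrightarrow> \<phi> ` T \<subseteq> {0..int N} \<longrightarrow>
    (\<forall>x\<in>T. real (card {y\<in>T. \<phi> y = \<phi> x}) \<le> D * real N powr (- 2 * e) * card T) \<longrightarrow>
    (\<forall>p\<in>sieve_primes e N. finite (B p) \<and> real (card (B p)) \<le> \<delta> * p) \<longrightarrow>
    (\<Sum>p\<in>sieve_primes e N. ln (real p) / p * card {x\<in>T. \<phi> x mod int p \<in> B p}) \<le> \<theta> * total_weight e N * card T"
proof -
  \<comment> \<open>Diagonal and off-diagonal terms are each at most \<open>t^2 ln N\<close>, so the
    second moment is at most \<open>2 \<delta> t^2 ln N\<close>, while the total weight is at least
    \<open>e/4 * ln N\<close>.\<close>
  define \<delta> where "\<delta> = \<theta>\<^sup>2 * e / 8"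
  have \<delta>: "\<delta> > 0" using assms by (simp add: \<delta>_def)
  show ?thesis
  proof (intro exI[of _ \<delta>] conjI \<delta> allI)
    fix D :: real
    have "\<forall>\<^sub>F N::nat in sequentially. ln N \<ge> D" by real_asymp
    moreover have "\<forall>\<^sub>F N::nat in sequentially. N \<ge> 1" by (rule eventually_ge_at_top)
    ultimately show "\<forall>\<^sub>F N in sequentially. \<forall>(T::'a set) (\<phi>::'a \<Rightarrow> int) (B::nat \<Rightarrow> int set).
      finite T \<longrightarrow> \<phi> ` T \<subseteq> {0..int N} \<longrightarrow>
      (\<forall>x\<in>T. real (card {y\<in>T. \<phi> y = \<phi> x}) \<le> D * real N powr (- 2 * e) * card T) \<longrightarrow>
      (\<forall>p\<in>sieve_primes e N. finite (B p) \<and> real (card (B p)) \<le> \<delta> * p) \<longrightarrow>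
      (\<Sum>p\<in>sieve_primes e N. ln (real p) / p * card {x\<in>T. \<phi> x mod int p \<in> B p}) \<le> \<theta> * total_weight e N * card T"
      using total_weight_lower[OF assms(1)] sum_ln_sieve_primes_upper[OF assms(1)]
    proof eventually_elim
      case (elim N)
      let ?P = "sieve_primes e N"
      let ?Q = "\<Sum>p\<in>?P. ln (real p)"
      show ?case
      proof (intro allI impI)
        fix T :: "'a set" and \<phi> :: "'a \<Rightarrow> int" and B :: "nat \<Rightarrow> int set"
        assume T: "finite T" "\<phi> ` T \<subseteq> {0..int N}"
          and sp: "\<forall>x\<in>T. real (card {y\<in>T. \<phi> y = \<phi> x}) \<le> D * real N powr (- 2 * e) * card T"
          and B: "\<forall>p\<in>?P. finite (B p) \<and> real (card (B p)) \<le> \<delta> * p"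
        define t where "t = real (card T)"
        define Z where "Z p = real (card {x\<in>T. \<phi> x mod int p \<in> B p})" for p
        define R where "R p = real (card {(x, y)\<in>T \<times> T. \<phi> x mod int p = \<phi> y mod int p})" for p
        have w0: "0 \<le> ln (real p) / p" if "p \<in> ?P" for p using weight_nonneg[OF that] .
        show "(\<Sum>p\<in>?P. ln (real p) / p * card {x\<in>T. \<phi> x mod int p \<in> B p}) \<le> \<theta> * total_weight e N * card T"
        proof (cases "T = {}")
          case False
          then have t: "t > 0" using T by (simp add: t_def card_gt_0_iff)
          have Q0: "?Q \<ge> 0" by (intro sum_nonneg) (auto dest!: sieve_primes_ge_2)
          have D0: "D * real N powr (- 2 * e) * t * ?Q \<le> D * t"
          proof -
            \<comment> \<open>The sign of \<open>D\<close> is read off from the fibre condition at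
              any one point of \<open>T\<close>.\<close>
            obtain x where "x \<in> T" using False by auto
            then have "0 \<le> D * real N powr (- 2 * e) * t" using sp by (metis t_def of_nat_0_le_iff order_trans)
            then have D: "D \<ge> 0" using t elim by (simp add: zero_le_mult_iff)
            have "real N powr (- 2 * e) * ?Q \<le> real N powr (- 2 * e) * real N powr (2 * e)"
              using elim by (intro mult_left_mono) auto
            also have "\<dots> = 1" using elim by (simp add: powr_add[symmetric])
            finally have "(D * t) * (real N powr (- 2 * e) * ?Q) \<le> (D * t) * 1"
              using D t by (intro mult_left_mono) auto
            then show ?thesis by (simp add: mult_ac)
          qed
          have "(\<Sum>p\<in>?P. ln (real p) / p * (Z p)\<^sup>2) \<le> (\<Sum>p\<in>?P. \<delta> * (ln (real p) * R p))"
          proof (rule sum_mono)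
            fix p assume p: "p \<in> ?P"
            have "(Z p)\<^sup>2 \<le> card (B p) * R p"
              unfolding Z_def R_def using card_fibers_le_pairs[of T "B p" "\<lambda>x. \<phi> x mod int p"] T B p by blast
            also have "\<dots> \<le> \<delta> * p * R p" using B p by (intro mult_right_mono) (auto simp: R_def)
            \<comment> \<open>The factor \<open>p\<close> from \<open>card (B p)\<close> turns the
              weight \<open>ln p / p\<close> into the \<open>ln p\<close> of the larger
              sieve.\<close>
            finally have "ln (real p) / p * (Z p)\<^sup>2 \<le> ln (real p) / p * (\<delta> * p * R p)"
              using w0[OF p] by (rule mult_left_mono)
            also have "\<dots> = \<delta> * (ln (real p) * R p)" using sieve_primes_ge_2[OF p] by simp
            finally show "ln (real p) / p * (Z p)\<^sup>2 \<le> \<delta> * (ln (real p) * R p)" .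
          qed
          also have "\<dots> = \<delta> * (\<Sum>p\<in>?P. ln (real p) * R p)" by (simp add: sum_distrib_left)
          also have "\<dots> \<le> \<delta> * (t\<^sup>2 * ln N + t * (D * real N powr (- 2 * e) * t) * ?Q)"
          proof (rule mult_left_mono)
            have "real (card {y \<in> T. \<phi> y = \<phi> x}) \<le> D * real N powr (- 2 * e) * t" if "x \<in> T" for x
              using sp that by (simp add: t_def)
            from larger_sieve[OF T elim(2) this finite_sieve_primes sieve_primes_prime]
            show "(\<Sum>p\<in>?P. ln (real p) * R p) \<le> t\<^sup>2 * ln N + t * (D * real N powr (- 2 * e) * t) * ?Q"
              by (simp add: R_def t_def)
          qed (use \<delta> in simp)
          also have "\<dots> = \<delta> * (t\<^sup>2 * ln N + t * (D * real N powr (- 2 * e) * t * ?Q))" by (simp add: mult_ac)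
          also have "\<dots> \<le> \<delta> * (t\<^sup>2 * ln N + t * (D * t))"
            using \<delta> t D0 by (intro mult_left_mono add_mono) auto
          also have "\<dots> \<le> \<delta> * (t\<^sup>2 * ln N + t * (ln N * t))"
            using \<delta> t elim by (intro mult_left_mono add_mono mult_right_mono) auto
          also have "\<dots> = \<theta>\<^sup>2 * t\<^sup>2 * (e / 4 * ln N)" by (simp add: \<delta>_def power2_eq_square)
          also have "\<dots> \<le> \<theta>\<^sup>2 * t\<^sup>2 * total_weight e N"
            using elim by (intro mult_left_mono) auto
          finally have sq: "(\<Sum>p\<in>?P. ln (real p) / p * (Z p)\<^sup>2) \<le> \<theta>\<^sup>2 * t\<^sup>2 * total_weight e N" .
          \<comment> \<open>From the second moment to the first by
            \<open>Z \<le> \<theta> t / 2 + Z^2 / (2 \<theta> t)\<close>; each summand yields half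
            of the bound.\<close>
          have "(\<Sum>p\<in>?P. ln (real p) / p * Z p)
              \<le> (\<Sum>p\<in>?P. ln (real p) / p * (\<theta> / 2 * t + (Z p)\<^sup>2 / (2 * \<theta> * t)))"
          proof (rule sum_mono, rule mult_left_mono)
            fix p
            have "0 \<le> (Z p - \<theta> * t)\<^sup>2" by simp
            then have "2 * \<theta> * t * Z p \<le> (Z p)\<^sup>2 + \<theta>\<^sup>2 * t\<^sup>2" by (simp add: power2_eq_square algebra_simps)
            then show "Z p \<le> \<theta> / 2 * t + (Z p)\<^sup>2 / (2 * \<theta> * t)"
              using t assms(2) by (simp add: field_simps power2_eq_square)
          qed (use w0 in auto)
          also have "\<dots> = \<theta> / 2 * t * total_weight e N + (\<Sum>p\<in>?P. ln (real p) / p * (Z p)\<^sup>2) / (2 * \<theta> * t)"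
            by (simp add: total_weight_def prime_weight_def distrib_left sum.distrib sum_distrib_left sum_divide_distrib mult_ac)
          also have "\<dots> \<le> \<theta> / 2 * t * total_weight e N + \<theta>\<^sup>2 * t\<^sup>2 * total_weight e N / (2 * \<theta> * t)"
            using t assms(2) by (intro add_left_mono divide_right_mono sq) auto
          also have "\<dots> = \<theta> * total_weight e N * t"
            using t assms(2) by (simp add: power2_eq_square field_simps)
          finally show ?thesis by (simp add: Z_def t_def)
        qed simp
      qed
    qed
  qed
qed

section \<open>Slices, and decomposition into sets with negligible slices\<close>

definition reduce :: "nat \<Rightarrow> int list \<Rightarrow> int list" where
  "reduce p x = map (\<lambda>a. a mod int p) x"

definition slice :: "int list set \<Rightarrow> nat \<Rightarrow> int \<Rightarrow> int list set" where
  "slice T i a = {x\<in>T. x ! i = a}"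

text \<open>The factor \<open>N^(-2e)\<close> cancels the bound \<open>N^(2e)\<close> for the sum of
  \<open>ln p\<close> over the sieve primes: two points of one slice agree in coordinate
  \<open>i\<close> modulo every prime, and with this bound such pairs cost only \<open>O(D)\<close>
  against \<open>ln N\<close>.\<close>

definition spread :: "real \<Rightarrow> real \<Rightarrow> nat \<Rightarrow> nat \<Rightarrow> int list set \<Rightarrow> bool" where
  "spread D e N i T \<longleftrightarrow> (\<forall>x\<in>T. real (card (slice T i (x ! i))) \<le> D * real N powr (- 2 * e) * card T)"

lemma residue_classes_eq: "residue_classes p S = card (reduce p ` S)"
  by (simp add: residue_classes_def reduce_def)

lemma residue_classes_mono: "finite T \<Longrightarrow> S \<subseteq> T \<Longrightarrow> residue_classes p S \<le> residue_classes p T"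
  unfolding residue_classes_eq by (intro card_mono) auto

lemma finite_grid [simp]: "finite (grid d N)"
proof -
  have "grid d N \<subseteq> {x. set x \<subseteq> {0..int N} \<and> length x = d}" by (auto simp: grid_def)
  then show ?thesis by (rule finite_subset) (rule finite_lists_length_eq, simp)
qed

lemma finite_subset_grid: "S \<subseteq> grid d N \<Longrightarrow> finite S"
  by (metis finite_grid finite_subset)

lemma grid_nth: "x \<in> grid d N \<Longrightarrow> i < d \<Longrightarrow> x ! i \<in> {0..int N}"
  by (auto simp: grid_def)

lemma grid_length: "x \<in> grid d N \<Longrightarrow> length x = d"
  by (auto simp: grid_def)

lemma slice_subset: "slice T i a \<subseteq> T"
  by (auto simp: slice_def)

lemma sum_card_slices:
  assumes "finite T" "finite A"
  shows "(\<Sum>a\<in>A. real (card (slice T i a))) = real (card {x\<in>T. x ! i \<in> A})"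
  using card_fibers[OF assms, of "\<lambda>x. x ! i"] by (simp add: slice_def)

lemma sum_card_slices_le:
  assumes "finite T" "finite A"
  shows "(\<Sum>a\<in>A. real (card (slice T i a))) \<le> card T"
  using sum_card_slices[OF assms] assms(1) by (simp add: card_mono)

text \<open>Call a slice heavy if it holds more than \<open>N^(-2e) * card S\<close> points. Each
  direction has at most \<open>N^(2e)\<close> heavy slices, so at most \<open>d^d * N^(2ed)\<close>
  points lie on heavy slices in all directions, negligible against \<open>N^s\<close>. Any other
  point fits into some part; the parts may overlap.\<close>

lemma spread_decomposition:
  fixes e s \<kappa> \<rho> :: real
  assumes "e > 0" "2 * e * d < s" "\<kappa> > 0" "\<rho> > 0"
  shows "\<exists>D::real>0. \<forall>\<^sub>F N in sequentially. \<forall>S\<subseteq>grid d N. \<kappa> * real N powr s \<le> card S \<longrightarrow>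
    (\<exists>T. (\<forall>i<d. T i \<subseteq> S \<and> (T i = {} \<or> card S \<le> D * card (T i) \<and> spread D e N i (T i)))
      \<and> card (S - (\<Union>i<d. T i)) \<le> \<rho> * card S)"
proof -
  \<comment> \<open>Parts with fewer than \<open>card S / D\<close> points are replaced by the empty
    set; at most \<open>d\<close> such parts lose at most \<open>\<rho>/2 * card S\<close>
    points.\<close>
  define D where "D = 2 * real (d + 1) / \<rho>"
  have D: "D > 0" using assms by (simp add: D_def)
  show ?thesis
  proof (intro exI[of _ D] conjI D)
    have "\<forall>\<^sub>F N::nat in sequentially. real d ^ d * real N powr (2 * e * d) \<le> \<rho> / 2 * (\<kappa> * real N powr s)"
      using assms by real_asymp
    moreover have "\<forall>\<^sub>F N::nat in sequentially. N \<ge> 1" by (rule eventually_ge_at_top)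
    ultimately show "\<forall>\<^sub>F N in sequentially. \<forall>S\<subseteq>grid d N. \<kappa> * real N powr s \<le> card S \<longrightarrow>
      (\<exists>T. (\<forall>i<d. T i \<subseteq> S \<and> (T i = {} \<or> card S \<le> D * card (T i) \<and> spread D e N i (T i)))
        \<and> card (S - (\<Union>i<d. T i)) \<le> \<rho> * card S)"
    proof eventually_elim
      case (elim N)
      show ?case
      proof (intro allI impI)
        fix S assume S: "S \<subseteq> grid d N" and large: "\<kappa> * real N powr s \<le> card S"
        have fS: "finite S" using S by (rule finite_subset_grid)
        define \<mu> where "\<mu> = real N powr (- 2 * e) * card S"
        have "0 < \<kappa> * real N powr s" using assms elim by simp
        then have S0: "real (card S) > 0" using large by linarith
        then have \<mu>: "\<mu> > 0" using elim by (simp add: \<mu>_def)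
        define T0 where "T0 i = {x\<in>S. real (card (slice S i (x ! i))) \<le> \<mu>}" for i
        define T where "T i = (if card S \<le> D * card (T0 i) then T0 i else {})" for i
        define E where "E = {x\<in>S. \<forall>i<d. x \<notin> T0 i}"
        define V where "V i = {a\<in>{0..int N}. real (card (slice S i a)) > \<mu>}" for i
        have fV: "finite (V i)" for i
          unfolding V_def by (rule finite_subset[of _ "{0..int N}"]) auto
        have cV: "real (card (V i)) \<le> real N powr (2 * e)" for i
        proof -
          have "card (V i) * \<mu> = (\<Sum>a\<in>V i. \<mu>)" by simp
          also have "\<dots> \<le> (\<Sum>a\<in>V i. real (card (slice S i a)))" by (intro sum_mono) (auto simp: V_def)
          also have "\<dots> \<le> card S" by (rule sum_card_slices_le[OF fS fV])
          finally have "card (V i) * \<mu> \<le> card S" .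
          then have "card (V i) * real N powr (- 2 * e) \<le> 1" using S0 by (simp add: \<mu>_def)
          then show ?thesis using elim by (simp add: powr_minus field_simps)
        qed
        \<comment> \<open>An exceptional point is a word of length \<open>d\<close> over the heavy
          coordinate values; using one alphabet for all coordinates costs the factor
          \<open>d^d\<close>.\<close>
        have "E \<subseteq> {x. set x \<subseteq> (\<Union>i<d. V i) \<and> length x = d}"
        proof
          fix x assume x: "x \<in> E"
          then have xg: "x \<in> grid d N" using S by (auto simp: E_def)
          have "x ! i \<in> V i" if "i < d" for i
            using x grid_nth[OF xg that] that by (auto simp: E_def V_def T0_def)
          then show "x \<in> {x. set x \<subseteq> (\<Union>i<d. V i) \<and> length x = d}"
            using grid_length[OF xg] by (fastforce simp: in_set_conv_nth)
        qed
        then have "card E \<le> card {x. set x \<subseteq> (\<Union>i<d. V i) \<and> length x = d}"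
          by (intro card_mono finite_lists_length_eq) (auto simp: fV)
        also have "\<dots> = card (\<Union>i<d. V i) ^ d"
          by (rule card_lists_length_eq) (auto simp: fV)
        finally have "real (card E) \<le> real (card (\<Union>i<d. V i)) ^ d" by (metis of_nat_le_iff of_nat_power)
        also have "\<dots> \<le> (d * real N powr (2 * e)) ^ d"
        proof (rule power_mono)
          have "real (card (\<Union>i<d. V i)) \<le> (\<Sum>i<d. real (card (V i)))"
            using card_UN_le[of "{..<d}" V] by (metis finite_lessThan of_nat_le_iff of_nat_sum)
          also have "\<dots> \<le> (\<Sum>i<d. real N powr (2 * e))" by (intro sum_mono cV)
          finally show "real (card (\<Union>i<d. V i)) \<le> d * real N powr (2 * e)" by simp
        qed auto
        also have "\<dots> = real d ^ d * real N powr (2 * e * d)"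
          using elim by (simp add: power_mult_distrib powr_powr powr_realpow[symmetric])
        also have "\<dots> \<le> \<rho> / 2 * card S" using elim large assms by (smt (verit) mult_left_mono half_gt_zero)
        finally have cE: "real (card E) \<le> \<rho> / 2 * card S" .
        have cT: "real (card (T0 i - T i)) \<le> \<rho> / (2 * (d + 1)) * card S" for i
        proof (cases "card S \<le> D * card (T0 i)")
          case False
          then have "real (card (T0 i)) \<le> card S / D" using D by (simp add: field_simps)
          then show ?thesis using False by (simp add: T_def D_def mult.commute)
        qed (use assms in \<open>auto simp: T_def\<close>)
        have "S - (\<Union>i<d. T i) \<subseteq> E \<union> (\<Union>i<d. T0 i - T i)" by (auto simp: E_def)
        then have "card (S - (\<Union>i<d. T i)) \<le> card (E \<union> (\<Union>i<d. T0 i - T i))"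
          by (intro card_mono) (use fS in \<open>auto simp: E_def T0_def\<close>)
        also have "\<dots> \<le> card E + (\<Sum>i<d. card (T0 i - T i))"
          by (intro order_trans[OF card_Un_le] add_left_mono card_UN_le) auto
        finally have "real (card (S - (\<Union>i<d. T i))) \<le> card E + (\<Sum>i<d. real (card (T0 i - T i)))"
          by (metis of_nat_add of_nat_le_iff of_nat_sum)
        also have "\<dots> \<le> \<rho> / 2 * card S + (\<Sum>i<d. \<rho> / (2 * (d + 1)) * card S)"
          by (intro add_mono cE sum_mono cT)
        also have "\<dots> \<le> \<rho> * card S"
        proof -
          have "real d * (\<rho> / (2 * (d + 1))) \<le> \<rho> / 2" using assms by (simp add: field_simps)
          then have "real d * (\<rho> / (2 * (d + 1))) * card S \<le> \<rho> / 2 * card S" by (rule mult_right_mono) auto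
          moreover have "(\<Sum>i<d. \<rho> / (2 * (d + 1)) * card S) = real d * (\<rho> / (2 * (d + 1))) * card S" by simp
          ultimately show ?thesis by linarith
        qed
        finally have rem: "real (card (S - (\<Union>i<d. T i))) \<le> \<rho> * card S" .
        have "T i \<subseteq> S \<and> (T i = {} \<or> card S \<le> D * card (T i) \<and> spread D e N i (T i))" for i
        proof (cases "card S \<le> D * card (T0 i)")
          case True
          have "spread D e N i (T0 i)" unfolding spread_def
          proof
            fix x assume x: "x \<in> T0 i"
            have "card (slice (T0 i) i (x ! i)) \<le> card (slice S i (x ! i))"
              by (intro card_mono) (use fS in \<open>auto simp: T0_def slice_def\<close>)
            also have "real \<dots> \<le> \<mu>" using x by (simp add: T0_def)
            \<comment> \<open>\<open>\<mu>\<close> is measured against \<open>S\<close>; the lower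
              bound on the size of the part makes it relative to the part.\<close>
            also have "\<dots> \<le> real N powr (- 2 * e) * (D * card (T0 i))"
              unfolding \<mu>_def using True by (rule mult_left_mono) auto
            finally show "real (card (slice (T0 i) i (x ! i))) \<le> D * real N powr (- 2 * e) * card (T0 i)"
              by (simp add: mult_ac)
          qed
          then show ?thesis using True by (auto simp: T_def T0_def)
        qed (auto simp: T_def)
        with rem show "\<exists>T. (\<forall>i<d. T i \<subseteq> S \<and> (T i = {} \<or> card S \<le> D * card (T i) \<and> spread D e N i (T i)))
          \<and> card (S - (\<Union>i<d. T i)) \<le> \<rho> * card S" by blast
      qed
    qed
  qed
qed

section \<open>Dispersion of large sets\<close>

text \<open>For most primes, no sizeable part of \<open>S\<close> fits into \<open>\<delta> p^k\<close> residue classes.\<close>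
definition dispersed :: "real \<Rightarrow> real \<Rightarrow> nat \<Rightarrow> real \<Rightarrow> nat \<Rightarrow> int list set \<Rightarrow> bool" where
  "dispersed \<delta> \<theta> k e N S \<longleftrightarrow> (\<forall>U. (\<forall>p\<in>sieve_primes e N. U p \<subseteq> S \<and> real (residue_classes p (U p)) \<le> \<delta> * real p ^ k)
    \<longrightarrow> (\<Sum>p\<in>sieve_primes e N. ln (real p) / p * card (U p)) \<le> \<theta> * total_weight e N * card S)"

lemma dispersedD:
  assumes "dispersed \<delta> \<theta> k e N S"
    and "\<And>p. p \<in> sieve_primes e N \<Longrightarrow> U p \<subseteq> S"
    and "\<And>p. p \<in> sieve_primes e N \<Longrightarrow> real (residue_classes p (U p)) \<le> \<delta> * real p ^ k"
  shows "(\<Sum>p\<in>sieve_primes e N. ln (real p) / p * card (U p)) \<le> \<theta> * total_weight e N * card S"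
  using assms unfolding dispersed_def by blast

lemma total_weight_nonneg: "total_weight e N \<ge> 0"
  unfolding total_weight_def prime_weight_def by (intro sum_nonneg weight_nonneg)

text \<open>Points with different residues in coordinate \<open>i\<close> have different reductions,
  so the classes above the various \<open>b\<close> are disjoint and their numbers add up.\<close>

lemma card_fat_residues:
  fixes \<beta> :: real
  assumes "U \<subseteq> grid d N" "i < d"
  shows "card {b\<in>{0..<int p}. real (residue_classes p {x\<in>U. x ! i mod int p = b}) > \<beta>} * \<beta>
    \<le> residue_classes p U"
proof -
  let ?B = "{b\<in>{0..<int p}. real (residue_classes p {x\<in>U. x ! i mod int p = b}) > \<beta>}"
  let ?F = "\<lambda>b. reduce p ` {x\<in>U. x ! i mod int p = b}"
  have fU: "finite U" by (rule finite_subset_grid[OF assms(1)])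
  have fB: "finite ?B" by (rule finite_subset[of _ "{0..<int p}"]) auto
  have nth: "reduce p x ! i = x ! i mod int p" if "x \<in> U" for x
    using grid_length[of x d N] that assms by (auto simp: reduce_def)
  have disj: "?F b \<inter> ?F c = {}" if "b \<noteq> c" for b c
  proof (rule ccontr)
    assume "?F b \<inter> ?F c \<noteq> {}"
    then obtain x y where "x \<in> U" "y \<in> U" "x ! i mod int p = b" "y ! i mod int p = c" "reduce p x = reduce p y"
      by (auto simp: set_eq_iff)
    then show False using nth that by metis
  qed
  have "card ?B * \<beta> = (\<Sum>b\<in>?B. \<beta>)" by simp
  also have "\<dots> \<le> (\<Sum>b\<in>?B. real (card (?F b)))"
    by (intro sum_mono) (auto simp: residue_classes_eq)
  also have "\<dots> = real (card (\<Union>b\<in>?B. ?F b))"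
    using fB fU disj by (subst card_UN_disjoint) auto
  also have "\<dots> \<le> card (reduce p ` U)"
    using fU by (intro of_nat_mono card_mono) auto
  finally show ?thesis by (simp add: residue_classes_eq)
qed

text \<open>The coordinate takes at most \<open>N + 1 \<le> 2 N\<close> values, each accounting for
  fewer than \<open>K\<close> points.\<close>

lemma card_small_slices:
  fixes K :: real
  assumes "T \<subseteq> grid d N" "i < d" "N \<ge> 1" "K \<ge> 0"
  shows "real (card {x\<in>T. real (card (slice T i (x ! i))) < K}) \<le> 2 * real N * K"
proof -
  let ?A = "{a\<in>{0..int N}. real (card (slice T i a)) < K}"
  have fT: "finite T" by (rule finite_subset_grid[OF assms(1)])
  have fA: "finite ?A" by (rule finite_subset[of _ "{0..int N}"]) auto
  have "{x\<in>T. real (card (slice T i (x ! i))) < K} \<subseteq> {x\<in>T. x ! i \<in> ?A}"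
    using grid_nth assms by blast
  then have "real (card {x\<in>T. real (card (slice T i (x ! i))) < K}) \<le> real (card {x\<in>T. x ! i \<in> ?A})"
    using fT by (intro of_nat_mono card_mono) auto
  also have "\<dots> = (\<Sum>a\<in>?A. real (card (slice T i a)))"
    by (rule sum_card_slices[OF fT fA, symmetric])
  also have "\<dots> \<le> (\<Sum>a\<in>?A. K)" by (intro sum_mono) auto
  also have "\<dots> = card ?A * K" by simp
  also have "\<dots> \<le> real (card {0..int N}) * K"
    using assms(4) by (intro mult_right_mono of_nat_mono card_mono) auto
  also have "\<dots> \<le> 2 * real N * K" using assms(3,4) by (intro mult_right_mono) auto
  finally show ?thesis .
qed

lemma powr_small_slices:
  assumes "N \<ge> 1"
  shows "2 * real N * (\<kappa> * real N powr (real k - 1 + s)) = 2 * \<kappa> * real N powr (real k + s)"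
proof -
  have "real N powr (real k + s) = real N powr 1 * real N powr (real k - 1 + s)"
    unfolding powr_add[symmetric] by (simp add: algebra_simps)
  then show ?thesis using assms by simp
qed

text \<open>For each \<open>p\<close> the points of \<open>U p\<close> are of three kinds. Those
  over residues above which \<open>U p\<close> has many classes lie over few residues, so
  \<open>few_residues\<close> applies. Those on small slices are few. The remaining points on any
  one slice occupy few classes, and that slice is dispersed by \<open>IH\<close>.\<close>

lemma dispersed_step_spread:
  fixes e s \<kappa> \<theta> D :: real
  assumes "e > 0" "\<kappa> > 0" "\<theta> > 0"
    and IH: "\<And>\<kappa> \<theta>::real. \<kappa> > 0 \<Longrightarrow> \<theta> > 0 \<Longrightarrow> \<exists>\<delta>::real>0. \<forall>\<^sub>F N in sequentially. \<forall>S\<subseteq>grid d N.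
      \<kappa> * real N powr (real k - 1 + s) \<le> card S \<longrightarrow> dispersed \<delta> \<theta> k e N S"
  shows "\<exists>\<delta>::real>0. \<forall>\<^sub>F N in sequentially. \<forall>i<d. \<forall>T\<subseteq>grid d N.
      \<kappa> * real N powr (real k + s) \<le> card T \<longrightarrow> spread D e N i T \<longrightarrow> dispersed \<delta> \<theta> (Suc k) e N T"
proof -
  \<comment> \<open>Slices with fewer than \<open>K\<close> points hold at most \<open>2 N K\<close>
    points, which this choice makes \<open>\<theta>/3 * \<kappa> * N^(k + s)\<close>.\<close>
  define \<kappa>1 where "\<kappa>1 = \<kappa> * \<theta> / 6"
  have \<kappa>1: "\<kappa>1 > 0" "\<theta> / 3 > 0" using assms by (auto simp: \<kappa>1_def)
  obtain \<delta>1 :: real where \<delta>1: "\<delta>1 > 0" and ev1: "\<forall>\<^sub>F N in sequentially. \<forall>S\<subseteq>grid d N.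
      \<kappa>1 * real N powr (real k - 1 + s) \<le> card S \<longrightarrow> dispersed \<delta>1 (\<theta> / 3) k e N S"
    using IH[OF \<kappa>1] by blast
  obtain \<delta>2 :: real where \<delta>2: "\<delta>2 > 0" and ev2: "\<forall>\<^sub>F N in sequentially. \<forall>(T::int list set) (\<phi>::int list \<Rightarrow> int) (B::nat \<Rightarrow> int set).
    finite T \<longrightarrow> \<phi> ` T \<subseteq> {0..int N} \<longrightarrow>
    (\<forall>x\<in>T. real (card {y\<in>T. \<phi> y = \<phi> x}) \<le> D * real N powr (- 2 * e) * card T) \<longrightarrow>
    (\<forall>p\<in>sieve_primes e N. finite (B p) \<and> real (card (B p)) \<le> \<delta>2 * p) \<longrightarrow>
    (\<Sum>p\<in>sieve_primes e N. ln (real p) / p * card {x\<in>T. \<phi> x mod int p \<in> B p}) \<le> \<theta> / 3 * total_weight e N * card T"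
    using few_residues[OF assms(1) \<kappa>1(2)] by blast
  have ev3: "\<forall>\<^sub>F N::nat in sequentially. N \<ge> 1" by (rule eventually_ge_at_top)
  show ?thesis
  proof (intro exI[of _ "\<delta>1 * \<delta>2"] conjI)
    show "\<forall>\<^sub>F N in sequentially. \<forall>i<d. \<forall>T\<subseteq>grid d N.
      \<kappa> * real N powr (real k + s) \<le> card T \<longrightarrow> spread D e N i T \<longrightarrow> dispersed (\<delta>1 * \<delta>2) \<theta> (Suc k) e N T"
      using ev1 ev2 ev3
    proof eventually_elim
      case (elim N)
      let ?P = "sieve_primes e N" and ?W = "total_weight e N"
      show ?case unfolding dispersed_def
      proof (intro allI impI)
        fix i T U
        assume i: "i < d" and T: "T \<subseteq> grid d N" and large: "\<kappa> * real N powr (real k + s) \<le> card T"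
          and sp: "spread D e N i T"
          and U: "\<forall>p\<in>?P. U p \<subseteq> T \<and> real (residue_classes p (U p)) \<le> \<delta>1 * \<delta>2 * real p ^ Suc k"
        have fT: "finite T" by (rule finite_subset_grid[OF T])
        define K where "K = \<kappa>1 * real N powr (real k - 1 + s)"
        have K0: "K \<ge> 0" using \<kappa>1 by (simp add: K_def)
        \<comment> \<open>As \<open>U p\<close> has at most
          \<open>\<delta>1 \<delta>2 p^(k+1)\<close> classes in all, at most
          \<open>\<delta>2 p\<close> residues can qualify.\<close>
        define B where "B p = {b\<in>{0..<int p}. real (residue_classes p {x\<in>U p. x ! i mod int p = b}) > \<delta>1 * real p ^ k}" for p
        define Sm where "Sm = {x\<in>T. real (card (slice T i (x ! i))) < K}"
        define A where "A = {a\<in>{0..int N}. real (card (slice T i a)) \<ge> K}"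
        define V where "V a p = {x\<in>U p. x ! i = a \<and> a mod int p \<notin> B p}" for a p
        have fA: "finite A" unfolding A_def by (rule finite_subset[of _ "{0..int N}"]) auto
        have w0: "0 \<le> ln (real p) / p" if "p \<in> ?P" for p using weight_nonneg[OF that] .
        have fat: "(\<Sum>p\<in>?P. ln (real p) / p * card {x\<in>T. x ! i mod int p \<in> B p}) \<le> \<theta> / 3 * ?W * card T"
        proof -
          have "real (card (B p)) \<le> \<delta>2 * p" if p: "p \<in> ?P" for p
          proof -
            have "card (B p) * (\<delta>1 * real p ^ k) \<le> residue_classes p (U p)"
              unfolding B_def by (rule card_fat_residues[OF _ i]) (use U p T in blast)
            also have "\<dots> \<le> \<delta>1 * \<delta>2 * real p ^ Suc k" using U p by blast
            finally have "card (B p) * (\<delta>1 * real p ^ k) \<le> (\<delta>2 * p) * (\<delta>1 * real p ^ k)" by (simp add: mult_ac)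
            then show ?thesis
              using \<delta>1 sieve_primes_ge_2[OF p] by (subst (asm) mult_le_cancel_right_pos) auto
          qed
          moreover have "finite (B p)" for p
            unfolding B_def by (rule finite_subset[of _ "{0..<int p}"]) auto
          moreover have "(\<lambda>x. x ! i) ` T \<subseteq> {0..int N}" using T grid_nth[OF _ i] by blast
          ultimately show ?thesis
            using elim(2)[rule_format, of T "\<lambda>x. x ! i" B] fT sp unfolding spread_def slice_def by blast
        qed
        have small: "real (card Sm) \<le> \<theta> / 3 * card T"
        proof -
          have "real (card Sm) \<le> 2 * real N * K"
            unfolding Sm_def by (rule card_small_slices[OF T i elim(3) K0])
          also have "\<dots> = \<theta> / 3 * (\<kappa> * real N powr (real k + s))"
            unfolding K_def powr_small_slices[OF elim(3)] by (simp add: \<kappa>1_def)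
          also have "\<dots> \<le> \<theta> / 3 * card T" using large assms by (intro mult_left_mono) auto
          finally show ?thesis .
        qed
        have thin: "(\<Sum>p\<in>?P. ln (real p) / p * card (V a p)) \<le> \<theta> / 3 * ?W * card (slice T i a)" if a: "a \<in> A" for a
        proof -
          have "real (residue_classes p (V a p)) \<le> \<delta>1 * real p ^ k" if p: "p \<in> ?P" for p
          proof (cases "a mod int p \<in> B p")
            case True
            then show ?thesis using \<delta>1 by (simp add: V_def residue_classes_eq)
          next
            case False
            have "finite (U p)" using U p fT finite_subset by blast
            then have "residue_classes p (V a p) \<le> residue_classes p {x\<in>U p. x ! i mod int p = a mod int p}"
              by (intro residue_classes_mono) (auto simp: V_def)
            also have "real \<dots> \<le> \<delta>1 * real p ^ k"
              using False sieve_primes_ge_2[OF p] by (auto simp: B_def not_less)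
            finally show ?thesis by simp
          qed
          moreover have "V a p \<subseteq> slice T i a" if "p \<in> ?P" for p
            using U that by (auto simp: V_def slice_def)
          moreover have "dispersed \<delta>1 (\<theta> / 3) k e N (slice T i a)"
            using elim(1) a T slice_subset[of T i a] unfolding A_def K_def by blast
          ultimately show ?thesis by (intro dispersedD)
        qed
        have "(\<Sum>p\<in>?P. ln (real p) / p * card (U p))
          \<le> (\<Sum>p\<in>?P. ln (real p) / p * (card {x\<in>T. x ! i mod int p \<in> B p} + card Sm + (\<Sum>a\<in>A. card (V a p))))"
        proof (rule sum_mono, rule mult_left_mono)
          fix p assume p: "p \<in> ?P"
          have "U p \<subseteq> {x\<in>T. x ! i mod int p \<in> B p} \<union> Sm \<union> (\<Union>a\<in>A. V a p)"
          proof
            fix x assume x: "x \<in> U p"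
            then have "x \<in> T" "x ! i \<in> {0..int N}" using U p T grid_nth[OF _ i] by blast+
            then show "x \<in> {x\<in>T. x ! i mod int p \<in> B p} \<union> Sm \<union> (\<Union>a\<in>A. V a p)"
              using x by (auto simp: Sm_def A_def V_def not_less)
          qed
          then have "card (U p) \<le> card ({x\<in>T. x ! i mod int p \<in> B p} \<union> Sm \<union> (\<Union>a\<in>A. V a p))"
            by (rule card_mono[rotated]) (use fT fA U p in \<open>auto simp: Sm_def V_def intro: finite_subset\<close>)
          also have "\<dots> \<le> card {x\<in>T. x ! i mod int p \<in> B p} + card Sm + card (\<Union>a\<in>A. V a p)"
            by (meson card_Un_le add_right_mono order_trans)
          also have "card (\<Union>a\<in>A. V a p) \<le> (\<Sum>a\<in>A. card (V a p))" by (rule card_UN_le[OF fA])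
          finally show "real (card (U p)) \<le> real (card {x\<in>T. x ! i mod int p \<in> B p} + card Sm + (\<Sum>a\<in>A. card (V a p)))"
            by (simp only: of_nat_le_iff)
        qed (use w0 in auto)
        also have "\<dots> = (\<Sum>p\<in>?P. ln (real p) / p * card {x\<in>T. x ! i mod int p \<in> B p}) + ?W * card Sm
            + (\<Sum>p\<in>?P. \<Sum>a\<in>A. ln (real p) / p * card (V a p))"
          by (simp add: distrib_left sum.distrib total_weight_def prime_weight_def sum_distrib_right sum_distrib_left)
        also have "(\<Sum>p\<in>?P. \<Sum>a\<in>A. ln (real p) / p * card (V a p))
            = (\<Sum>a\<in>A. \<Sum>p\<in>?P. ln (real p) / p * card (V a p))" by (rule sum.swap)
        also have "\<dots> \<le> (\<Sum>a\<in>A. \<theta> / 3 * ?W * card (slice T i a))" by (intro sum_mono thin)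
        also have "\<dots> = \<theta> / 3 * ?W * (\<Sum>a\<in>A. real (card (slice T i a)))" by (simp add: sum_distrib_left)
        also have "\<dots> \<le> \<theta> / 3 * ?W * card T"
          using total_weight_nonneg assms by (intro mult_left_mono sum_card_slices_le fT fA) auto
        also have "?W * card Sm \<le> ?W * (\<theta> / 3 * card T)"
          using small total_weight_nonneg by (rule mult_left_mono)
        finally show "(\<Sum>p\<in>?P. ln (real p) / p * card (U p)) \<le> \<theta> * ?W * card T"
          using fat by (simp add: algebra_simps)
      qed
    qed
  qed (use \<delta>1 \<delta>2 in auto)
qed

lemma powr_add_ge:
  assumes "N \<ge> 1" shows "real N powr s \<le> real N powr (real k + s)"
  using assms by (intro powr_mono) auto

text \<open>Cutting a spread part into about \<open>N\<close> slices lowers the exponent of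
  \<open>N\<close> by one together with \<open>k\<close>, while the surplus \<open>s\<close> stays
  the same; the condition \<open>2 e d < s\<close> therefore serves at every level of the
  induction.\<close>

lemma large_imp_dispersed:
  fixes e s :: real
  assumes "e > 0" "2 * e * d < s" "\<kappa> > 0" "\<theta> > 0"
  shows "\<exists>\<delta>::real>0. \<forall>\<^sub>F N in sequentially. \<forall>S\<subseteq>grid d N.
      \<kappa> * real N powr (real k - 1 + s) \<le> card S \<longrightarrow> dispersed \<delta> \<theta> k e N S"
  using assms(3,4)
proof (induction k arbitrary: \<kappa> \<theta>)
  case 0
  show ?case
  \<comment> \<open>Fewer than one residue class means that \<open>U p\<close> is empty.\<close>
  proof (intro exI[of _ "1/2"] conjI)
    have "\<forall>\<^sub>F N::nat in sequentially. N \<ge> 1" by (rule eventually_ge_at_top)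
    then show "\<forall>\<^sub>F N in sequentially. \<forall>S\<subseteq>grid d N.
      \<kappa> * real N powr (real 0 - 1 + s) \<le> card S \<longrightarrow> dispersed (1/2) \<theta> 0 e N S"
    proof eventually_elim
      case (elim N)
      show ?case unfolding dispersed_def
      proof (intro allI impI)
        fix S U
        assume S: "S \<subseteq> grid d N" and U: "\<forall>p\<in>sieve_primes e N. U p \<subseteq> S \<and> residue_classes p (U p) \<le> 1/2 * real p ^ 0"
        have "card (U p) = 0" if "p \<in> sieve_primes e N" for p
        proof -
          have "finite (U p)" using U S that finite_subset_grid by blast
          moreover have "card (reduce p ` U p) = 0" using U that by (auto simp: residue_classes_eq)
          ultimately show ?thesis by simp
        qed
        then have "(\<Sum>p\<in>sieve_primes e N. ln (real p) / p * card (U p)) = 0" by simp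
        also have "0 \<le> \<theta> * total_weight e N * card S"
          using total_weight_nonneg[of e N] 0 by simp
        finally show "(\<Sum>p\<in>sieve_primes e N. ln (real p) / p * card (U p)) \<le> \<theta> * total_weight e N * card S" .
      qed
    qed
  qed simp
next
  case (Suc k)
  have "\<theta> / 2 > 0" using Suc.prems by simp
  from spread_decomposition[OF assms(1,2) Suc.prems(1) this] obtain D :: real where D: "D > 0"
    and ev1: "\<forall>\<^sub>F N in sequentially. \<forall>S\<subseteq>grid d N. \<kappa> * real N powr s \<le> card S \<longrightarrow>
    (\<exists>T. (\<forall>i<d. T i \<subseteq> S \<and> (T i = {} \<or> card S \<le> D * card (T i) \<and> spread D e N i (T i)))
      \<and> card (S - (\<Union>i<d. T i)) \<le> \<theta> / 2 * card S)" by blast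
  \<comment> \<open>Half of \<open>\<theta>\<close> pays for the points outside all parts, the other
    half is shared by the parts; \<open>d + 1\<close> keeps \<open>\<theta>1\<close> positive when
    \<open>d = 0\<close>.\<close>
  define \<theta>1 where "\<theta>1 = \<theta> / (2 * (d + 1))"
  have *: "\<kappa> / D > 0" "\<theta>1 > 0" using Suc.prems D by (auto simp: \<theta>1_def)
  from dispersed_step_spread[OF assms(1) * Suc.IH, of D] obtain \<delta> :: real where \<delta>: "\<delta> > 0"
    and ev2: "\<forall>\<^sub>F N in sequentially. \<forall>i<d. \<forall>T\<subseteq>grid d N.
      \<kappa> / D * real N powr (real k + s) \<le> card T \<longrightarrow> spread D e N i T \<longrightarrow> dispersed \<delta> \<theta>1 (Suc k) e N T"
    by blast
  have ev3: "\<forall>\<^sub>F N::nat in sequentially. N \<ge> 1" by (rule eventually_ge_at_top)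
  show ?case
  proof (intro exI[of _ \<delta>] conjI \<delta>)
    show "\<forall>\<^sub>F N in sequentially. \<forall>S\<subseteq>grid d N.
      \<kappa> * real N powr (real (Suc k) - 1 + s) \<le> card S \<longrightarrow> dispersed \<delta> \<theta> (Suc k) e N S"
      using ev1 ev2 ev3
    proof eventually_elim
      case (elim N)
      let ?P = "sieve_primes e N" and ?W = "total_weight e N"
      show ?case unfolding dispersed_def
      proof (intro allI impI)
        fix S U
        assume S: "S \<subseteq> grid d N" and large: "\<kappa> * real N powr (real (Suc k) - 1 + s) \<le> card S"
          and U: "\<forall>p\<in>?P. U p \<subseteq> S \<and> real (residue_classes p (U p)) \<le> \<delta> * real p ^ Suc k"
        have fS: "finite S" by (rule finite_subset_grid[OF S])
        have large': "\<kappa> * real N powr (real k + s) \<le> card S" using large by simp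
        have "\<kappa> * real N powr s \<le> \<kappa> * real N powr (real k + s)"
          using powr_add_ge[OF elim(3)] Suc.prems by (intro mult_left_mono) auto
        then have "\<kappa> * real N powr s \<le> card S" using large' by linarith
        from elim(1)[rule_format, OF S this] obtain T where T: "\<And>i. i < d \<Longrightarrow> T i \<subseteq> S \<and> (T i = {} \<or> card S \<le> D * card (T i) \<and> spread D e N i (T i))"
          and rem: "card (S - (\<Union>i<d. T i)) \<le> \<theta> / 2 * card S"
          by blast
        have w0: "0 \<le> ln (real p) / p" if "p \<in> ?P" for p using weight_nonneg[OF that] .
        have part: "(\<Sum>p\<in>?P. ln (real p) / p * card (U p \<inter> T i)) \<le> \<theta>1 * ?W * card S" if i: "i < d" for i
        proof (cases "T i = {}")
          case True
          then show ?thesis using total_weight_nonneg[of e N] * by simp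
        next
          case False
          then have "card S \<le> D * card (T i)" "spread D e N i (T i)" using T[OF i] by auto
          moreover from this have "\<kappa> / D * real N powr (real k + s) \<le> card (T i)"
            using large' D by (simp add: field_simps)
          ultimately have "dispersed \<delta> \<theta>1 (Suc k) e N (T i)"
            using elim(2) i T[OF i] S by blast
          moreover have "real (residue_classes p (U p \<inter> T i)) \<le> \<delta> * real p ^ Suc k" if p: "p \<in> ?P" for p
          proof -
            have "finite (U p)" using U p fS finite_subset by blast
            then have "residue_classes p (U p \<inter> T i) \<le> residue_classes p (U p)"
              by (intro residue_classes_mono) auto
            also have "real (residue_classes p (U p)) \<le> \<delta> * real p ^ Suc k" using U p by blast
            finally show ?thesis by simp
          qed
          ultimately have "(\<Sum>p\<in>?P. ln (real p) / p * card (U p \<inter> T i)) \<le> \<theta>1 * ?W * card (T i)"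
            by (intro dispersedD) auto
          also have "\<dots> \<le> \<theta>1 * ?W * card S"
            using total_weight_nonneg[of e N] * T[OF i] fS by (intro mult_left_mono of_nat_mono card_mono) auto
          finally show ?thesis .
        qed
        have "(\<Sum>p\<in>?P. ln (real p) / p * card (U p))
          \<le> (\<Sum>p\<in>?P. ln (real p) / p * (card (S - (\<Union>i<d. T i)) + (\<Sum>i<d. card (U p \<inter> T i))))"
        proof (rule sum_mono, rule mult_left_mono)
          fix p assume p: "p \<in> ?P"
          have "U p \<subseteq> (S - (\<Union>i<d. T i)) \<union> (\<Union>i<d. U p \<inter> T i)" using U p by blast
          then have "card (U p) \<le> card ((S - (\<Union>i<d. T i)) \<union> (\<Union>i<d. U p \<inter> T i))"
            by (rule card_mono[rotated]) (use fS U p in \<open>auto intro: finite_subset\<close>)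
          also have "\<dots> \<le> card (S - (\<Union>i<d. T i)) + (\<Sum>i<d. card (U p \<inter> T i))"
            by (intro order_trans[OF card_Un_le] add_left_mono card_UN_le) auto
          finally show "real (card (U p)) \<le> real (card (S - (\<Union>i<d. T i)) + (\<Sum>i<d. card (U p \<inter> T i)))"
            by (simp only: of_nat_le_iff)
        qed (use w0 in auto)
        also have "\<dots> = ?W * card (S - (\<Union>i<d. T i)) + (\<Sum>p\<in>?P. \<Sum>i<d. ln (real p) / p * card (U p \<inter> T i))"
          by (simp add: distrib_left sum.distrib total_weight_def prime_weight_def sum_distrib_right sum_distrib_left)
        also have "(\<Sum>p\<in>?P. \<Sum>i<d. ln (real p) / p * card (U p \<inter> T i))
          = (\<Sum>i<d. \<Sum>p\<in>?P. ln (real p) / p * card (U p \<inter> T i))" by (rule sum.swap)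
        also have "\<dots> \<le> (\<Sum>i<d. \<theta>1 * ?W * card S)" by (intro sum_mono part) auto
        also have "\<dots> = (d * \<theta>1) * (?W * card S)" by simp
        also have "\<dots> \<le> \<theta> / 2 * (?W * card S)"
          using total_weight_nonneg[of e N] Suc.prems
          by (intro mult_right_mono) (auto simp: \<theta>1_def field_simps)
        also have "?W * card (S - (\<Union>i<d. T i)) \<le> ?W * (\<theta> / 2 * card S)"
          using rem total_weight_nonneg by (rule mult_left_mono)
        finally show "(\<Sum>p\<in>?P. ln (real p) / p * card (U p)) \<le> \<theta> * ?W * card S"
          by (simp add: algebra_simps)
      qed
    qed
  qed
qed

section \<open>Covering by few slices\<close>

text \<open>Hits are measured in points rather than slices: divided by \<open>card T\<close>, the
  size is the probability that the slice through a random point of \<open>T\<close> meets the class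
  of \<open>x\<close>.\<close>

definition slice_hits :: "int list set \<Rightarrow> nat \<Rightarrow> nat \<Rightarrow> int list \<Rightarrow> int list set" where
  "slice_hits T i p x = {y\<in>T. \<exists>z\<in>T. z ! i = y ! i \<and> reduce p z = reduce p x}"

text \<open>Double counting of pairs of a point \<open>y\<close> and a class that \<open>U\<close>
  has on the slice of \<open>y\<close>: each class of \<open>U\<close> is counted for at most
  \<open>b\<close> points \<open>y\<close>.\<close>

lemma sum_residue_classes_slices:
  fixes b :: real
  assumes "finite T" "U \<subseteq> T"
    and b: "\<And>x. x \<in> U \<Longrightarrow> real (card (slice_hits T i p x)) \<le> b"
  shows "(\<Sum>y\<in>T. real (residue_classes p (U \<inter> slice T i (y ! i)))) \<le> residue_classes p U * b"
proof -
  have fU: "finite U" using assms finite_subset by blast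
  have "(\<Sum>y\<in>T. real (residue_classes p (U \<inter> slice T i (y ! i))))
      = (\<Sum>y\<in>T. \<Sum>\<xi>\<in>reduce p ` U. if \<xi> \<in> reduce p ` (U \<inter> slice T i (y ! i)) then 1 else 0)"
  proof (rule sum.cong[OF refl])
    fix y
    have "{\<xi>\<in>reduce p ` U. \<xi> \<in> reduce p ` (U \<inter> slice T i (y ! i))} = reduce p ` (U \<inter> slice T i (y ! i))" by auto
    then show "real (residue_classes p (U \<inter> slice T i (y ! i)))
      = (\<Sum>\<xi>\<in>reduce p ` U. if \<xi> \<in> reduce p ` (U \<inter> slice T i (y ! i)) then 1 else 0)"
      using fU by (simp add: residue_classes_eq sum.If_cases Int_def)
  qed
  also have "\<dots> = (\<Sum>\<xi>\<in>reduce p ` U. real (card {y\<in>T. \<xi> \<in> reduce p ` (U \<inter> slice T i (y ! i))}))"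
    using assms(1) by (subst sum.swap) (simp add: sum.If_cases Int_def)
  also have "\<dots> \<le> (\<Sum>\<xi>\<in>reduce p ` U. b)"
  proof (rule sum_mono)
    fix \<xi> assume "\<xi> \<in> reduce p ` U"
    then obtain x where x: "x \<in> U" "\<xi> = reduce p x" by auto
    have "{y\<in>T. \<xi> \<in> reduce p ` (U \<inter> slice T i (y ! i))} \<subseteq> slice_hits T i p x"
      using x assms(2) by (fastforce simp: slice_hits_def slice_def)
    then have "card {y\<in>T. \<xi> \<in> reduce p ` (U \<inter> slice T i (y ! i))} \<le> card (slice_hits T i p x)"
      using assms(1) by (intro card_mono) (auto simp: slice_hits_def)
    also have "real \<dots> \<le> b" using x b by blast
    finally show "real (card {y\<in>T. \<xi> \<in> reduce p ` (U \<inter> slice T i (y ! i))}) \<le> b" by simp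
  qed
  finally show ?thesis by (simp add: residue_classes_eq)
qed

lemma total_weight_pos:
  assumes "e > 0"
  shows "\<forall>\<^sub>F N in sequentially. total_weight e N > 0"
proof -
  have "\<forall>\<^sub>F N::nat in sequentially. e / 4 * ln N > 0" using assms by real_asymp
  with total_weight_lower[OF assms] show ?thesis by eventually_elim linarith
qed

text \<open>The scale \<open>1/p\<close> is what one expects if \<open>T\<close> has about
  \<open>p^(k+1)\<close> classes and each slice about \<open>p^k\<close>. Half of the total weight
  is asked for so that a quarter remains when \<open>greedy_step\<close> discards primes already
  covered.\<close>

definition well_hit :: "real \<Rightarrow> real \<Rightarrow> nat \<Rightarrow> int list set \<Rightarrow> nat \<Rightarrow> int list \<Rightarrow> bool" where
  "well_hit c e N T i x \<longleftrightarrow> (\<exists>G\<subseteq>sieve_primes e N. prime_weight G \<ge> total_weight e N / 2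
    \<and> (\<forall>p\<in>G. real (card (slice_hits T i p x)) \<ge> c * card T / p))"

text \<open>Let \<open>U p\<close> be the rarely hit points. The average slice sees
  \<open>U p\<close> in at most \<open>\<alpha> c p^k\<close> classes, so all but a few slices see
  it in at most \<open>\<delta> p^k\<close>; dispersion of the slices then makes \<open>U p\<close>
  small on average over \<open>p\<close>.\<close>

lemma most_points_well_hit:
  fixes e s \<kappa> \<alpha> \<eta> :: real
  assumes "e > 0" "2 * e * d < s" "\<kappa> > 0" "\<alpha> > 0" "\<eta> > 0"
  shows "\<exists>c::real>0. \<forall>\<^sub>F N in sequentially. \<forall>i<d. \<forall>T\<subseteq>grid d N.
    (\<forall>x\<in>T. \<kappa> * real N powr (real k - 1 + s) \<le> card (slice T i (x ! i))) \<longrightarrow>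
    prime_weight {p\<in>sieve_primes e N. real (residue_classes p T) > \<alpha> * real p ^ Suc k} \<le> \<eta> / 8 * total_weight e N \<longrightarrow>
    (\<exists>X\<subseteq>T. (1 - \<eta>) * card T \<le> card X \<and> (\<forall>x\<in>X. well_hit c e N T i x))"
proof -
  have \<eta>8: "\<eta> / 8 > 0" using assms by simp
  obtain \<delta> :: real where \<delta>: "\<delta> > 0" and ev1: "\<forall>\<^sub>F N in sequentially. \<forall>S\<subseteq>grid d N.
      \<kappa> * real N powr (real k - 1 + s) \<le> card S \<longrightarrow> dispersed \<delta> (\<eta> / 8) k e N S"
    using large_imp_dispersed[OF assms(1-3) \<eta>8] by blast
  \<comment> \<open>Markov's inequality for the number of classes of \<open>U p\<close> on a slice:
    mean \<open>\<alpha> c p^k\<close>, threshold \<open>\<delta> p^k\<close>, exceptional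
    proportion \<open>\<eta>/8\<close>.\<close>
  define c where "c = \<delta> * \<eta> / (8 * \<alpha>)"
  have c: "c > 0" using assms \<delta> by (simp add: c_def)
  show ?thesis
  proof (intro exI[of _ c] conjI c)
    show "\<forall>\<^sub>F N in sequentially. \<forall>i<d. \<forall>T\<subseteq>grid d N.
      (\<forall>x\<in>T. \<kappa> * real N powr (real k - 1 + s) \<le> card (slice T i (x ! i))) \<longrightarrow>
      prime_weight {p\<in>sieve_primes e N. real (residue_classes p T) > \<alpha> * real p ^ Suc k} \<le> \<eta> / 8 * total_weight e N \<longrightarrow>
      (\<exists>X\<subseteq>T. (1 - \<eta>) * card T \<le> card X \<and> (\<forall>x\<in>X. well_hit c e N T i x))"
      using ev1 total_weight_pos[OF assms(1)]
    proof eventually_elim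
      case (elim N)
      let ?P = "sieve_primes e N" and ?W = "total_weight e N"
      show ?case
      proof (intro allI impI)
        fix i T
        define Bad where "Bad = {p\<in>?P. real (residue_classes p T) > \<alpha> * real p ^ Suc k}"
        assume i: "i < d" and T: "T \<subseteq> grid d N"
          and large: "\<forall>x\<in>T. \<kappa> * real N powr (real k - 1 + s) \<le> card (slice T i (x ! i))"
          and "prime_weight {p\<in>sieve_primes e N. real (residue_classes p T) > \<alpha> * real p ^ Suc k} \<le> \<eta> / 8 * ?W"
        then have bad: "prime_weight Bad \<le> \<eta> / 8 * ?W" by (simp add: Bad_def)
        have fT: "finite T" by (rule finite_subset_grid[OF T])
        define t where "t = real (card T)"
        have t: "t \<ge> 0" by (simp add: t_def)
        have w0: "0 \<le> ln (real p) / p" if "p \<in> ?P" for p using weight_nonneg[OF that] .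
        \<comment> \<open>For a bad prime every point counts as rarely hit; these primes have at
          most \<open>\<eta>/8\<close> of the weight.\<close>
        define U where "U p = (if p \<in> Bad then T else {x\<in>T. real (card (slice_hits T i p x)) < c * t / p})" for p
        define E where "E p = {y\<in>T. p \<notin> Bad \<and> real (residue_classes p (U p \<inter> slice T i (y ! i))) > \<delta> * real p ^ k}" for p
        define V where "V a p = {x\<in>U p \<inter> slice T i a. p \<notin> Bad \<and> real (residue_classes p (U p \<inter> slice T i a)) \<le> \<delta> * real p ^ k}" for a p
        define A where "A = (\<lambda>x. x ! i) ` T"
        have fA: "finite A" using fT by (simp add: A_def)
        have UT: "U p \<subseteq> T" for p by (auto simp: U_def)
        have cE: "real (card (E p)) \<le> \<eta> / 8 * t" if p: "p \<in> ?P" for p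
        proof (cases "p \<in> Bad")
          case False
          have p2: "real p > 0" using sieve_primes_ge_2[OF p] by simp
          have "card (E p) * (\<delta> * real p ^ k) = (\<Sum>y\<in>E p. \<delta> * real p ^ k)" by simp
          also have "\<dots> \<le> (\<Sum>y\<in>E p. real (residue_classes p (U p \<inter> slice T i (y ! i))))"
            by (intro sum_mono) (auto simp: E_def)
          also have "\<dots> \<le> (\<Sum>y\<in>T. real (residue_classes p (U p \<inter> slice T i (y ! i))))"
            using fT by (intro sum_mono2) (auto simp: E_def)
          also have "\<dots> \<le> residue_classes p (U p) * (c * t / p)"
            by (rule sum_residue_classes_slices[OF fT UT]) (use False in \<open>auto simp: U_def\<close>)
          also have "\<dots> \<le> (\<alpha> * real p ^ Suc k) * (c * t / p)"
          proof (rule mult_right_mono)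
            have "residue_classes p (U p) \<le> residue_classes p T" by (rule residue_classes_mono[OF fT UT])
            also have "real \<dots> \<le> \<alpha> * real p ^ Suc k" using False p by (auto simp: Bad_def)
            finally show "real (residue_classes p (U p)) \<le> \<alpha> * real p ^ Suc k" by simp
          qed (use c t in auto)
          also have "\<dots> = (\<eta> / 8 * t) * (\<delta> * real p ^ k)"
            using p2 assms(4) by (simp add: c_def)
          finally show ?thesis using \<delta> p2 by (subst (asm) mult_le_cancel_right_pos) auto
        qed (use assms t in \<open>simp add: E_def\<close>)
        have thin: "(\<Sum>p\<in>?P. ln (real p) / p * card (V a p)) \<le> \<eta> / 8 * ?W * card (slice T i a)" if a: "a \<in> A" for a
        proof (rule dispersedD)
          obtain x where "x \<in> T" "a = x ! i" using a by (auto simp: A_def)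
          then have "\<kappa> * real N powr (real k - 1 + s) \<le> card (slice T i a)" using large by blast
          then show "dispersed \<delta> (\<eta> / 8) k e N (slice T i a)"
            using elim(1) T slice_subset[of T i a] by blast
          show "V a p \<subseteq> slice T i a" for p by (auto simp: V_def)
          show "real (residue_classes p (V a p)) \<le> \<delta> * real p ^ k" for p
          proof (cases "p \<notin> Bad \<and> real (residue_classes p (U p \<inter> slice T i a)) \<le> \<delta> * real p ^ k")
            case True
            then have "V a p = U p \<inter> slice T i a" by (auto simp: V_def)
            then show ?thesis using True by simp
          next
            case False
            then have "V a p = {}" by (auto simp: V_def)
            then show ?thesis using \<delta> by (simp add: residue_classes_eq)
          qed
        qed
        have "(\<Sum>p\<in>?P. ln (real p) / p * card (U p))
          \<le> (\<Sum>p\<in>?P. ln (real p) / p * ((if p \<in> Bad then t else 0) + \<eta> / 8 * t + (\<Sum>a\<in>A. real (card (V a p)))))"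
        proof (rule sum_mono, rule mult_left_mono)
          fix p assume p: "p \<in> ?P"
          show "real (card (U p)) \<le> (if p \<in> Bad then t else 0) + \<eta> / 8 * t + (\<Sum>a\<in>A. real (card (V a p)))"
          proof (cases "p \<in> Bad")
            case True
            have "0 \<le> \<eta> / 8 * t" "0 \<le> (\<Sum>a\<in>A. real (card (V a p)))"
              using assms t by (auto intro: sum_nonneg)
            then show ?thesis using True by (simp add: U_def t_def)
          next
            case False
            have "U p \<subseteq> E p \<union> (\<Union>a\<in>A. V a p)"
            proof
              fix x assume x: "x \<in> U p"
              then have xT: "x \<in> T" using UT by blast
              show "x \<in> E p \<union> (\<Union>a\<in>A. V a p)"
              proof (cases "x \<in> E p")
                case False2: False
                then have "x \<in> V (x ! i) p"
                  using x xT False by (auto simp: E_def V_def slice_def not_less)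
                then show ?thesis using xT by (auto simp: A_def)
              qed simp
            qed
            then have "card (U p) \<le> card (E p \<union> (\<Union>a\<in>A. V a p))"
              by (rule card_mono[rotated]) (use fT fA UT in \<open>auto simp: E_def V_def intro: finite_subset\<close>)
            also have "\<dots> \<le> card (E p) + (\<Sum>a\<in>A. card (V a p))"
              by (intro order_trans[OF card_Un_le] add_left_mono card_UN_le fA)
            finally have "real (card (U p)) \<le> real (card (E p)) + (\<Sum>a\<in>A. real (card (V a p)))"
              by (metis of_nat_add of_nat_le_iff of_nat_sum)
            then show ?thesis using cE[OF p] False by simp
          qed
        qed (use w0 in auto)
        also have "\<dots> = (\<Sum>p\<in>?P. if p \<in> Bad then ln (real p) / p * t else 0) + ?W * (\<eta> / 8 * t)
            + (\<Sum>p\<in>?P. \<Sum>a\<in>A. ln (real p) / p * card (V a p))"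
          by (simp add: distrib_left sum.distrib total_weight_def prime_weight_def sum_distrib_right sum_distrib_left
              if_distrib[of "\<lambda>z. _ * z"] cong: if_cong)
        also have "(\<Sum>p\<in>?P. if p \<in> Bad then ln (real p) / p * t else 0) = prime_weight Bad * t"
        proof -
          have "?P \<inter> Bad = Bad" by (auto simp: Bad_def)
          then show ?thesis by (simp add: sum.If_cases prime_weight_def sum_distrib_right)
        qed
        also have "(\<Sum>p\<in>?P. \<Sum>a\<in>A. ln (real p) / p * card (V a p))
            = (\<Sum>a\<in>A. \<Sum>p\<in>?P. ln (real p) / p * card (V a p))" by (rule sum.swap)
        also have "\<dots> \<le> (\<Sum>a\<in>A. \<eta> / 8 * ?W * card (slice T i a))" by (intro sum_mono thin)
        also have "\<dots> = \<eta> / 8 * ?W * (\<Sum>a\<in>A. real (card (slice T i a)))" by (simp add: sum_distrib_left)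
        also have "\<dots> \<le> \<eta> / 8 * ?W * t"
          unfolding t_def using elim(2) assms by (intro mult_left_mono sum_card_slices_le fT fA) auto
        also have "prime_weight Bad * t \<le> \<eta> / 8 * ?W * t" using bad t by (rule mult_right_mono)
        finally have main: "(\<Sum>p\<in>?P. ln (real p) / p * card (U p)) \<le> 3 * \<eta> / 8 * ?W * t"
          by (simp add: algebra_simps)
        \<comment> \<open>Bad primes, exceptional slices and dispersed slices have each contributed
          \<open>\<eta>/8\<close>. Markov's inequality at level \<open>?W / 2\<close> then excludes
          at most \<open>3/4 * \<eta> * t\<close> points.\<close>
        define X where "X = {x\<in>T. prime_weight {p\<in>?P. x \<in> U p} \<le> ?W / 2}"
        have "card (T - X) * (?W / 2) = (\<Sum>x\<in>T - X. ?W / 2)" by simp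
        also have "\<dots> \<le> (\<Sum>x\<in>T - X. prime_weight {p\<in>?P. x \<in> U p})"
          by (intro sum_mono) (auto simp: X_def)
        also have "\<dots> \<le> (\<Sum>x\<in>T. prime_weight {p\<in>?P. x \<in> U p})"
          using fT w0 by (intro sum_mono2) (auto simp: prime_weight_def intro!: sum_nonneg)
        also have "\<dots> = (\<Sum>x\<in>T. \<Sum>p\<in>?P. if x \<in> U p then ln (real p) / p else 0)"
          by (simp add: prime_weight_def sum.If_cases Int_def)
        also have "\<dots> = (\<Sum>p\<in>?P. ln (real p) / p * card (U p))"
        proof (subst sum.swap, rule sum.cong[OF refl])
          fix p
          have "{x\<in>T. x \<in> U p} = U p" using UT by blast
          then show "(\<Sum>x\<in>T. if x \<in> U p then ln (real p) / p else 0) = ln (real p) / p * card (U p)"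
            using fT by (simp add: sum.If_cases Int_def)
        qed
        also have "\<dots> \<le> 3 * \<eta> / 8 * ?W * t" by (rule main)
        also have "\<dots> = (3 * \<eta> / 4 * t) * (?W / 2)" by simp
        finally have "real (card (T - X)) \<le> 3 * \<eta> / 4 * t"
          using elim(2) by (subst (asm) mult_le_cancel_right_pos) auto
        also have "\<dots> \<le> \<eta> * t" using t assms by (intro mult_right_mono) auto
        finally have "real (card (T - X)) \<le> \<eta> * t" .
        moreover have "X \<subseteq> T" by (auto simp: X_def)
        moreover from this have "real (card T) = card X + card (T - X)"
          using fT by (metis card_Diff_subset card_mono finite_subset le_add_diff_inverse of_nat_add)
        ultimately have cX: "(1 - \<eta>) * card T \<le> card X" by (simp add: t_def algebra_simps)
        have "well_hit c e N T i x" if x: "x \<in> X" for x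
          unfolding well_hit_def
        proof (intro exI[of _ "{p\<in>?P. x \<notin> U p}"] conjI ballI)
          have "?W = prime_weight {p\<in>?P. x \<in> U p} + prime_weight {p\<in>?P. x \<notin> U p}"
            unfolding total_weight_def prime_weight_def
            by (subst sum.union_disjoint[symmetric]) (auto intro: sum.cong)
          then show "?W / 2 \<le> prime_weight {p\<in>?P. x \<notin> U p}" using x by (auto simp: X_def)
          fix p assume "p \<in> {p\<in>?P. x \<notin> U p}"
          then show "c * card T / p \<le> card (slice_hits T i p x)"
            using x by (auto simp: U_def X_def t_def not_less split: if_splits)
        qed auto
        with cX \<open>X \<subseteq> T\<close> show "\<exists>X\<subseteq>T. (1 - \<eta>) * card T \<le> card X \<and> (\<forall>x\<in>X. well_hit c e N T i x)"
          by blast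
      qed
    qed
  qed
qed

section \<open>Greedy choice of slices\<close>

definition covered :: "real \<Rightarrow> nat \<Rightarrow> int list set \<Rightarrow> nat \<Rightarrow> int set \<Rightarrow> int list \<Rightarrow> nat set" where
  "covered e N T i J x = {p\<in>sieve_primes e N. \<exists>z\<in>T. z ! i \<in> J \<and> reduce p z = reduce p x}"

text \<open>Measured in \<open>ln p\<close> and not in \<open>ln p / p\<close>, because this sum
  bounds from below the logarithm of a nonzero integer divisible by all these primes.\<close>

definition coverage :: "real \<Rightarrow> nat \<Rightarrow> int list set \<Rightarrow> nat \<Rightarrow> int set \<Rightarrow> int list \<Rightarrow> real" where
  "coverage e N T i J x = (\<Sum>p\<in>covered e N T i J x. ln (real p))"

lemma finite_covered [simp]: "finite (covered e N T i J x)"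
  by (simp add: covered_def)

lemma ln_sieve_primes_nonneg: "p \<in> sieve_primes e N \<Longrightarrow> 0 \<le> ln (real p)"
  using sieve_primes_ge_2[of p e N] by simp

lemma reduce_nth: "i < length x \<Longrightarrow> reduce p x ! i = x ! i mod int p"
  by (simp add: reduce_def)

text \<open>An average slice \<open>a\<close> adds \<open>\<ge> c/8\<close> times the total weight to the coverage of each \<open>x\<close> in \<open>B J\<close>:
  the primes already covered have negligible weight. For \<open>a \<noteq> x ! i\<close> the gain is at most \<open>ln N\<close>, since all
  new primes divide \<open>x ! i - a\<close>; this makes the truncation in \<open>\<Phi>\<close> harmless.\<close>
lemma greedy_step:
  fixes c D e :: real and R :: nat
  assumes T: "T \<subseteq> grid d N" "i < d" "T \<noteq> {}" "spread D e N i T" and X: "X \<subseteq> T" and N: "N \<ge> 1" and c: "c > 0"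
    and hit: "\<And>x. x \<in> X \<Longrightarrow> well_hit c e N T i x"
    and light: "\<And>G. G \<subseteq> sieve_primes e N \<Longrightarrow> (\<Sum>p\<in>G. ln (real p)) \<le> R * ln N \<Longrightarrow> prime_weight G \<le> 1 / 4 * total_weight e N"
    and upper: "(\<Sum>p\<in>sieve_primes e N. ln (real p)) \<le> real N powr (2 * e)"
    and D: "D \<ge> 0" "D \<le> c / 8 * total_weight e N"
  defines "\<Phi> \<equiv> \<lambda>J. \<Sum>x\<in>X. min (coverage e N T i J x) ((R + 1) * ln N)"
    and "B \<equiv> \<lambda>J. {x\<in>X. coverage e N T i J x \<le> R * ln N}"
  shows "\<exists>a. \<Phi> (insert a J) \<ge> \<Phi> J + c / 8 * total_weight e N * card (B J)"
proof -
  let ?P = "sieve_primes e N" and ?W = "total_weight e N"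
  define t where "t = real (card T)"
  have fT: "finite T" by (rule finite_subset_grid[OF T(1)])
  have t: "t > 0" using fT T(3) by (simp add: t_def card_gt_0_iff)
  have fX: "finite X" using fT X finite_subset by blast
  have fB: "finite (B J)" using fX by (simp add: B_def)
  have "\<forall>x\<in>X. \<exists>G. G \<subseteq> ?P \<and> prime_weight G \<ge> ?W / 2
      \<and> (\<forall>p\<in>G. real (card (slice_hits T i p x)) \<ge> c * t / p)"
    using hit unfolding well_hit_def t_def by blast
  from bchoice[OF this] obtain G where G0: "\<forall>x\<in>X. G x \<subseteq> ?P \<and> prime_weight (G x) \<ge> ?W / 2
      \<and> (\<forall>p\<in>G x. real (card (slice_hits T i p x)) \<ge> c * t / p)" ..
  have G: "G x \<subseteq> ?P" "prime_weight (G x) \<ge> ?W / 2" if "x \<in> X" for x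
    using G0[rule_format, OF that] by simp_all
  have G_hits: "real (card (slice_hits T i p x)) \<ge> c * t / p" if "x \<in> X" "p \<in> G x" for x p
    using G0[rule_format, OF that(1)] that(2) by simp
  \<comment> \<open>Primes already covered bring nothing new. For \<open>x\<close> in
    \<open>B J\<close> they satisfy \<open>\<Sum> ln p \<le> R ln N\<close>, hence by
    \<open>light\<close> they have at most a quarter of the total weight.\<close>
  define G' where "G' x = G x - covered e N T i J x" for x
  have G'P: "G' x \<subseteq> ?P" if "x \<in> X" for x using G(1)[OF that] by (auto simp: G'_def)
  have fG': "finite (G' x)" if "x \<in> X" for x by (rule finite_subset[OF G'P[OF that] finite_sieve_primes])
  define H where "H x a = {p\<in>G' x. \<exists>z\<in>T. z ! i = a \<and> reduce p z = reduce p x}" for x a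
  \<comment> \<open>The slice through \<open>x\<close> itself would cover all of \<open>G' x\<close>
    at once; giving it gain 0 keeps every gain below \<open>ln N\<close>.\<close>
  define gain where "gain x a = (if x ! i = a then 0 else \<Sum>p\<in>H x a. ln (real p))" for x a
  have len: "length x = d" if "x \<in> T" for x using that T(1) grid_length by blast
  have rng: "x ! i \<in> {0..int N}" if "x \<in> T" for x using that T(1,2) grid_nth by blast
  have gain0: "gain x a \<ge> 0" if "x \<in> X" for x a
    unfolding gain_def using G'P[OF that] by (auto simp: H_def intro!: sum_nonneg ln_sieve_primes_nonneg)
  have gainN: "gain x (y ! i) \<le> ln N" if x: "x \<in> X" and y: "y \<in> T" for x y
  proof (cases "x ! i = y ! i")
    case False
    have xT: "x \<in> T" using x X by blast
    have "gain x (y ! i) = (\<Sum>p\<in>H x (y ! i). ln (real p))" using False by (simp add: gain_def)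
    also have "\<dots> \<le> (\<Sum>p | p \<in> ?P \<and> x ! i mod int p = y ! i mod int p. ln (real p))"
    proof (rule sum_mono2)
      show "H x (y ! i) \<subseteq> {p \<in> ?P. x ! i mod int p = y ! i mod int p}"
      proof
        fix p assume p: "p \<in> H x (y ! i)"
        then obtain z where z: "z \<in> T" "z ! i = y ! i" "reduce p z = reduce p x" by (auto simp: H_def)
        have "x ! i mod int p = y ! i mod int p"
          using z reduce_nth[of i z p] reduce_nth[of i x p] len[OF z(1)] len[OF xT] T(2) by metis
        then show "p \<in> {p \<in> ?P. x ! i mod int p = y ! i mod int p}"
          using p G'P[OF x] by (auto simp: H_def)
      qed
    qed (auto intro: ln_sieve_primes_nonneg)
    also have "\<dots> \<le> ln N"
      by (rule sum_ln_congruent[OF finite_sieve_primes sieve_primes_prime rng[OF xT] rng[OF y] False])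
    finally show ?thesis .
  qed (use N in \<open>simp add: gain_def\<close>)
  have gain_sum: "(\<Sum>y\<in>T. gain x (y ! i)) \<ge> c / 8 * ?W * t" if x: "x \<in> B J" for x
  proof -
    have xX: "x \<in> X" and xT: "x \<in> T" using x X by (auto simp: B_def)
    let ?s = "real (card (slice T i (x ! i)))"
    have "prime_weight (covered e N T i J x) \<le> 1 / 4 * ?W"
      using x by (intro light) (auto simp: B_def coverage_def covered_def)
    moreover have "prime_weight (G x) \<le> prime_weight (G' x) + prime_weight (covered e N T i J x)"
    proof -
      have "prime_weight (G x) \<le> prime_weight (G' x \<union> covered e N T i J x)"
        unfolding prime_weight_def
        by (rule sum_mono2) (use G'P[OF xX] fG'[OF xX] in \<open>auto simp: G'_def covered_def intro!: weight_nonneg\<close>)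
      also have "\<dots> = prime_weight (G' x) + prime_weight (covered e N T i J x)"
        unfolding prime_weight_def by (rule sum.union_disjoint) (use fG'[OF xX] in \<open>auto simp: G'_def\<close>)
      finally show ?thesis .
    qed
    ultimately have wG': "prime_weight (G' x) \<ge> ?W / 4" using G(2)[OF xX] by linarith
    \<comment> \<open>The contribution of the slice of \<open>x\<close>, to be discarded: by
      spreadness even all sieve primes together make it at most \<open>D * t\<close>.\<close>
    have "?s * (\<Sum>p\<in>G' x. ln (real p)) \<le> (D * real N powr (- 2 * e) * t) * real N powr (2 * e)"
    proof (rule mult_mono)
      show "?s \<le> D * real N powr (- 2 * e) * t" using T(4) xT by (simp add: spread_def t_def)
      have "(\<Sum>p\<in>G' x. ln (real p)) \<le> (\<Sum>p\<in>?P. ln (real p))"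
        by (rule sum_mono2) (use G'P[OF xX] in \<open>auto intro: ln_sieve_primes_nonneg\<close>)
      then show "(\<Sum>p\<in>G' x. ln (real p)) \<le> real N powr (2 * e)" using upper by linarith
      show "0 \<le> (\<Sum>p\<in>G' x. ln (real p))"
        using G'P[OF xX] by (auto intro!: sum_nonneg ln_sieve_primes_nonneg)
    qed (use D t in auto)
    also have "\<dots> = D * t" using N by (simp add: powr_minus field_simps)
    also have "\<dots> \<le> c / 8 * ?W * t" using D t by (intro mult_right_mono) auto
    finally have sub: "?s * (\<Sum>p\<in>G' x. ln (real p)) \<le> c / 8 * ?W * t" .
    \<comment> \<open>Of the expected total gain \<open>c/4 * ?W * t\<close>, at most half comes
      from the slice of \<open>x\<close> itself.\<close>
    have "c / 4 * ?W * t = c * t * (?W / 4)" by simp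
    also have "\<dots> \<le> c * t * prime_weight (G' x)" using wG' c t by (intro mult_left_mono) auto
    also have "\<dots> = (\<Sum>p\<in>G' x. ln (real p) * (c * t / p))"
      by (simp add: prime_weight_def sum_distrib_left mult_ac)
    also have "\<dots> \<le> (\<Sum>p\<in>G' x. ln (real p) * (card {y\<in>T. x ! i \<noteq> y ! i \<and> p \<in> H x (y ! i)} + ?s))"
    proof (rule sum_mono, rule mult_left_mono)
      fix p assume p: "p \<in> G' x"
      then have "c * t / p \<le> card (slice_hits T i p x)" using G_hits[OF xX] by (simp add: G'_def)
      also have "card (slice_hits T i p x) \<le> card ({y\<in>T. x ! i \<noteq> y ! i \<and> p \<in> H x (y ! i)} \<union> slice T i (x ! i))"
        by (rule card_mono) (use fT p in \<open>auto simp: slice_hits_def slice_def H_def\<close>)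
      also have "\<dots> \<le> card {y\<in>T. x ! i \<noteq> y ! i \<and> p \<in> H x (y ! i)} + card (slice T i (x ! i))"
        by (rule card_Un_le)
      finally show "c * t / p \<le> real (card {y\<in>T. x ! i \<noteq> y ! i \<and> p \<in> H x (y ! i)}) + ?s" by simp
      show "0 \<le> ln (real p)" using p G'P[OF xX] by (auto intro: ln_sieve_primes_nonneg)
    qed
    also have "\<dots> = (\<Sum>p\<in>G' x. ln (real p) * card {y\<in>T. x ! i \<noteq> y ! i \<and> p \<in> H x (y ! i)})
        + ?s * (\<Sum>p\<in>G' x. ln (real p))"
      by (simp add: distrib_left sum.distrib sum_distrib_left sum_distrib_right mult.commute[of "real (card (slice T i (x ! i)))"])
    also have "(\<Sum>p\<in>G' x. ln (real p) * card {y\<in>T. x ! i \<noteq> y ! i \<and> p \<in> H x (y ! i)})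
        = (\<Sum>p\<in>G' x. \<Sum>y\<in>T. if x ! i \<noteq> y ! i \<and> p \<in> H x (y ! i) then ln (real p) else 0)"
      using fT by (simp add: sum.If_cases Int_def mult.commute)
    also have "\<dots> = (\<Sum>y\<in>T. \<Sum>p\<in>G' x. if x ! i \<noteq> y ! i \<and> p \<in> H x (y ! i) then ln (real p) else 0)"
      by (rule sum.swap)
    also have "\<dots> = (\<Sum>y\<in>T. gain x (y ! i))"
    proof (rule sum.cong[OF refl])
      fix y
      have "{p\<in>G' x. p \<in> H x (y ! i)} = H x (y ! i)" by (auto simp: H_def)
      then show "(\<Sum>p\<in>G' x. if x ! i \<noteq> y ! i \<and> p \<in> H x (y ! i) then ln (real p) else 0) = gain x (y ! i)"
        using fG'[OF xX] by (simp add: gain_def sum.If_cases Int_def)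
    qed
    finally show ?thesis using sub by linarith
  qed
  \<comment> \<open>Averaging over the points \<open>y\<close> of \<open>T\<close>, that is over
    slices weighted by their size, finds one slice that serves all of \<open>B J\<close> on
    average.\<close>
  have "\<exists>y\<in>T. (\<Sum>x\<in>B J. gain x (y ! i)) \<ge> c / 8 * ?W * card (B J)"
  proof (rule ccontr)
    assume "\<not> ?thesis"
    then have "(\<Sum>y\<in>T. \<Sum>x\<in>B J. gain x (y ! i)) < (\<Sum>y\<in>T. c / 8 * ?W * card (B J))"
      using fT T(3) by (intro sum_strict_mono) (auto simp: not_le)
    also have "\<dots> = (\<Sum>x\<in>B J. c / 8 * ?W * t)" by (simp add: t_def mult_ac)
    also have "\<dots> \<le> (\<Sum>x\<in>B J. \<Sum>y\<in>T. gain x (y ! i))" by (intro sum_mono gain_sum)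
    also have "\<dots> = (\<Sum>y\<in>T. \<Sum>x\<in>B J. gain x (y ! i))" by (rule sum.swap)
    finally show False by simp
  qed
  then obtain y where y: "y \<in> T" and yg: "(\<Sum>x\<in>B J. gain x (y ! i)) \<ge> c / 8 * ?W * card (B J)" by blast
  let ?J = "insert (y ! i) J"
  have lnN: "ln (real N) \<ge> 0" using N by simp
  have "\<Phi> J + c / 8 * ?W * card (B J) \<le> \<Phi> J + (\<Sum>x\<in>X. if x \<in> B J then gain x (y ! i) else 0)"
  proof -
    have "{x\<in>X. x \<in> B J} = B J" by (auto simp: B_def)
    then show ?thesis using yg fX by (simp add: sum.If_cases Int_def)
  qed
  also have "\<dots> = (\<Sum>x\<in>X. min (coverage e N T i J x) ((R + 1) * ln N) + (if x \<in> B J then gain x (y ! i) else 0))"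
    by (simp add: \<Phi>_def sum.distrib)
  also have "\<dots> \<le> \<Phi> ?J" unfolding \<Phi>_def
  proof (rule sum_mono)
    fix x assume x: "x \<in> X"
    have sub: "covered e N T i J x \<subseteq> covered e N T i ?J x" by (auto simp: covered_def)
    have mono: "coverage e N T i J x \<le> coverage e N T i ?J x"
      unfolding coverage_def by (rule sum_mono2[OF _ sub]) (auto simp: covered_def intro: ln_sieve_primes_nonneg)
    show "min (coverage e N T i J x) ((R + 1) * ln N) + (if x \<in> B J then gain x (y ! i) else 0)
        \<le> min (coverage e N T i ?J x) ((R + 1) * ln N)"
    proof (cases "x \<in> B J")
      case True
      have "coverage e N T i J x + gain x (y ! i) \<le> coverage e N T i ?J x"
      proof (cases "x ! i = y ! i")
        case False
        have "coverage e N T i J x + gain x (y ! i) = (\<Sum>p\<in>covered e N T i J x \<union> H x (y ! i). ln (real p))"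
          unfolding coverage_def using False fG'[OF x]
          by (subst sum.union_disjoint) (auto simp: gain_def H_def G'_def)
        also have "\<dots> \<le> coverage e N T i ?J x" unfolding coverage_def
          by (rule sum_mono2) (use G'P[OF x] in \<open>auto simp: covered_def H_def intro: ln_sieve_primes_nonneg\<close>)
        finally show ?thesis .
      qed (use mono in \<open>simp add: gain_def\<close>)
      moreover have "coverage e N T i J x \<le> R * ln N" using True by (simp add: B_def)
      ultimately show ?thesis using True gainN[OF x y] gain0[OF x, of "y ! i"] lnN by (simp add: algebra_simps)
    qed (use mono in auto)
  qed
  finally show ?thesis by blast
qed

text \<open>The potential \<open>?\<Phi>\<close> never exceeds
  \<open>card T * (R + 1) * ln N\<close>, and while more than \<open>\<eta> * card T\<close> points
  of \<open>X\<close> lack coverage, each greedy step raises it by a fixed multiple of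
  \<open>card T * ln N\<close>.\<close>

lemma greedy_cover:
  fixes c D e \<eta> :: real
  assumes "e > 0" "c > 0" "D \<ge> 0" "\<eta> > 0"
  shows "\<exists>C::real>0. \<forall>R::nat. \<forall>\<^sub>F N in sequentially. \<forall>i<d. \<forall>T\<subseteq>grid d N. \<forall>X\<subseteq>T.
    spread D e N i T \<longrightarrow> (\<forall>x\<in>X. well_hit c e N T i x) \<longrightarrow>
    (\<exists>J. finite J \<and> real (card J) \<le> C * (R + 1) \<and>
      real (card {x\<in>X. coverage e N T i J x \<le> R * ln N}) \<le> \<eta> * card T)"
proof -
  \<comment> \<open>One step gains at least \<open>c/8 * (e/4 * ln N) * (\<eta> * t)\<close>, which
    is \<open>ln N * t / C0\<close>.\<close>
  define C0 where "C0 = 32 / (c * e * \<eta>)"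
  have C0: "C0 > 0" using assms by (simp add: C0_def)
  show ?thesis
  proof (intro exI[of _ "C0 + 1"] conjI allI)
    show "C0 + 1 > 0" using C0 by simp
    fix R :: nat
    \<comment> \<open>\<open>R + 1\<close> in place of \<open>R\<close>, since
      \<open>light_primes\<close> asks for a positive budget and \<open>R\<close> may be 0.\<close>
    have "1 / 4 > (0::real)" "real (R + 1) > 0" by auto
    note light = light_primes[OF assms(1) this]
    have evD: "\<forall>\<^sub>F N::nat in sequentially. D \<le> c / 8 * (e / 4 * ln N)" using assms by real_asymp
    have evN: "\<forall>\<^sub>F N::nat in sequentially. N \<ge> 2" by (rule eventually_ge_at_top)
    show "\<forall>\<^sub>F N in sequentially. \<forall>i<d. \<forall>T\<subseteq>grid d N. \<forall>X\<subseteq>T.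
      spread D e N i T \<longrightarrow> (\<forall>x\<in>X. well_hit c e N T i x) \<longrightarrow>
      (\<exists>J. finite J \<and> real (card J) \<le> (C0 + 1) * (R + 1) \<and>
        real (card {x\<in>X. coverage e N T i J x \<le> R * ln N}) \<le> \<eta> * card T)"
      using light total_weight_lower[OF assms(1)] sum_ln_sieve_primes_upper[OF assms(1)] evD evN
    proof eventually_elim
      case (elim N)
      let ?W = "total_weight e N"
      show ?case
      proof (intro allI impI)
        fix i T X
        assume i: "i < d" and T: "T \<subseteq> grid d N" and X: "X \<subseteq> T" and sp: "spread D e N i T"
          and hit: "\<forall>x\<in>X. well_hit c e N T i x"
        have lnN: "ln (real N) > 0" using elim by simp
        let ?B = "\<lambda>J. {x\<in>X. coverage e N T i J x \<le> R * ln N}"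
        let ?\<Phi> = "\<lambda>J. \<Sum>x\<in>X. min (coverage e N T i J x) ((R + 1) * ln N)"
        show "\<exists>J. finite J \<and> real (card J) \<le> (C0 + 1) * (R + 1) \<and> real (card (?B J)) \<le> \<eta> * card T"
        proof (cases "T = {}")
          case True
          then show ?thesis using X C0 by (intro exI[of _ "{}"]) auto
        next
          case False
          define t where "t = real (card T)"
          have fT: "finite T" by (rule finite_subset_grid[OF T])
          have t: "t > 0" using fT False by (simp add: t_def card_gt_0_iff)
          define g where "g = c / 8 * ?W * (\<eta> * t)"
          have g: "g \<ge> ln N * t / C0"
          proof -
            have "c / 8 * (e / 4 * ln N) * (\<eta> * t) \<le> g"
              unfolding g_def using elim assms t by (intro mult_right_mono mult_left_mono) auto
            then show ?thesis by (simp add: C0_def mult_ac)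
          qed
          \<comment> \<open>Either at most \<open>n\<close> slices already succeed, or
            \<open>n\<close> greedy steps have each added \<open>g\<close>.\<close>
          have dich: "\<exists>J. finite J \<and> card J \<le> n \<and> (real (card (?B J)) \<le> \<eta> * t \<or> ?\<Phi> J \<ge> n * g)" for n
          proof (induction n)
            case 0
            have "?\<Phi> {} \<ge> 0"
              using lnN by (intro sum_nonneg) (auto simp: coverage_def covered_def)
            then show ?case by (intro exI[of _ "{}"]) auto
          next
            case (Suc n)
            then obtain J where J: "finite J" "card J \<le> n" "real (card (?B J)) \<le> \<eta> * t \<or> ?\<Phi> J \<ge> n * g" by blast
            show ?case
            proof (cases "real (card (?B J)) \<le> \<eta> * t")
              case True
              then show ?thesis using J by (intro exI[of _ J]) auto
            next
              case F: False
              have "\<exists>a. ?\<Phi> (insert a J) \<ge> ?\<Phi> J + c / 8 * ?W * card (?B J)"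
              proof (rule greedy_step[OF T i False sp X _ assms(2)])
                show "D \<le> c / 8 * ?W" using elim assms by (smt (verit) mult_left_mono divide_nonneg_nonneg)
                show "prime_weight G \<le> 1 / 4 * ?W" if "G \<subseteq> sieve_primes e N" "(\<Sum>p\<in>G. ln (real p)) \<le> R * ln N" for G
                proof -
                  have "(\<Sum>p\<in>G. ln (real p)) \<le> real (R + 1) * ln N" using that(2) lnN by (simp add: algebra_simps)
                  then show ?thesis using elim(1) that(1) by blast
                qed
              qed (use elim hit assms in auto)
              then obtain a where a: "?\<Phi> (insert a J) \<ge> ?\<Phi> J + c / 8 * ?W * card (?B J)" by blast
              have "c / 8 * ?W * card (?B J) \<ge> g"
              proof -
                have "0 \<le> c / 8 * ?W" using assms total_weight_nonneg[of e N] by simp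
                then show ?thesis unfolding g_def using F by (intro mult_left_mono) auto
              qed
              with a J F have "?\<Phi> (insert a J) \<ge> Suc n * g" by (simp add: algebra_simps)
              then show ?thesis using J by (intro exI[of _ "insert a J"]) (auto simp: card_insert_if)
            qed
          qed
          \<comment> \<open>More steps than the upper bound on the potential allows, which refutes
            the second alternative.\<close>
          define n where "n = nat \<lfloor>C0 * (R + 1)\<rfloor> + 1"
          have n: "real n > C0 * (R + 1)" unfolding n_def by linarith
          have n': "real n \<le> (C0 + 1) * (R + 1)"
          proof -
            have "0 \<le> C0 * (R + 1)" using C0 by simp
            then have "real n \<le> C0 * (R + 1) + 1" unfolding n_def by linarith
            then show ?thesis by (simp add: algebra_simps)
          qed
          obtain J where J: "finite J" "card J \<le> n" "real (card (?B J)) \<le> \<eta> * t \<or> ?\<Phi> J \<ge> n * g"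
            using dich[of n] by blast
          have "?\<Phi> J \<le> (\<Sum>x\<in>X. (R + 1) * ln N)" by (intro sum_mono) auto
          also have "\<dots> = card X * ((R + 1) * ln N)" by simp
          also have "\<dots> \<le> t * ((R + 1) * ln N)"
            unfolding t_def using lnN by (intro mult_right_mono of_nat_mono card_mono fT X) auto
          also have "\<dots> = C0 * (R + 1) * (ln N * t / C0)" using C0 by simp
          also have "\<dots> < n * (ln N * t / C0)" using n lnN t C0 by (intro mult_strict_right_mono) auto
          also have "\<dots> \<le> n * g" using g by (intro mult_left_mono) auto
          finally have "real (card (?B J)) \<le> \<eta> * card T" using J by (auto simp: t_def)
          moreover have "real (card J) \<le> (C0 + 1) * (R + 1)" using J n' by linarith
          ultimately show ?thesis using J by blast
        qed
      qed
    qed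
  qed
qed

text \<open>\<open>F\<close> ranges over the only properties of integer polynomials that matter: they respect
  congruences and are bounded by \<open>N ^ R\<close> on the grid.\<close>
definition controls :: "nat \<Rightarrow> nat \<Rightarrow> nat \<Rightarrow> int list set \<Rightarrow> int list set \<Rightarrow> bool" where
  "controls d N R A S \<longleftrightarrow> (\<forall>F :: int list \<Rightarrow> int.
     (\<forall>p x y. reduce p x = reduce p y \<longrightarrow> int p dvd F x - F y) \<longrightarrow>
     (\<forall>x\<in>grid d N. \<bar>F x\<bar> \<le> int N ^ R) \<longrightarrow> (\<forall>x\<in>A. F x = 0) \<longrightarrow> (\<forall>x\<in>S. F x = 0))"

text \<open>Every prime counted in the coverage of \<open>x\<close> divides \<open>F x\<close>, so a
  nonzero \<open>F x\<close> would exceed \<open>N^R\<close> in absolute value.\<close>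

lemma controls_covered:
  assumes "T \<subseteq> grid d N" "X \<subseteq> T" "N \<ge> 1"
  shows "controls d N R {z\<in>T. z ! i \<in> J} {x\<in>X. coverage e N T i J x > R * ln N}"
  unfolding controls_def
proof (intro allI impI ballI)
  fix F :: "int list \<Rightarrow> int" and x
  assume cong: "\<forall>p x y. reduce p x = reduce p y \<longrightarrow> int p dvd F x - F y"
    and bound: "\<forall>x\<in>grid d N. \<bar>F x\<bar> \<le> int N ^ R" and zero: "\<forall>x\<in>{z\<in>T. z ! i \<in> J}. F x = 0"
    and x: "x \<in> {x\<in>X. coverage e N T i J x > R * ln N}"
  show "F x = 0"
  proof (rule ccontr)
    assume nz: "F x \<noteq> 0"
    have "int p dvd F x" if p: "p \<in> covered e N T i J x" for p
    proof -
      obtain z where "z \<in> T" "z ! i \<in> J" "reduce p z = reduce p x" using p by (auto simp: covered_def)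
      then show ?thesis using cong zero by (metis (mono_tags, lifting) diff_zero mem_Collect_eq)
    qed
    then have "coverage e N T i J x \<le> ln \<bar>real_of_int (F x)\<bar>"
      unfolding coverage_def
      by (intro sum_ln_primes_le nz finite_covered) (auto simp: covered_def sieve_primes_def)
    also have "\<dots> \<le> ln (real N ^ R)"
    proof (rule ln_mono)
      have "\<bar>F x\<bar> \<le> int N ^ R" using bound x assms by auto
      then have "real_of_int \<bar>F x\<bar> \<le> real_of_int (int N ^ R)" by (simp only: of_int_le_iff)
      then show "\<bar>real_of_int (F x)\<bar> \<le> real N ^ R" by simp
    qed (use nz in auto)
    also have "\<dots> = R * ln N" using assms(3) by (simp add: ln_realpow)
    finally show False using x by simp
  qed
qed

text \<open>\<open>\<eta>/2\<close> pays for the points that are not well hit and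
  \<open>\<eta>/2\<close> for those left uncovered by the greedy choice. \<open>C\<close> precedes
  \<open>R\<close>, so that one level of the induction costs exactly one factor of order
  \<open>R\<close>.\<close>

lemma slices_control:
  fixes e s \<kappa> \<alpha> \<eta> D :: real
  assumes "e > 0" "2 * e * d < s" "\<kappa> > 0" "\<alpha> > 0" "\<eta> > 0" "D \<ge> 0"
  shows "\<exists>C::real>0. \<forall>R::nat. \<forall>\<^sub>F N in sequentially. \<forall>i<d. \<forall>T\<subseteq>grid d N. spread D e N i T \<longrightarrow>
    (\<forall>x\<in>T. \<kappa> * real N powr (real k - 1 + s) \<le> card (slice T i (x ! i))) \<longrightarrow>
    prime_weight {p\<in>sieve_primes e N. real (residue_classes p T) > \<alpha> * real p ^ Suc k} \<le> \<eta> / 16 * total_weight e N \<longrightarrow>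
    (\<exists>J T'. finite J \<and> real (card J) \<le> C * (R + 1) \<and> T' \<subseteq> T \<and> (1 - \<eta>) * card T \<le> card T'
      \<and> controls d N R {z\<in>T. z ! i \<in> J} T')"
proof -
  have \<eta>2: "\<eta> / 2 > 0" using assms by simp
  obtain c :: real where c: "c > 0" and ev1: "\<forall>\<^sub>F N in sequentially. \<forall>i<d. \<forall>T\<subseteq>grid d N.
    (\<forall>x\<in>T. \<kappa> * real N powr (real k - 1 + s) \<le> card (slice T i (x ! i))) \<longrightarrow>
    prime_weight {p\<in>sieve_primes e N. real (residue_classes p T) > \<alpha> * real p ^ Suc k} \<le> \<eta> / 2 / 8 * total_weight e N \<longrightarrow>
    (\<exists>X\<subseteq>T. (1 - \<eta> / 2) * card T \<le> card X \<and> (\<forall>x\<in>X. well_hit c e N T i x))"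
    using most_points_well_hit[OF assms(1-4) \<eta>2] by blast
  obtain C :: real where C: "C > 0" and ev2: "\<forall>R::nat. \<forall>\<^sub>F N in sequentially. \<forall>i<d. \<forall>T\<subseteq>grid d N. \<forall>X\<subseteq>T.
    spread D e N i T \<longrightarrow> (\<forall>x\<in>X. well_hit c e N T i x) \<longrightarrow>
    (\<exists>J. finite J \<and> real (card J) \<le> C * (R + 1) \<and>
      real (card {x\<in>X. coverage e N T i J x \<le> R * ln N}) \<le> \<eta> / 2 * card T)"
    using greedy_cover[OF assms(1) c assms(6) \<eta>2] by blast
  show ?thesis
  proof (intro exI[of _ C] conjI C allI)
    fix R :: nat
    have evN: "\<forall>\<^sub>F N::nat in sequentially. N \<ge> 1" by (rule eventually_ge_at_top)
    show "\<forall>\<^sub>F N in sequentially. \<forall>i<d. \<forall>T\<subseteq>grid d N. spread D e N i T \<longrightarrow>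
      (\<forall>x\<in>T. \<kappa> * real N powr (real k - 1 + s) \<le> card (slice T i (x ! i))) \<longrightarrow>
      prime_weight {p\<in>sieve_primes e N. real (residue_classes p T) > \<alpha> * real p ^ Suc k} \<le> \<eta> / 16 * total_weight e N \<longrightarrow>
      (\<exists>J T'. finite J \<and> real (card J) \<le> C * (R + 1) \<and> T' \<subseteq> T \<and> (1 - \<eta>) * card T \<le> card T'
        \<and> controls d N R {z\<in>T. z ! i \<in> J} T')"
      using ev1 ev2[rule_format, of R] evN
    proof eventually_elim
      case (elim N)
      show ?case
      proof (intro allI impI)
        fix i T
        assume i: "i < d" and T: "T \<subseteq> grid d N" and sp: "spread D e N i T"
          and large: "\<forall>x\<in>T. \<kappa> * real N powr (real k - 1 + s) \<le> card (slice T i (x ! i))"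
          and bad: "prime_weight {p\<in>sieve_primes e N. real (residue_classes p T) > \<alpha> * real p ^ Suc k} \<le> \<eta> / 16 * total_weight e N"
        have "prime_weight {p\<in>sieve_primes e N. real (residue_classes p T) > \<alpha> * real p ^ Suc k} \<le> \<eta> / 2 / 8 * total_weight e N"
          using bad by simp
        from elim(1)[rule_format, OF i T large[rule_format] this]
        obtain X where X: "X \<subseteq> T" "(1 - \<eta> / 2) * card T \<le> card X" "\<forall>x\<in>X. well_hit c e N T i x" by blast
        from elim(2)[rule_format, OF i T X(1) sp X(3)[rule_format]]
        obtain J where J: "finite J" "real (card J) \<le> C * (R + 1)"
          "real (card {x\<in>X. coverage e N T i J x \<le> R * ln N}) \<le> \<eta> / 2 * card T" by blast
        have fX: "finite X" using X(1) finite_subset_grid[OF T] finite_subset by blast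
        let ?T' = "{x\<in>X. coverage e N T i J x > R * ln N}"
        have "X = ?T' \<union> {x\<in>X. coverage e N T i J x \<le> R * ln N}" by auto
        then have "card X \<le> card ?T' + card {x\<in>X. coverage e N T i J x \<le> R * ln N}"
          by (metis (no_types, lifting) card_Un_le)
        then have "(1 - \<eta>) * card T \<le> card ?T'" using X(2) J(3) by (simp add: algebra_simps)
        moreover have "controls d N R {z\<in>T. z ! i \<in> J} ?T'"
          by (rule controls_covered[OF T X(1) elim(3)])
        moreover have "?T' \<subseteq> T" using X by auto
        ultimately show "\<exists>J T'. finite J \<and> real (card J) \<le> C * (R + 1) \<and> T' \<subseteq> T \<and> (1 - \<eta>) * card T \<le> card T'
          \<and> controls d N R {z\<in>T. z ! i \<in> J} T'" using J by blast
      qed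
    qed
  qed
qed

section \<open>Control by small sets\<close>

lemma prime_weight_mono: "G \<subseteq> H \<Longrightarrow> H \<subseteq> sieve_primes e N \<Longrightarrow> prime_weight G \<le> prime_weight H"
  unfolding prime_weight_def
  by (rule sum_mono2) (auto intro: finite_subset[OF _ finite_sieve_primes] intro!: weight_nonneg)

text \<open>Base of the induction on \<open>k\<close>. Among slightly more than
  \<open>\<alpha>\<close> points, two collide modulo each prime with at most \<open>\<alpha>\<close>
  classes. Such primes divide one of boundedly many coordinate differences, so their
  \<open>\<Sum> ln p\<close> is \<open>O(ln N)\<close> and their weight stays below half of the
  total.\<close>

lemma few_classes_bounded:
  fixes e \<alpha> :: real
  assumes "e > 0" "\<alpha> > 0"
  shows "\<forall>\<^sub>F N in sequentially. \<forall>S\<subseteq>grid d N.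
    prime_weight {p\<in>sieve_primes e N. real (residue_classes p S) > \<alpha>} \<le> 1 / 2 * total_weight e N \<longrightarrow> real (card S) \<le> \<alpha>"
proof -
  define m where "m = nat \<lfloor>\<alpha>\<rfloor> + 1"
  have m: "real m > \<alpha>" unfolding m_def by linarith
  \<comment> \<open>At most \<open>m * m * d\<close> coordinate differences pay \<open>ln N\<close>
    each; the \<open>+ 1\<close> keeps the budget positive when \<open>d = 0\<close>.\<close>
  have "1 / 4 > (0::real)" "real (m * m * d + 1) > 0" by (simp, unfold of_nat_0_less_iff, simp)
  note light = light_primes[OF assms(1) this]
  have evN: "\<forall>\<^sub>F N::nat in sequentially. N \<ge> 1" by (rule eventually_ge_at_top)
  show ?thesis using light total_weight_pos[OF assms(1)] evN
  proof eventually_elim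
    case (elim N)
    let ?W = "total_weight e N"
    show ?case
    proof (intro allI impI)
      fix S assume S: "S \<subseteq> grid d N"
        and w: "prime_weight {p\<in>sieve_primes e N. real (residue_classes p S) > \<alpha>} \<le> 1 / 2 * ?W"
      have fS: "finite S" by (rule finite_subset_grid[OF S])
      show "real (card S) \<le> \<alpha>"
      proof (rule ccontr)
        assume "\<not> real (card S) \<le> \<alpha>"
        then have "m \<le> card S" using assms unfolding m_def by linarith
        then obtain S0 where S0: "S0 \<subseteq> S" "card S0 = m" "finite S0"
          using obtain_subset_with_card_n by blast
        define G where "G = {p\<in>sieve_primes e N. \<not> real (residue_classes p S) > \<alpha>}"
        define I where "I = {(x, y, i). x \<in> S0 \<and> y \<in> S0 \<and> i < d \<and> x ! i \<noteq> y ! i}"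
        have I: "I \<subseteq> S0 \<times> S0 \<times> {..<d}" by (auto simp: I_def)
        then have fI: "finite I" using S0 finite_subset by blast
        have cI: "card I \<le> m * m * d"
          using card_mono[OF _ I] S0 by (simp add: card_cartesian_product)
        have rng: "x ! i \<in> {0..int N}" if "x \<in> S0" "i < d" for x i
          using that S0 S grid_nth by blast
        have pig: "\<exists>(x, y, i)\<in>I. x ! i mod int p = y ! i mod int p" if p: "p \<in> G" for p
        proof -
          have "card (reduce p ` S0) \<le> residue_classes p S"
            unfolding residue_classes_eq using fS S0 by (intro card_mono) auto
          moreover have "real (residue_classes p S) < m" using p m by (auto simp: G_def)
          ultimately have "card (reduce p ` S0) < card S0" using S0 by simp
          from pigeonhole[OF this] obtain x y where xy: "x \<in> S0" "y \<in> S0" "x \<noteq> y" "reduce p x = reduce p y"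
            by (auto simp: inj_on_def)
          have len: "length x = d" "length y = d" using xy S0 S grid_length by blast+
          then obtain i where i: "i < d" "x ! i \<noteq> y ! i" using xy(3) by (auto simp: list_eq_iff_nth_eq)
          have "x ! i mod int p = y ! i mod int p"
            using xy(4) reduce_nth[of i x p] reduce_nth[of i y p] len i by simp
          then show ?thesis using xy i by (auto simp: I_def)
        qed
        have "(\<Sum>p\<in>G. ln (real p)) \<le> (\<Sum>p\<in>G. \<Sum>(x, y, i)\<in>I. if x ! i mod int p = y ! i mod int p then ln (real p) else 0)"
        proof (rule sum_mono)
          fix p assume p: "p \<in> G"
          then have ln0: "0 \<le> ln (real p)" by (auto simp: G_def intro: ln_sieve_primes_nonneg)
          obtain j where j: "j \<in> I" "case j of (x, y, i) \<Rightarrow> x ! i mod int p = y ! i mod int p" using pig[OF p] by blast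
          then have "ln (real p) = (case j of (x, y, i) \<Rightarrow> if x ! i mod int p = y ! i mod int p then ln (real p) else 0)"
            by auto
          also have "\<dots> \<le> (\<Sum>(x, y, i)\<in>I. if x ! i mod int p = y ! i mod int p then ln (real p) else 0)"
            by (rule member_le_sum[OF j(1) _ fI]) (use ln0 in auto)
          finally show "ln (real p) \<le> (\<Sum>(x, y, i)\<in>I. if x ! i mod int p = y ! i mod int p then ln (real p) else 0)" .
        qed
        also have "\<dots> = (\<Sum>(x, y, i)\<in>I. \<Sum>p | p \<in> G \<and> x ! i mod int p = y ! i mod int p. ln (real p))"
        proof (subst sum.swap, rule sum.cong[OF refl])
          fix j :: "int list \<times> int list \<times> nat"
          have "finite G" by (simp add: G_def)
          then show "(\<Sum>p\<in>G. case j of (x, y, i) \<Rightarrow> if x ! i mod int p = y ! i mod int p then ln (real p) else 0)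
            = (case j of (x, y, i) \<Rightarrow> \<Sum>p | p \<in> G \<and> x ! i mod int p = y ! i mod int p. ln (real p))"
            by (cases j) (simp add: sum.If_cases Int_def)
        qed
        also have "\<dots> \<le> (\<Sum>j\<in>I. ln N)"
        proof (rule sum_mono)
          fix j assume "j \<in> I"
          then obtain x y i where j: "j = (x, y, i)" "x \<in> S0" "y \<in> S0" "i < d" "x ! i \<noteq> y ! i" by (auto simp: I_def)
          have "(\<Sum>p | p \<in> G \<and> x ! i mod int p = y ! i mod int p. ln (real p)) \<le> ln N"
            by (rule sum_ln_congruent) (use rng j in \<open>auto simp: G_def sieve_primes_prime\<close>)
          then show "(case j of (x, y, i) \<Rightarrow> \<Sum>p | p \<in> G \<and> x ! i mod int p = y ! i mod int p. ln (real p)) \<le> ln N"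
            by (simp add: j)
        qed
        also have "\<dots> = card I * ln N" by simp
        also have "\<dots> \<le> real (m * m * d + 1) * ln N"
        proof (rule mult_right_mono)
          have "card I \<le> m * m * d + 1" using cI by simp
          then show "real (card I) \<le> real (m * m * d + 1)" by (simp only: of_nat_le_iff)
        qed (use elim(3) in simp)
        finally have "(\<Sum>p\<in>G. ln (real p)) \<le> real (m * m * d + 1) * ln N" .
        moreover have "G \<subseteq> sieve_primes e N" by (auto simp: G_def)
        ultimately have "prime_weight G \<le> 1 / 4 * ?W" using elim(1) by blast
        moreover have "?W = prime_weight {p\<in>sieve_primes e N. real (residue_classes p S) > \<alpha>} + prime_weight G"
          unfolding total_weight_def prime_weight_def G_def
          by (subst sum.union_disjoint[symmetric]) (auto intro: sum.cong)
        ultimately show False using w elim(2) by linarith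
      qed
    qed
  qed
qed

text \<open>\<open>A \<subseteq> S\<close> keeps \<open>A\<close> inside the grid, where monomials
  have the size bound that Siegel's lemma asks for.\<close>

definition controllable :: "nat \<Rightarrow> nat \<Rightarrow> nat \<Rightarrow> real \<Rightarrow> real \<Rightarrow> int list set \<Rightarrow> bool" where
  "controllable d N R M \<eta> S \<longleftrightarrow> (\<exists>A S'. A \<subseteq> S \<and> S' \<subseteq> S \<and> real (card A) \<le> M
    \<and> (1 - \<eta>) * card S \<le> card S' \<and> controls d N R A S')"

lemma controlsD:
  fixes F :: "int list \<Rightarrow> int"
  assumes "controls d N R A S"
    and "\<And>p x y. reduce p x = reduce p y \<Longrightarrow> int p dvd F x - F y"
    and "\<And>x. x \<in> grid d N \<Longrightarrow> \<bar>F x\<bar> \<le> int N ^ R"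
    and "\<And>x. x \<in> A \<Longrightarrow> F x = 0" "x \<in> S"
  shows "F x = 0"
  using assms unfolding controls_def by blast

lemma controls_refl: "controls d N R A A"
  by (auto simp: controls_def)

lemma controls_UN:
  assumes "\<And>i. i \<in> I \<Longrightarrow> controls d N R (A i) (S i)"
  shows "controls d N R (\<Union>i\<in>I. A i) (\<Union>i\<in>I. S i)"
  unfolding controls_def
proof (intro allI impI ballI)
  fix F :: "int list \<Rightarrow> int" and x
  assume F: "\<forall>p x y. reduce p x = reduce p y \<longrightarrow> int p dvd F x - F y" "\<forall>x\<in>grid d N. \<bar>F x\<bar> \<le> int N ^ R"
    "\<forall>x\<in>\<Union> (A ` I). F x = 0" and "x \<in> \<Union> (S ` I)"
  then obtain i where "i \<in> I" "x \<in> S i" by blast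
  then show "F x = 0" using F by (intro controlsD[OF assms, of i F x]) auto
qed

lemma controls_trans:
  assumes "controls d N R A B'" "controls d N R B S" "B \<subseteq> B'"
  shows "controls d N R A S"
  using assms unfolding controls_def by blast

text \<open>\<open>\<gamma>\<close> must not depend on \<open>\<alpha>\<close>: the induction step picks the constant \<open>\<alpha>1\<close> for the slices in terms
  of the \<open>\<gamma>1\<close> of the induction hypothesis.\<close>
lemma controllable_step_spread:
  fixes e s \<kappa> \<eta> D :: real
  assumes "e > 0" "2 * e * d < s" "\<kappa> > 0" "\<eta> > 0" "\<eta> \<le> 1" "D > 0"
    and IH: "\<And>\<kappa> \<eta>::real. \<kappa> > 0 \<Longrightarrow> \<eta> > 0 \<Longrightarrow> \<exists>\<gamma>::real>0. \<forall>\<alpha>::real>0. \<exists>C::real>0. \<forall>R\<ge>1.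
      \<forall>\<^sub>F N in sequentially. \<forall>S\<subseteq>grid d N. \<kappa> * real N powr (real k - 1 + s) \<le> card S \<longrightarrow>
      prime_weight {p\<in>sieve_primes e N. real (residue_classes p S) > \<alpha> * real p ^ k} \<le> \<gamma> * total_weight e N \<longrightarrow>
      controllable d N R (C * real R ^ k) \<eta> S"
  shows "\<exists>\<gamma>::real>0. \<forall>\<alpha>::real>0. \<exists>C::real>0. \<forall>R\<ge>1.
      \<forall>\<^sub>F N in sequentially. \<forall>i<d. \<forall>T\<subseteq>grid d N. \<kappa> * real N powr (real k + s) \<le> card T \<longrightarrow> spread D e N i T \<longrightarrow>
      prime_weight {p\<in>sieve_primes e N. real (residue_classes p T) > \<alpha> * real p ^ Suc k} \<le> \<gamma> * total_weight e N \<longrightarrow>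
      controllable d N R (C * real R ^ Suc k) \<eta> T"
proof -
  \<comment> \<open>Slices below the threshold \<open>K\<close> then hold at most
    \<open>2 N K = \<eta>/8 * \<kappa> * N^(k + s)\<close> points.\<close>
  define \<kappa>1 where "\<kappa>1 = \<kappa> * \<eta> / 16"
  have \<kappa>1: "\<kappa>1 > 0" "\<eta> / 4 > 0" using assms by (auto simp: \<kappa>1_def)
  obtain \<gamma>1 :: real where \<gamma>1: "\<gamma>1 > 0" and IH1: "\<forall>\<alpha>::real>0. \<exists>C::real>0. \<forall>R\<ge>1.
      \<forall>\<^sub>F N in sequentially. \<forall>S\<subseteq>grid d N. \<kappa>1 * real N powr (real k - 1 + s) \<le> card S \<longrightarrow>
      prime_weight {p\<in>sieve_primes e N. real (residue_classes p S) > \<alpha> * real p ^ k} \<le> \<gamma>1 * total_weight e N \<longrightarrow>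
      controllable d N R (C * real R ^ k) (\<eta> / 4) S"
    using IH[OF \<kappa>1] by blast
  \<comment> \<open>The first bound fits the bad primes of \<open>T\<close> into the Markov estimate
    for \<open>Bw\<close>, the second meets the requirement of \<open>slices_control\<close> at
    \<open>\<eta>/2\<close>.\<close>
  define \<gamma> where "\<gamma> = min (\<gamma>1 * \<eta> / 16) (\<eta> / 32)"
  have \<gamma>: "\<gamma> > 0" "\<gamma> \<le> \<gamma>1 * \<eta> / 16" "\<gamma> \<le> \<eta> / 32" using \<gamma>1 assms by (auto simp: \<gamma>_def)
  have \<theta>: "\<gamma>1 * \<eta> / 16 > 0" using \<gamma>1 assms by simp
  obtain \<delta> :: real where \<delta>: "\<delta> > 0" and ev1: "\<forall>D. \<forall>\<^sub>F N in sequentially. \<forall>(T::int list set) (\<phi>::int list \<Rightarrow> int) (B::nat \<Rightarrow> int set).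
    finite T \<longrightarrow> \<phi> ` T \<subseteq> {0..int N} \<longrightarrow>
    (\<forall>x\<in>T. real (card {y\<in>T. \<phi> y = \<phi> x}) \<le> D * real N powr (- 2 * e) * card T) \<longrightarrow>
    (\<forall>p\<in>sieve_primes e N. finite (B p) \<and> real (card (B p)) \<le> \<delta> * p) \<longrightarrow>
    (\<Sum>p\<in>sieve_primes e N. ln (real p) / p * card {x\<in>T. \<phi> x mod int p \<in> B p}) \<le> \<gamma>1 * \<eta> / 16 * total_weight e N * card T"
    using few_residues[OF assms(1) \<theta>] by blast
  show ?thesis
  proof (rule exI[of _ \<gamma>], rule conjI, rule \<gamma>(1), intro allI impI)
    fix \<alpha> :: real assume \<alpha>: "\<alpha> > 0"
    \<comment> \<open>If \<open>T\<close> has at most \<open>\<alpha> p^(k+1)\<close> classes, then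
      at most \<open>\<delta> p\<close> residues have more than \<open>\<alpha>1 p^k\<close> classes
      above them.\<close>
    define \<alpha>1 where "\<alpha>1 = \<alpha> / \<delta>"
    have \<alpha>1: "\<alpha>1 > 0" using \<alpha> \<delta> by (simp add: \<alpha>1_def)
    obtain C1 :: real where C1: "C1 > 0" and ev2: "\<forall>R\<ge>1.
      \<forall>\<^sub>F N in sequentially. \<forall>S\<subseteq>grid d N. \<kappa>1 * real N powr (real k - 1 + s) \<le> card S \<longrightarrow>
      prime_weight {p\<in>sieve_primes e N. real (residue_classes p S) > \<alpha>1 * real p ^ k} \<le> \<gamma>1 * total_weight e N \<longrightarrow>
      controllable d N R (C1 * real R ^ k) (\<eta> / 4) S"
      using IH1 \<alpha>1 by blast
    \<comment> \<open>The halved slice size and the doubled spread constant allow for the passage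
      from \<open>T\<close> to \<open>T'\<close>, which keeps at least half of \<open>T\<close> and
      of each slice that it meets.\<close>
    have "\<kappa>1 / 2 > 0" "\<eta> / 2 > 0" "2 * D \<ge> 0" using \<kappa>1 assms by auto
    from slices_control[OF assms(1,2) this(1) \<alpha> this(2,3), of k]
    obtain C2 :: real where C2: "C2 > 0" and ev3: "\<forall>R::nat. \<forall>\<^sub>F N in sequentially. \<forall>i<d. \<forall>T\<subseteq>grid d N. spread (2 * D) e N i T \<longrightarrow>
      (\<forall>x\<in>T. \<kappa>1 / 2 * real N powr (real k - 1 + s) \<le> card (slice T i (x ! i))) \<longrightarrow>
      prime_weight {p\<in>sieve_primes e N. real (residue_classes p T) > \<alpha> * real p ^ Suc k} \<le> \<eta> / 2 / 16 * total_weight e N \<longrightarrow>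
      (\<exists>J T'. finite J \<and> real (card J) \<le> C2 * (R + 1) \<and> T' \<subseteq> T \<and> (1 - \<eta> / 2) * card T \<le> card T'
        \<and> controls d N R {z\<in>T. z ! i \<in> J} T')" by blast
    show "\<exists>C::real>0. \<forall>R\<ge>1.
      \<forall>\<^sub>F N in sequentially. \<forall>i<d. \<forall>T\<subseteq>grid d N. \<kappa> * real N powr (real k + s) \<le> card T \<longrightarrow> spread D e N i T \<longrightarrow>
      prime_weight {p\<in>sieve_primes e N. real (residue_classes p T) > \<alpha> * real p ^ Suc k} \<le> \<gamma> * total_weight e N \<longrightarrow>
      controllable d N R (C * real R ^ Suc k) \<eta> T"
    proof (intro exI[of _ "2 * C1 * C2"] conjI allI impI)
      fix R :: nat assume R: "R \<ge> 1"
      have evN: "\<forall>\<^sub>F N::nat in sequentially. N \<ge> 1" by (rule eventually_ge_at_top)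
      show "\<forall>\<^sub>F N in sequentially. \<forall>i<d. \<forall>T\<subseteq>grid d N. \<kappa> * real N powr (real k + s) \<le> card T \<longrightarrow> spread D e N i T \<longrightarrow>
        prime_weight {p\<in>sieve_primes e N. real (residue_classes p T) > \<alpha> * real p ^ Suc k} \<le> \<gamma> * total_weight e N \<longrightarrow>
        controllable d N R (2 * C1 * C2 * real R ^ Suc k) \<eta> T"
        using ev1[rule_format, of D] ev2[rule_format, OF R] ev3[rule_format, of R] evN total_weight_pos[OF assms(1)]
      proof eventually_elim
        case (elim N)
        let ?P = "sieve_primes e N" and ?W = "total_weight e N"
        show ?case
        proof (intro allI impI)
          fix i T
          define Bad where "Bad = {p\<in>?P. real (residue_classes p T) > \<alpha> * real p ^ Suc k}"
          assume i: "i < d" and T: "T \<subseteq> grid d N" and large: "\<kappa> * real N powr (real k + s) \<le> card T"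
            and sp: "spread D e N i T"
            and "prime_weight {p\<in>?P. real (residue_classes p T) > \<alpha> * real p ^ Suc k} \<le> \<gamma> * ?W"
          then have bad: "prime_weight Bad \<le> \<gamma> * ?W" by (simp add: Bad_def)
          have fT: "finite T" by (rule finite_subset_grid[OF T])
          define t where "t = real (card T)"
          have t: "t \<ge> 0" by (simp add: t_def)
          have w0: "0 \<le> ln (real p) / p" if "p \<in> ?P" for p using weight_nonneg[OF that] .
          define K where "K = \<kappa>1 * real N powr (real k - 1 + s)"
          have K0: "K \<ge> 0" using \<kappa>1 by (simp add: K_def)
          define bw where "bw a = prime_weight {p\<in>?P. real (residue_classes p (slice T i a)) > \<alpha>1 * real p ^ k}" for a
          define Sm where "Sm = {x\<in>T. real (card (slice T i (x ! i))) < K}"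
          define Bw where "Bw = {x\<in>T. bw (x ! i) > \<gamma>1 * ?W}"
          have cSm: "real (card Sm) \<le> \<eta> / 8 * t"
          proof -
            have "real (card Sm) \<le> 2 * real N * K"
              unfolding Sm_def by (rule card_small_slices[OF T i elim(4) K0])
            also have "\<dots> = \<eta> / 8 * (\<kappa> * real N powr (real k + s))"
              unfolding K_def powr_small_slices[OF elim(4)] by (simp add: \<kappa>1_def)
            also have "\<dots> \<le> \<eta> / 8 * t" unfolding t_def using large assms by (intro mult_left_mono) auto
            finally show ?thesis .
          qed
          \<comment> \<open>Apart from the bad primes of \<open>T\<close>, a slice has too many
            classes modulo \<open>p\<close> only if its coordinate lies over a residue in
            \<open>B p\<close>. \<open>few_residues\<close> bounds the average weight of such
            primes, and Markov's inequality bounds the points on slices where it exceeds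
            \<open>\<gamma>1 * ?W\<close>.\<close>
          have cBw: "real (card Bw) \<le> \<eta> / 8 * t"
          proof -
            define B where "B p = (if p \<in> Bad then {} else
              {b\<in>{0..<int p}. real (residue_classes p {x\<in>T. x ! i mod int p = b}) > \<alpha>1 * real p ^ k})" for p
            have fat: "(\<Sum>p\<in>?P. ln (real p) / p * card {x\<in>T. x ! i mod int p \<in> B p}) \<le> \<gamma>1 * \<eta> / 16 * ?W * t"
            proof -
              have "real (card (B p)) \<le> \<delta> * p" if p: "p \<in> ?P" for p
              proof (cases "p \<in> Bad")
                case False
                have "card (B p) * (\<alpha>1 * real p ^ k) \<le> residue_classes p T"
                  using card_fat_residues[OF T i, where p = p and \<beta> = "\<alpha>1 * real p ^ k"] False by (simp add: B_def)
                also have "\<dots> \<le> \<alpha> * real p ^ Suc k" using p False by (auto simp: Bad_def)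
                also have "\<dots> = (\<delta> * p) * (\<alpha>1 * real p ^ k)" using \<delta> by (simp add: \<alpha>1_def)
                finally show ?thesis
                  using \<alpha>1 sieve_primes_ge_2[OF p] by (subst (asm) mult_le_cancel_right_pos) auto
              qed (use \<delta> in \<open>simp add: B_def\<close>)
              moreover have "finite (B p)" for p
                unfolding B_def by (auto intro: finite_subset[of _ "{0..<int p}"])
              moreover have "(\<lambda>x. x ! i) ` T \<subseteq> {0..int N}" using T grid_nth[OF _ i] by blast
              ultimately show ?thesis
                using elim(1)[rule_format, of T "\<lambda>x. x ! i" B] fT sp unfolding spread_def slice_def t_def by blast
            qed
            have "card Bw * (\<gamma>1 * ?W) = (\<Sum>x\<in>Bw. \<gamma>1 * ?W)" by simp
            also have "\<dots> \<le> (\<Sum>x\<in>Bw. bw (x ! i))" by (intro sum_mono) (auto simp: Bw_def)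
            also have "\<dots> \<le> (\<Sum>x\<in>T. bw (x ! i))"
              using fT w0 by (intro sum_mono2) (auto simp: Bw_def bw_def prime_weight_def intro!: sum_nonneg)
            also have "\<dots> = (\<Sum>x\<in>T. \<Sum>p\<in>?P. if real (residue_classes p (slice T i (x ! i))) > \<alpha>1 * real p ^ k
                then ln (real p) / p else 0)"
              by (simp add: bw_def prime_weight_def sum.If_cases Int_def)
            also have "\<dots> = (\<Sum>p\<in>?P. ln (real p) / p *
                card {x\<in>T. real (residue_classes p (slice T i (x ! i))) > \<alpha>1 * real p ^ k})"
              using fT by (subst sum.swap) (simp add: sum.If_cases Int_def mult.commute)
            also have "\<dots> \<le> (\<Sum>p\<in>?P. ln (real p) / p * ((if p \<in> Bad then t else 0) + card {x\<in>T. x ! i mod int p \<in> B p}))"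
            proof (rule sum_mono, rule mult_left_mono)
              fix p assume p: "p \<in> ?P"
              let ?X = "{x\<in>T. real (residue_classes p (slice T i (x ! i))) > \<alpha>1 * real p ^ k}"
              show "real (card ?X) \<le> (if p \<in> Bad then t else 0) + card {x\<in>T. x ! i mod int p \<in> B p}"
              proof (cases "p \<in> Bad")
                case True
                have "real (card ?X) \<le> t" unfolding t_def using fT by (intro of_nat_mono card_mono) auto
                then show ?thesis using True by simp
              next
                case False
                have "?X \<subseteq> {x\<in>T. x ! i mod int p \<in> B p}"
                proof
                  fix x assume x: "x \<in> ?X"
                  have "residue_classes p (slice T i (x ! i)) \<le> residue_classes p {y\<in>T. y ! i mod int p = x ! i mod int p}"
                    using fT by (intro residue_classes_mono) (auto simp: slice_def)
                  moreover have "real (residue_classes p (slice T i (x ! i))) > \<alpha>1 * real p ^ k" using x by simp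
                  ultimately have "real (residue_classes p {y\<in>T. y ! i mod int p = x ! i mod int p}) > \<alpha>1 * real p ^ k"
                    by linarith
                  then show "x \<in> {x\<in>T. x ! i mod int p \<in> B p}"
                    using x False sieve_primes_ge_2[OF p] by (auto simp: B_def)
                qed
                then have "card ?X \<le> card {x\<in>T. x ! i mod int p \<in> B p}" using fT by (intro card_mono) auto
                then show ?thesis using False by simp
              qed
            qed (use w0 in auto)
            also have "\<dots> = (\<Sum>p\<in>?P. if p \<in> Bad then ln (real p) / p * t else 0)
                + (\<Sum>p\<in>?P. ln (real p) / p * card {x\<in>T. x ! i mod int p \<in> B p})"
              by (simp add: distrib_left sum.distrib if_distrib[of "\<lambda>z. _ * z"] cong: if_cong)
            also have "(\<Sum>p\<in>?P. if p \<in> Bad then ln (real p) / p * t else 0) = prime_weight Bad * t"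
            proof -
              have "?P \<inter> Bad = Bad" by (auto simp: Bad_def)
              then show ?thesis by (simp add: sum.If_cases prime_weight_def sum_distrib_right)
            qed
            also have "\<dots> \<le> \<gamma>1 * \<eta> / 16 * ?W * t"
            proof (rule mult_right_mono[OF _ t])
              have "\<gamma> * ?W \<le> \<gamma>1 * \<eta> / 16 * ?W" using \<gamma>(2) elim(5) by (intro mult_right_mono) auto
              then show "prime_weight Bad \<le> \<gamma>1 * \<eta> / 16 * ?W" using bad by linarith
            qed
            finally have "card Bw * (\<gamma>1 * ?W) \<le> (\<eta> / 8 * t) * (\<gamma>1 * ?W)" using fat by (simp add: algebra_simps)
            then show ?thesis using \<gamma>1 elim(5) by (subst (asm) mult_le_cancel_right_pos) auto
          qed
          define good where "good a \<longleftrightarrow> K \<le> card (slice T i a) \<and> bw a \<le> \<gamma>1 * ?W" for a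
          have "\<forall>a. \<exists>A S'. good a \<longrightarrow> A \<subseteq> slice T i a \<and> S' \<subseteq> slice T i a \<and> real (card A) \<le> C1 * real R ^ k
              \<and> (1 - \<eta> / 4) * card (slice T i a) \<le> card S' \<and> controls d N R A S'"
          proof
            fix a
            have "controllable d N R (C1 * real R ^ k) (\<eta> / 4) (slice T i a)" if "good a"
              using elim(2)[rule_format, of "slice T i a"] that T slice_subset[of T i a]
              unfolding good_def K_def bw_def by blast
            then show "\<exists>A S'. good a \<longrightarrow> A \<subseteq> slice T i a \<and> S' \<subseteq> slice T i a \<and> real (card A) \<le> C1 * real R ^ k
              \<and> (1 - \<eta> / 4) * card (slice T i a) \<le> card S' \<and> controls d N R A S'"
              unfolding controllable_def by blast
          qed
          from choice[OF this] obtain Af where "\<forall>a. \<exists>S'. good a \<longrightarrow> Af a \<subseteq> slice T i a \<and> S' \<subseteq> slice T i a \<and> real (card (Af a)) \<le> C1 * real R ^ k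
              \<and> (1 - \<eta> / 4) * card (slice T i a) \<le> card S' \<and> controls d N R (Af a) S'" ..
          from choice[OF this] obtain Sf where sel: "\<forall>a. good a \<longrightarrow> Af a \<subseteq> slice T i a \<and> Sf a \<subseteq> slice T i a \<and> real (card (Af a)) \<le> C1 * real R ^ k
              \<and> (1 - \<eta> / 4) * card (slice T i a) \<le> card (Sf a) \<and> controls d N R (Af a) (Sf a)" ..
          have Af: "Af a \<subseteq> slice T i a" "real (card (Af a)) \<le> C1 * real R ^ k"
            and Sf: "Sf a \<subseteq> slice T i a" "(1 - \<eta> / 4) * card (slice T i a) \<le> card (Sf a)"
            and ctl: "controls d N R (Af a) (Sf a)" if "good a" for a
            using sel[rule_format, OF that] by simp_all
          \<comment> \<open>Each good slice is cut down to the part controlled by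
            \<open>Af a\<close> before slices are chosen, so that whole slices of \<open>T'\<close>
            may later be replaced by the small sets \<open>Af a\<close>.\<close>
          define T' where "T' = {x\<in>T. good (x ! i) \<and> x \<in> Sf (x ! i)}"
          have T'T: "T' \<subseteq> T" by (auto simp: T'_def)
          then have fT': "finite T'" using fT finite_subset by blast
          define A0 where "A0 = {a\<in>(\<lambda>x. x ! i) ` T. good a}"
          have fA0: "finite A0" using fT by (simp add: A0_def)
          have fslice: "finite (slice T i a)" for a using fT by (simp add: slice_def)
          have lost: "real (card (slice T i a - Sf a)) \<le> \<eta> / 4 * card (slice T i a)" if "a \<in> A0" for a
          proof -
            have g: "good a" using that by (simp add: A0_def)
            have "card (slice T i a) = card (Sf a) + card (slice T i a - Sf a)"
              using Sf(1)[OF g] fslice[of a] by (metis card_Diff_subset card_mono finite_subset le_add_diff_inverse)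
            then show ?thesis using Sf(2)[OF g] by (simp add: algebra_simps)
          qed
          have "T - T' \<subseteq> Sm \<union> Bw \<union> (\<Union>a\<in>A0. slice T i a - Sf a)"
          proof
            fix x assume "x \<in> T - T'"
            then show "x \<in> Sm \<union> Bw \<union> (\<Union>a\<in>A0. slice T i a - Sf a)"
              by (cases "good (x ! i)") (auto simp: T'_def Sm_def Bw_def A0_def good_def slice_def)
          qed
          then have "card (T - T') \<le> card (Sm \<union> Bw \<union> (\<Union>a\<in>A0. slice T i a - Sf a))"
            by (rule card_mono[rotated]) (use fT fA0 fslice in \<open>auto simp: Sm_def Bw_def\<close>)
          also have "\<dots> \<le> card Sm + card Bw + card (\<Union>a\<in>A0. slice T i a - Sf a)"
            by (meson card_Un_le add_right_mono order_trans)
          also have "\<dots> \<le> card Sm + card Bw + (\<Sum>a\<in>A0. card (slice T i a - Sf a))"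
            by (intro add_left_mono card_UN_le fA0)
          finally have "real (card (T - T')) \<le> real (card Sm) + real (card Bw) + (\<Sum>a\<in>A0. real (card (slice T i a - Sf a)))"
            by (simp only: of_nat_add[symmetric] of_nat_sum[symmetric] of_nat_le_iff)
          also have "(\<Sum>a\<in>A0. real (card (slice T i a - Sf a))) \<le> (\<Sum>a\<in>A0. \<eta> / 4 * card (slice T i a))"
            by (intro sum_mono lost)
          also have "\<dots> = \<eta> / 4 * (\<Sum>a\<in>A0. real (card (slice T i a)))" by (simp add: sum_distrib_left)
          also have "\<dots> \<le> \<eta> / 4 * t"
            unfolding t_def using assms by (intro mult_left_mono sum_card_slices_le fT fA0) auto
          finally have lostT: "real (card (T - T')) \<le> \<eta> / 2 * t" using cSm cBw by simp
          define t' where "t' = real (card T')"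
          have "card T = card T' + card (T - T')"
            using T'T fT by (metis card_Diff_subset card_mono finite_subset le_add_diff_inverse)
          then have t': "t' \<ge> (1 - \<eta> / 2) * t" using lostT by (simp add: t_def t'_def algebra_simps)
          have half: "t \<le> 2 * t'"
          proof -
            have "\<eta> * t \<le> 1 * t" using assms(5) t by (rule mult_right_mono)
            then show ?thesis using t' by (simp add: algebra_simps)
          qed
          have sp': "spread (2 * D) e N i T'" unfolding spread_def
          proof
            fix x assume x: "x \<in> T'"
            have "card (slice T' i (x ! i)) \<le> card (slice T i (x ! i))"
              using fslice T'T by (intro card_mono) (auto simp: slice_def)
            also have "real \<dots> \<le> D * real N powr (- 2 * e) * t"
              using sp x T'T by (auto simp: spread_def t_def)
            also have "\<dots> \<le> D * real N powr (- 2 * e) * (2 * t')"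
              using half assms(6) by (intro mult_left_mono) auto
            finally show "real (card (slice T' i (x ! i))) \<le> 2 * D * real N powr (- 2 * e) * card T'"
              by (simp add: t'_def mult_ac)
          qed
          \<comment> \<open>A slice met by \<open>T'\<close> keeps all of \<open>Sf (x ! i)\<close>,
            hence most of its points.\<close>
          have large': "\<kappa>1 / 2 * real N powr (real k - 1 + s) \<le> card (slice T' i (x ! i))" if x: "x \<in> T'" for x
          proof -
            have g: "good (x ! i)" using x by (simp add: T'_def)
            have "Sf (x ! i) \<subseteq> slice T' i (x ! i)"
              using Sf(1)[OF g] g by (auto simp: T'_def slice_def)
            then have "card (Sf (x ! i)) \<le> card (slice T' i (x ! i))"
              using fT' by (intro card_mono) (auto simp: slice_def)
            moreover have "(1 - \<eta> / 4) * card (slice T i (x ! i)) \<ge> 1 / 2 * K"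
              using g assms(5) K0 by (intro mult_mono) (auto simp: good_def)
            ultimately show ?thesis using Sf(2)[OF g] by (simp add: K_def)
          qed
          have bad': "prime_weight {p\<in>?P. real (residue_classes p T') > \<alpha> * real p ^ Suc k} \<le> \<eta> / 2 / 16 * ?W"
          proof -
            have "{p\<in>?P. real (residue_classes p T') > \<alpha> * real p ^ Suc k} \<subseteq> Bad"
            proof
              fix p assume p: "p \<in> {p\<in>?P. real (residue_classes p T') > \<alpha> * real p ^ Suc k}"
              have "residue_classes p T' \<le> residue_classes p T" by (rule residue_classes_mono[OF fT T'T])
              then have "real (residue_classes p T') \<le> real (residue_classes p T)" by simp
              with p have "real (residue_classes p T) > \<alpha> * real p ^ Suc k" by (auto intro: less_le_trans)
              then show "p \<in> Bad" using p by (simp add: Bad_def)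
            qed
            then have "prime_weight {p\<in>?P. real (residue_classes p T') > \<alpha> * real p ^ Suc k} \<le> prime_weight Bad"
              by (rule prime_weight_mono) (auto simp: Bad_def)
            also have "\<dots> \<le> \<gamma> * ?W" by (rule bad)
            also have "\<dots> \<le> \<eta> / 2 / 16 * ?W" using \<gamma>(3) elim(5) by (intro mult_right_mono) auto
            finally show ?thesis .
          qed
          have "T' \<subseteq> grid d N" using T T'T by blast
          from elim(3)[rule_format, OF i this sp' large' bad']
          obtain J T'' where J: "finite J" "real (card J) \<le> C2 * (R + 1)" and T'': "T'' \<subseteq> T'" "(1 - \<eta> / 2) * card T' \<le> card T''"
            and ctl2: "controls d N R {z\<in>T'. z ! i \<in> J} T''" by blast
          \<comment> \<open>Two stages of control: the sets \<open>Af a\<close> control the slices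
            of \<open>T'\<close> over \<open>J\<close>, and these control \<open>T''\<close>. The
            sizes multiply, \<open>O(R)\<close> slices with \<open>O(R^k)\<close> points
            each.\<close>
          define A where "A = (\<Union>a\<in>{a\<in>J. good a}. Af a)"
          have "A \<subseteq> T" using Af(1) slice_subset by (fastforce simp: A_def)
          moreover have "T'' \<subseteq> T" using T'' T'T by blast
          moreover have "real (card A) \<le> 2 * C1 * C2 * real R ^ Suc k"
          proof -
            have "card A \<le> (\<Sum>a\<in>{a\<in>J. good a}. card (Af a))"
              unfolding A_def using J(1) by (intro card_UN_le) auto
            then have "real (card A) \<le> (\<Sum>a\<in>{a\<in>J. good a}. real (card (Af a)))"
              by (metis of_nat_le_iff of_nat_sum)
            also have "\<dots> \<le> (\<Sum>a\<in>{a\<in>J. good a}. C1 * real R ^ k)" by (intro sum_mono Af(2)) auto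
            also have "\<dots> = card {a\<in>J. good a} * (C1 * real R ^ k)" by simp
            also have "\<dots> \<le> (C2 * (2 * R)) * (C1 * real R ^ k)"
            proof (rule mult_right_mono)
              have "real (card {a\<in>J. good a}) \<le> card J" using J(1) by (intro of_nat_mono card_mono) auto
              also have "\<dots> \<le> C2 * (R + 1)" by (rule J(2))
              also have "\<dots> \<le> C2 * (2 * R)" using R C2 by (intro mult_left_mono) auto
              finally show "real (card {a\<in>J. good a}) \<le> C2 * (2 * R)" .
            qed (use C1 in simp)
            finally show ?thesis by (simp add: mult_ac)
          qed
          moreover have "(1 - \<eta>) * card T \<le> card T''"
          proof -
            have "(1 - \<eta>) * t \<le> (1 - \<eta> / 2) * ((1 - \<eta> / 2) * t)"
              using t assms(4) by (simp add: algebra_simps)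
            also have "\<dots> \<le> (1 - \<eta> / 2) * t'" using t' assms(5) by (intro mult_left_mono) auto
            finally show ?thesis using T''(2) by (simp add: t_def t'_def)
          qed
          moreover have "controls d N R A T''"
          proof (rule controls_trans[OF _ ctl2])
            show "controls d N R A (\<Union>a\<in>{a\<in>J. good a}. Sf a)"
              unfolding A_def by (rule controls_UN) (use ctl in auto)
            show "{z \<in> T'. z ! i \<in> J} \<subseteq> (\<Union>a\<in>{a\<in>J. good a}. Sf a)" by (auto simp: T'_def)
          qed
          ultimately show "controllable d N R (2 * C1 * C2 * real R ^ Suc k) \<eta> T"
            unfolding controllable_def by blast
        qed
      qed
    qed (use C1 C2 in simp)
  qed
qed

text \<open>\<open>spread_decomposition\<close> reduces the step to spread parts, whose controlling
  sets are united. Exceptional primes must be tolerated here because the induction hypothesis is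
  applied to slices, which may occupy too many classes modulo some primes even if \<open>S\<close>
  never does.\<close>

lemma large_imp_controllable:
  fixes e s :: real
  assumes "e > 0" "2 * e * d < s" "\<kappa> > 0" "\<eta> > 0"
  shows "\<exists>\<gamma>::real>0. \<forall>\<alpha>::real>0. \<exists>C::real>0. \<forall>R\<ge>1.
      \<forall>\<^sub>F N in sequentially. \<forall>S\<subseteq>grid d N. \<kappa> * real N powr (real k - 1 + s) \<le> card S \<longrightarrow>
      prime_weight {p\<in>sieve_primes e N. real (residue_classes p S) > \<alpha> * real p ^ k} \<le> \<gamma> * total_weight e N \<longrightarrow>
      controllable d N R (C * real R ^ k) \<eta> S"
  using assms(3,4)
proof (induction k arbitrary: \<kappa> \<eta>)
  case 0
  show ?case
  \<comment> \<open>With at most half of the weight exceptional, \<open>few_classes_bounded\<close>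
    leaves at most \<open>\<alpha>\<close> points, and \<open>S\<close> controls itself.\<close>
  proof (rule exI[of _ "1/2"], rule conjI, simp, intro allI impI)
    fix \<alpha> :: real assume \<alpha>: "\<alpha> > 0"
    show "\<exists>C::real>0. \<forall>R\<ge>1.
      \<forall>\<^sub>F N in sequentially. \<forall>S\<subseteq>grid d N. \<kappa> * real N powr (real 0 - 1 + s) \<le> card S \<longrightarrow>
      prime_weight {p\<in>sieve_primes e N. real (residue_classes p S) > \<alpha> * real p ^ 0} \<le> 1/2 * total_weight e N \<longrightarrow>
      controllable d N R (C * real R ^ 0) \<eta> S"
    proof (intro exI[of _ \<alpha>] conjI \<alpha> allI impI)
      fix R :: nat
      show "\<forall>\<^sub>F N in sequentially. \<forall>S\<subseteq>grid d N. \<kappa> * real N powr (real 0 - 1 + s) \<le> card S \<longrightarrow>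
        prime_weight {p\<in>sieve_primes e N. real (residue_classes p S) > \<alpha> * real p ^ 0} \<le> 1/2 * total_weight e N \<longrightarrow>
        controllable d N R (\<alpha> * real R ^ 0) \<eta> S"
        using few_classes_bounded[OF assms(1) \<alpha>, of d]
      proof eventually_elim
        case (elim N)
        show ?case
        proof (intro allI impI)
          fix S assume S: "S \<subseteq> grid d N"
            and "prime_weight {p\<in>sieve_primes e N. real (residue_classes p S) > \<alpha> * real p ^ 0} \<le> 1/2 * total_weight e N"
          then have "real (card S) \<le> \<alpha>" using elim by simp
          moreover have "(1 - \<eta>) * card S \<le> card S" using 0 by (simp add: algebra_simps)
          ultimately show "controllable d N R (\<alpha> * real R ^ 0) \<eta> S"
            unfolding controllable_def using controls_refl by (intro exI[of _ S]) auto
        qed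
      qed
    qed
  qed
next
  case (Suc k)
  have "\<eta> / 2 > 0" using Suc.prems by simp
  from spread_decomposition[OF assms(1,2) Suc.prems(1) this] obtain D :: real where D: "D > 0"
    and ev1: "\<forall>\<^sub>F N in sequentially. \<forall>S\<subseteq>grid d N. \<kappa> * real N powr s \<le> card S \<longrightarrow>
    (\<exists>T. (\<forall>i<d. T i \<subseteq> S \<and> (T i = {} \<or> card S \<le> D * card (T i) \<and> spread D e N i (T i)))
      \<and> card (S - (\<Union>i<d. T i)) \<le> \<eta> / 2 * card S)" by blast
  \<comment> \<open>Cut at 1 as \<open>controllable_step_spread\<close> demands; all
    \<open>d\<close> parts together lose at most \<open>\<eta>/2\<close>.\<close>
  define \<eta>1 where "\<eta>1 = min 1 (\<eta> / (2 * (d + 1)))"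
  have *: "\<kappa> / D > 0" "\<eta>1 > 0" "\<eta>1 \<le> 1" using Suc.prems D by (auto simp: \<eta>1_def)
  have d\<eta>1: "d * \<eta>1 \<le> \<eta> / 2"
  proof -
    have "d * \<eta>1 \<le> d * (\<eta> / (2 * (d + 1)))" by (intro mult_left_mono) (auto simp: \<eta>1_def)
    also have "\<dots> \<le> \<eta> / 2" using Suc.prems by (simp add: field_simps)
    finally show ?thesis .
  qed
  from controllable_step_spread[OF assms(1,2) * D Suc.IH]
  obtain \<gamma> :: real where \<gamma>: "\<gamma> > 0" and step: "\<forall>\<alpha>::real>0. \<exists>C::real>0. \<forall>R\<ge>1.
      \<forall>\<^sub>F N in sequentially. \<forall>i<d. \<forall>T\<subseteq>grid d N. \<kappa> / D * real N powr (real k + s) \<le> card T \<longrightarrow> spread D e N i T \<longrightarrow>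
      prime_weight {p\<in>sieve_primes e N. real (residue_classes p T) > \<alpha> * real p ^ Suc k} \<le> \<gamma> * total_weight e N \<longrightarrow>
      controllable d N R (C * real R ^ Suc k) \<eta>1 T" by blast
  show ?case
  proof (rule exI[of _ \<gamma>], rule conjI, rule \<gamma>, intro allI impI)
    fix \<alpha> :: real assume \<alpha>: "\<alpha> > 0"
    obtain C :: real where C: "C > 0" and ev2: "\<forall>R\<ge>1.
      \<forall>\<^sub>F N in sequentially. \<forall>i<d. \<forall>T\<subseteq>grid d N. \<kappa> / D * real N powr (real k + s) \<le> card T \<longrightarrow> spread D e N i T \<longrightarrow>
      prime_weight {p\<in>sieve_primes e N. real (residue_classes p T) > \<alpha> * real p ^ Suc k} \<le> \<gamma> * total_weight e N \<longrightarrow>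
      controllable d N R (C * real R ^ Suc k) \<eta>1 T" using step \<alpha> by blast
    show "\<exists>C::real>0. \<forall>R\<ge>1.
      \<forall>\<^sub>F N in sequentially. \<forall>S\<subseteq>grid d N. \<kappa> * real N powr (real (Suc k) - 1 + s) \<le> card S \<longrightarrow>
      prime_weight {p\<in>sieve_primes e N. real (residue_classes p S) > \<alpha> * real p ^ Suc k} \<le> \<gamma> * total_weight e N \<longrightarrow>
      controllable d N R (C * real R ^ Suc k) \<eta> S"
    proof (intro exI[of _ "(d + 1) * C"] conjI allI impI)
      fix R :: nat assume R: "R \<ge> 1"
      have evN: "\<forall>\<^sub>F N::nat in sequentially. N \<ge> 1" by (rule eventually_ge_at_top)
      show "\<forall>\<^sub>F N in sequentially. \<forall>S\<subseteq>grid d N. \<kappa> * real N powr (real (Suc k) - 1 + s) \<le> card S \<longrightarrow>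
        prime_weight {p\<in>sieve_primes e N. real (residue_classes p S) > \<alpha> * real p ^ Suc k} \<le> \<gamma> * total_weight e N \<longrightarrow>
        controllable d N R ((d + 1) * C * real R ^ Suc k) \<eta> S"
        using ev1 ev2[rule_format, OF R] evN
      proof eventually_elim
        case (elim N)
        let ?P = "sieve_primes e N" and ?W = "total_weight e N"
        show ?case
        proof (intro allI impI)
          fix S
          assume S: "S \<subseteq> grid d N" and large: "\<kappa> * real N powr (real (Suc k) - 1 + s) \<le> card S"
            and bad: "prime_weight {p\<in>?P. real (residue_classes p S) > \<alpha> * real p ^ Suc k} \<le> \<gamma> * ?W"
          have fS: "finite S" by (rule finite_subset_grid[OF S])
          have large': "\<kappa> * real N powr (real k + s) \<le> card S" using large by simp
          have "\<kappa> * real N powr s \<le> \<kappa> * real N powr (real k + s)"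
            using powr_add_ge[OF elim(3)] Suc.prems by (intro mult_left_mono) auto
          then have "\<kappa> * real N powr s \<le> card S" using large' by linarith
          from elim(1)[rule_format, OF S this]
          obtain T where T: "\<And>i. i < d \<Longrightarrow> T i \<subseteq> S \<and> (T i = {} \<or> card S \<le> D * card (T i) \<and> spread D e N i (T i))"
            and rem: "card (S - (\<Union>i<d. T i)) \<le> \<eta> / 2 * card S" by blast
          have fTi: "finite (T i)" if "i < d" for i using T[OF that] fS finite_subset by blast
          have ctlT: "controllable d N R (C * real R ^ Suc k) \<eta>1 (T i)" if i: "i < d" for i
          proof (cases "T i = {}")
            case True
            then show ?thesis
              unfolding controllable_def using C by (intro exI[of _ "{}"]) (auto simp: controls_def)
          next
            case False
            then have b: "card S \<le> D * card (T i)" "spread D e N i (T i)" using T[OF i] by auto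
            then have l: "\<kappa> / D * real N powr (real k + s) \<le> card (T i)"
              using large' D by (simp add: field_simps)
            have "{p\<in>?P. real (residue_classes p (T i)) > \<alpha> * real p ^ Suc k}
                \<subseteq> {p\<in>?P. real (residue_classes p S) > \<alpha> * real p ^ Suc k}"
            proof
              fix p assume p: "p \<in> {p\<in>?P. real (residue_classes p (T i)) > \<alpha> * real p ^ Suc k}"
              have "residue_classes p (T i) \<le> residue_classes p S" using T[OF i] fS by (intro residue_classes_mono) auto
              then have "real (residue_classes p (T i)) \<le> real (residue_classes p S)" by simp
              with p have "real (residue_classes p S) > \<alpha> * real p ^ Suc k" by (auto intro: less_le_trans)
              then show "p \<in> {p\<in>?P. real (residue_classes p S) > \<alpha> * real p ^ Suc k}" using p by simp
            qed
            then have "prime_weight {p\<in>?P. real (residue_classes p (T i)) > \<alpha> * real p ^ Suc k}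
                \<le> prime_weight {p\<in>?P. real (residue_classes p S) > \<alpha> * real p ^ Suc k}"
              by (rule prime_weight_mono) auto
            then have bw: "prime_weight {p\<in>?P. real (residue_classes p (T i)) > \<alpha> * real p ^ Suc k} \<le> \<gamma> * ?W"
              using bad by linarith
            have "T i \<subseteq> grid d N" using T[OF i] S by blast
            from elim(2)[rule_format, OF i this l b(2) bw] show ?thesis .
          qed
          have "\<forall>i. \<exists>A S'. i < d \<longrightarrow> A \<subseteq> T i \<and> S' \<subseteq> T i \<and> real (card A) \<le> C * real R ^ Suc k
              \<and> (1 - \<eta>1) * card (T i) \<le> card S' \<and> controls d N R A S'"
          proof
            fix i
            show "\<exists>A S'. i < d \<longrightarrow> A \<subseteq> T i \<and> S' \<subseteq> T i \<and> real (card A) \<le> C * real R ^ Suc k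
              \<and> (1 - \<eta>1) * card (T i) \<le> card S' \<and> controls d N R A S'"
              using ctlT[of i] unfolding controllable_def by (cases "i < d") simp_all
          qed
          from choice[OF this] obtain Af where "\<forall>i. \<exists>S'. i < d \<longrightarrow> Af i \<subseteq> T i \<and> S' \<subseteq> T i \<and> real (card (Af i)) \<le> C * real R ^ Suc k
              \<and> (1 - \<eta>1) * card (T i) \<le> card S' \<and> controls d N R (Af i) S'" ..
          from choice[OF this] obtain Sf where sel: "\<forall>i. i < d \<longrightarrow> Af i \<subseteq> T i \<and> Sf i \<subseteq> T i \<and> real (card (Af i)) \<le> C * real R ^ Suc k
              \<and> (1 - \<eta>1) * card (T i) \<le> card (Sf i) \<and> controls d N R (Af i) (Sf i)" ..
          have Af: "Af i \<subseteq> T i" "real (card (Af i)) \<le> C * real R ^ Suc k"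
            and Sf: "Sf i \<subseteq> T i" "(1 - \<eta>1) * card (T i) \<le> card (Sf i)"
            and ctl: "controls d N R (Af i) (Sf i)" if "i < d" for i
            using sel[rule_format, OF that] by simp_all
          define A where "A = (\<Union>i<d. Af i)"
          define S' where "S' = (\<Union>i<d. Sf i)"
          have "A \<subseteq> S" using Af(1) T by (fastforce simp: A_def)
          moreover have S'S: "S' \<subseteq> S" using Sf(1) T by (fastforce simp: S'_def)
          moreover have "real (card A) \<le> (d + 1) * C * real R ^ Suc k"
          proof -
            have "card A \<le> (\<Sum>i<d. card (Af i))" unfolding A_def by (intro card_UN_le) auto
            then have "real (card A) \<le> (\<Sum>i<d. real (card (Af i)))" by (metis of_nat_le_iff of_nat_sum)
            also have "\<dots> \<le> (\<Sum>i<d. C * real R ^ Suc k)" by (intro sum_mono Af(2)) auto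
            also have "\<dots> = d * (C * real R ^ Suc k)" by simp
            also have "\<dots> \<le> (d + 1) * (C * real R ^ Suc k)" using C by (intro mult_right_mono) auto
            finally show ?thesis by (simp add: mult_ac)
          qed
          moreover have "(1 - \<eta>) * card S \<le> card S'"
          proof -
            have lost: "real (card (T i - Sf i)) \<le> \<eta>1 * card S" if i: "i < d" for i
            proof -
              have "card (T i) = card (Sf i) + card (T i - Sf i)"
                using Sf(1)[OF i] fTi[OF i] by (metis card_Diff_subset card_mono finite_subset le_add_diff_inverse)
              then have "real (card (T i - Sf i)) \<le> \<eta>1 * card (T i)" using Sf(2)[OF i] by (simp add: algebra_simps)
              also have "\<dots> \<le> \<eta>1 * card S" using * T[OF i] fS by (intro mult_left_mono of_nat_mono card_mono) auto
              finally show ?thesis .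
            qed
            have "S - S' \<subseteq> (S - (\<Union>i<d. T i)) \<union> (\<Union>i<d. T i - Sf i)" by (auto simp: S'_def)
            then have "card (S - S') \<le> card ((S - (\<Union>i<d. T i)) \<union> (\<Union>i<d. T i - Sf i))"
              by (rule card_mono[rotated]) (use fS fTi in auto)
            also have "\<dots> \<le> card (S - (\<Union>i<d. T i)) + (\<Sum>i<d. card (T i - Sf i))"
              by (intro order_trans[OF card_Un_le] add_left_mono card_UN_le) auto
            finally have "real (card (S - S')) \<le> real (card (S - (\<Union>i<d. T i))) + (\<Sum>i<d. real (card (T i - Sf i)))"
              by (simp only: of_nat_add[symmetric] of_nat_sum[symmetric] of_nat_le_iff)
            also have "(\<Sum>i<d. real (card (T i - Sf i))) \<le> (\<Sum>i<d. \<eta>1 * card S)" by (intro sum_mono lost) auto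
            also have "\<dots> = (d * \<eta>1) * card S" by simp
            also have "\<dots> \<le> \<eta> / 2 * card S" using d\<eta>1 by (rule mult_right_mono) auto
            finally have "real (card (S - S')) \<le> \<eta> * card S" using rem by simp
            moreover have "card S = card S' + card (S - S')"
              using S'S fS by (metis card_Diff_subset card_mono finite_subset le_add_diff_inverse)
            ultimately show ?thesis by (simp add: algebra_simps)
          qed
          moreover have "controls d N R A S'"
            unfolding A_def S'_def by (rule controls_UN) (use ctl in auto)
          ultimately show "controllable d N R ((d + 1) * C * real R ^ Suc k) \<eta> S"
            unfolding controllable_def by blast
        qed
      qed
    qed (use C in simp)
  qed
qed

section \<open>Polynomials vanishing on small sets\<close>

text \<open>Coefficient vectors with entries in \<open>{0..H}\<close> give values in
  \<open>{0..H*H}\<close>, because \<open>H = card M * V\<close>. So there are at most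
  \<open>(H+1)^(2 card A)\<close> value vectors, fewer than coefficient vectors, and the difference
  of two vectors with equal values is the solution.\<close>

lemma siegel:
  fixes \<phi> :: "'e \<Rightarrow> 'x \<Rightarrow> int" and V :: nat
  assumes "finite M" "finite A" "2 * card A < card M" "V \<ge> 1"
    and \<phi>: "\<And>m x. m \<in> M \<Longrightarrow> x \<in> A \<Longrightarrow> 0 \<le> \<phi> m x \<and> \<phi> m x \<le> int V"
  shows "\<exists>c. (\<exists>m\<in>M. c m \<noteq> 0) \<and> (\<forall>m. \<bar>c m\<bar> \<le> int (card M * V)) \<and> (\<forall>m. m \<notin> M \<longrightarrow> c m = 0)
    \<and> (\<forall>x\<in>A. (\<Sum>m\<in>M. c m * \<phi> m x) = 0)"
proof -
  define H where "H = card M * V"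
  have H: "H \<ge> 1" using assms(3,4) by (simp add: H_def Suc_le_eq)
  define P where "P = PiE M (\<lambda>_. {0..int H})"
  define \<Psi> where "\<Psi> g = restrict (\<lambda>x. \<Sum>m\<in>M. g m * \<phi> m x) A" for g
  have cP: "card P = (H + 1) ^ card M" using assms(1) by (simp add: P_def card_PiE nat_add_distrib)
  have fP: "finite P" using assms(1) by (simp add: P_def finite_PiE)
  have "\<Psi> ` P \<subseteq> PiE A (\<lambda>_. {0..int (H * H)})"
  proof
    fix h assume "h \<in> \<Psi> ` P"
    then obtain g where g: "g \<in> P" "h = \<Psi> g" by auto
    have "0 \<le> (\<Sum>m\<in>M. g m * \<phi> m x) \<and> (\<Sum>m\<in>M. g m * \<phi> m x) \<le> int (H * H)" if x: "x \<in> A" for x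
    proof
      have gm: "0 \<le> g m \<and> g m \<le> int H" if "m \<in> M" for m using g(1) that by (auto simp: P_def PiE_def Pi_def)
      show "0 \<le> (\<Sum>m\<in>M. g m * \<phi> m x)" using gm \<phi> x by (intro sum_nonneg) auto
      have "(\<Sum>m\<in>M. g m * \<phi> m x) \<le> (\<Sum>m\<in>M. int H * int V)"
        using gm \<phi> x by (intro sum_mono mult_mono) auto
      also have "\<dots> = int (H * H)" by (simp add: H_def)
      finally show "(\<Sum>m\<in>M. g m * \<phi> m x) \<le> int (H * H)" .
    qed
    then show "h \<in> PiE A (\<lambda>_. {0..int (H * H)})" by (auto simp: g(2) \<Psi>_def)
  qed
  then have "card (\<Psi> ` P) \<le> card (PiE A (\<lambda>_. {0..int (H * H)}))"
    using assms(2) by (intro card_mono finite_PiE) auto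
  also have "\<dots> = (H * H + 1) ^ card A" using assms(2) by (simp add: card_PiE nat_add_distrib nat_mult_distrib)
  also have "\<dots> \<le> ((H + 1) ^ 2) ^ card A" by (intro power_mono) (auto simp: power2_eq_square)
  also have "\<dots> = (H + 1) ^ (2 * card A)" by (simp add: power_mult)
  also have "\<dots> < (H + 1) ^ card M" using H assms(3) by (intro power_strict_increasing) auto
  finally have "card (\<Psi> ` P) < card P" by (simp add: cP)
  from pigeonhole[OF this] obtain g h where gh: "g \<in> P" "h \<in> P" "g \<noteq> h" "\<Psi> g = \<Psi> h"
    by (auto simp: inj_on_def)
  \<comment> \<open>Zero outside \<open>M\<close>, so that \<open>c\<close> can be read as a
    coefficient function for any larger degree bound.\<close>
  define c where "c m = (if m \<in> M then g m - h m else 0)" for m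
  have "\<exists>m\<in>M. c m \<noteq> 0"
  proof (rule ccontr)
    assume "\<not> ?thesis"
    then have "g m = h m" if "m \<in> M" for m using that by (auto simp: c_def)
    then have "g = h" using gh(1,2) by (intro PiE_ext[of g M]) (auto simp: P_def)
    then show False using gh(3) by simp
  qed
  moreover have "\<bar>c m\<bar> \<le> int (card M * V)" for m
  proof (cases "m \<in> M")
    case True
    then have "0 \<le> g m \<and> g m \<le> int H" "0 \<le> h m \<and> h m \<le> int H"
      using gh(1,2) by (auto simp: P_def PiE_def Pi_def)
    then have "\<bar>g m - h m\<bar> \<le> int H" by linarith
    then show ?thesis using True by (simp add: c_def H_def)
  qed (simp add: c_def)
  moreover have "(\<Sum>m\<in>M. c m * \<phi> m x) = 0" if x: "x \<in> A" for x
  proof -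
    have "(\<Sum>m\<in>M. c m * \<phi> m x) = (\<Sum>m\<in>M. g m * \<phi> m x) - (\<Sum>m\<in>M. h m * \<phi> m x)"
      by (simp add: c_def left_diff_distrib sum_subtractf)
    also have "\<dots> = \<Psi> g x - \<Psi> h x" using x by (simp add: \<Psi>_def)
    finally show ?thesis using gh(4) by simp
  qed
  ultimately show ?thesis by (intro exI[of _ c]) (auto simp: c_def)
qed

section \<open>Monomials: size on the grid, congruences, number\<close>

definition monoval :: "int list \<Rightarrow> nat list \<Rightarrow> int" where
  "monoval x m = prod_list (map2 (\<lambda>a n. a ^ n) x m)"

lemma monoval_simps [simp]:
  "monoval [] m = 1" "monoval x [] = 1" "monoval (a # x) (n # m) = a ^ n * monoval x m"
  by (simp_all add: monoval_def)

lemma monoval_bounds: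
  assumes "\<forall>a\<in>set x. 0 \<le> a \<and> a \<le> int N" "N \<ge> 1"
  shows "0 \<le> monoval x m \<and> monoval x m \<le> int N ^ sum_list m"
  using assms(1)
proof (induction x arbitrary: m)
  case (Cons a x)
  show ?case
  proof (cases m)
    case (Cons n m')
    have IH: "0 \<le> monoval x m'" "monoval x m' \<le> int N ^ sum_list m'" using Cons.IH[of m'] Cons.prems by auto
    have "a ^ n * monoval x m' \<le> int N ^ n * int N ^ sum_list m'"
      using IH Cons.prems by (intro mult_mono power_mono) auto
    then show ?thesis using IH Cons Cons.prems by (simp add: power_add)
  qed (use assms(2) in auto)
qed (use assms(2) in auto)

lemma monoval_cong:
  "reduce p x = reduce p y \<Longrightarrow> int p dvd monoval x m - monoval y m"
proof (induction x arbitrary: y m)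
  case Nil
  then show ?case by (simp add: reduce_def)
next
  case (Cons a x)
  then obtain b y' where y: "y = b # y'" by (cases y) (auto simp: reduce_def)
  show ?case
  proof (cases m)
    case m: (Cons n m')
    have "(a ^ n * monoval x m') mod int p = (b ^ n * monoval y' m') mod int p"
    proof (rule mod_mult_cong)
      have "a mod int p = b mod int p" using Cons.prems y by (simp add: reduce_def)
      then show "a ^ n mod int p = b ^ n mod int p" by (metis power_mod)
      have "reduce p x = reduce p y'" using Cons.prems y by (simp add: reduce_def)
      then show "monoval x m' mod int p = monoval y' m' mod int p"
        using Cons.IH by (simp add: mod_eq_dvd_iff)
    qed
    then show ?thesis by (simp add: y m mod_eq_dvd_iff)
  qed simp
qed

lemma mpoly_eval_eq: "mpoly_eval d D c x = (\<Sum>m\<in>monomials_upto d D. c m * monoval x m)"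
  by (simp add: mpoly_eval_def monoval_def)

lemma finite_lists_atMost: "finite {m. set m \<subseteq> {..r::nat} \<and> length m = d}"
  by (rule finite_lists_length_eq) simp

lemma monomials_subset:
  "monomials_upto d (real r) \<subseteq> {m. set m \<subseteq> {..r} \<and> length m = d}"
proof
  fix m assume m: "m \<in> monomials_upto d (real r)"
  then have "sum_list m \<le> r" "length m = d" by (auto simp: monomials_upto_def)
  moreover have "n \<le> sum_list m" if "n \<in> set m" for n using that by (intro member_le_sum_list) auto
  ultimately show "m \<in> {m. set m \<subseteq> {..r} \<and> length m = d}" by fastforce
qed

lemma finite_monomials: "finite (monomials_upto d D)"
proof -
  have "monomials_upto d D \<subseteq> monomials_upto d (real (nat \<lceil>D\<rceil>))"
    by (auto simp: monomials_upto_def) linarith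
  then show ?thesis
    using finite_subset[OF monomials_subset finite_lists_atMost] finite_subset by blast
qed

lemma card_monomials_le: "card (monomials_upto d (real r)) \<le> (r + 1) ^ d"
proof -
  have "card (monomials_upto d (real r)) \<le> card {m. set m \<subseteq> {..r} \<and> length m = d}"
    by (rule card_mono[OF finite_lists_atMost monomials_subset])
  also have "\<dots> = (r + 1) ^ d" by (subst card_lists_length_eq) auto
  finally show ?thesis .
qed

text \<open>Exponent vectors with all entries at most \<open>q\<close> have degree at most
  \<open>d * q\<close>; only the order of growth \<open>q^d\<close> matters.\<close>

lemma card_monomials_ge: "(q + 1) ^ d \<le> card (monomials_upto d (real (d * q)))"
proof -
  have "(q + 1) ^ d = card {m. set m \<subseteq> {..q} \<and> length m = d}" by (subst card_lists_length_eq) auto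
  also have "\<dots> \<le> card (monomials_upto d (real (d * q)))"
  proof (rule card_mono[OF finite_monomials], rule subsetI)
    fix m assume m: "m \<in> {m. set m \<subseteq> {..q} \<and> length m = d}"
    then have "sum_list m \<le> length m * q"
      by (induction m arbitrary: d) auto
    then have "real (sum_list m) \<le> real (d * q)" using m by (simp only: of_nat_le_iff mem_Collect_eq)
    then show "m \<in> monomials_upto d (real (d * q))" using m by (simp add: monomials_upto_def)
  qed
  finally show ?thesis .
qed

text \<open>\<open>C\<close> has two roles, degree bound and exponent of the height, so it is larger
  than the actual degree bound \<open>r\<close>; coefficients beyond \<open>r\<close> are 0. The
  last two conclusions prepare the hypotheses on \<open>F\<close> in
  \<open>controls\<close>.\<close>

lemma small_polynomial:
  fixes r N :: nat and C :: real
  assumes "A \<subseteq> grid d N" "2 * card A < card (monomials_upto d (real r))" "N \<ge> 2"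
    and C: "C \<ge> real ((r + 1) ^ d + r)"
  shows "\<exists>c. (\<exists>m\<in>monomials_upto d C. c m \<noteq> 0)
    \<and> (\<forall>m\<in>monomials_upto d C. real_of_int \<bar>c m\<bar> \<le> real N powr C)
    \<and> (\<forall>x\<in>A. mpoly_eval d C c x = 0)
    \<and> (\<forall>p x y. reduce p x = reduce p y \<longrightarrow> int p dvd mpoly_eval d C c x - mpoly_eval d C c y)
    \<and> (\<forall>x\<in>grid d N. \<bar>mpoly_eval d C c x\<bar> \<le> int (((r + 1) ^ d) ^ 2 * N ^ (2 * r)))"
proof -
  let ?M = "monomials_upto d (real r)"
  let ?b = "(r + 1) ^ d"
  have mono: "0 \<le> monoval x m \<and> monoval x m \<le> int (N ^ r)" if "m \<in> ?M" "x \<in> grid d N" for m x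
  proof -
    have b: "0 \<le> monoval x m \<and> monoval x m \<le> int N ^ sum_list m"
      using that assms(3) by (intro monoval_bounds) (auto simp: grid_def)
    have "int N ^ sum_list m \<le> int N ^ r"
      using that assms(3) by (intro power_increasing) (auto simp: monomials_upto_def)
    then show ?thesis using b by simp
  qed
  have V: "N ^ r \<ge> 1" using assms(3) by simp
  have fA: "finite A" by (rule finite_subset_grid[OF assms(1)])
  have mono_A: "0 \<le> monoval x m \<and> monoval x m \<le> int (N ^ r)" if "m \<in> ?M" "x \<in> A" for m x
    using mono[OF that(1)] that(2) assms(1) by blast
  from siegel[OF finite_monomials fA assms(2) V, of "\<lambda>m x. monoval x m", OF mono_A]
  obtain c where c: "\<exists>m\<in>?M. c m \<noteq> 0" "\<And>m. \<bar>c m\<bar> \<le> int (card ?M * N ^ r)" "\<And>m. m \<notin> ?M \<Longrightarrow> c m = 0"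
      "\<And>x. x \<in> A \<Longrightarrow> (\<Sum>m\<in>?M. c m * monoval x m) = 0" by blast
  have cb: "\<bar>c m\<bar> \<le> int (?b * N ^ r)" for m
  proof -
    have "card ?M * N ^ r \<le> ?b * N ^ r" by (intro mult_right_mono card_monomials_le) auto
    then show ?thesis using c(2)[of m] by linarith
  qed
  have "real r \<le> C" by (rule order_trans[OF _ C]) simp
  then have sub: "?M \<subseteq> monomials_upto d C" by (auto simp: monomials_upto_def intro: order_trans)
  have ev: "mpoly_eval d C c x = (\<Sum>m\<in>?M. c m * monoval x m)" for x
    unfolding mpoly_eval_eq by (rule sum.mono_neutral_right[OF finite_monomials sub]) (use c(3) in auto)
  have "real_of_int \<bar>c m\<bar> \<le> real N powr C" for m
  proof -
    have "real_of_int \<bar>c m\<bar> \<le> real_of_int (int (?b * N ^ r))" using cb[of m] by (simp only: of_int_le_iff)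
    also have "\<dots> = real (?b * N ^ r)" by simp
    also have "\<dots> \<le> real (N ^ ?b * N ^ r)"
    proof -
      \<comment> \<open>The bound \<open>?b\<close> for the number of monomials is hidden in a power
        of \<open>N\<close>, which takes \<open>N \<ge> 2\<close>.\<close>
      have "?b < 2 ^ ?b" by (rule less_exp)
      also have "\<dots> \<le> N ^ ?b" using assms(3) by (intro power_mono) auto
      finally have "?b * N ^ r \<le> N ^ ?b * N ^ r" by (intro mult_right_mono) auto
      then show ?thesis by (simp only: of_nat_le_iff)
    qed
    also have "\<dots> = real N powr real (?b + r)" using assms(3) by (simp add: powr_realpow[symmetric] powr_add)
    also have "\<dots> \<le> real N powr C" using C assms(3) by (intro powr_mono) auto
    finally show ?thesis .
  qed
  moreover have "int p dvd mpoly_eval d C c x - mpoly_eval d C c y" if "reduce p x = reduce p y" for p x y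
  proof -
    have "mpoly_eval d C c x - mpoly_eval d C c y = (\<Sum>m\<in>?M. c m * (monoval x m - monoval y m))"
      by (simp add: ev right_diff_distrib sum_subtractf)
    also have "int p dvd \<dots>" by (intro dvd_sum dvd_mult monoval_cong that)
    finally show ?thesis .
  qed
  moreover have "\<bar>mpoly_eval d C c x\<bar> \<le> int (?b ^ 2 * N ^ (2 * r))" if x: "x \<in> grid d N" for x
  proof -
    have "\<bar>mpoly_eval d C c x\<bar> \<le> (\<Sum>m\<in>?M. \<bar>c m * monoval x m\<bar>)" unfolding ev by (rule sum_abs)
    also have "\<dots> \<le> (\<Sum>m\<in>?M. int (?b * N ^ r) * int (N ^ r))"
      unfolding abs_mult using cb mono[OF _ x] by (intro sum_mono mult_mono) auto
    also have "\<dots> = int (card ?M * (?b * N ^ r * N ^ r))" by simp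
    also have "\<dots> \<le> int (?b * (?b * N ^ r * N ^ r))"
      by (intro of_nat_mono mult_right_mono card_monomials_le) auto
    also have "\<dots> = int (?b ^ 2 * N ^ (2 * r))"
      by (simp add: power2_eq_square power_mult mult_2 power_add mult_ac)
    finally show ?thesis .
  qed
  ultimately show ?thesis using c(1,4) sub ev by (intro exI[of _ c]) auto
qed

section \<open>Choice of the constants and the ranges of \<open>N\<close>\<close>

lemma card_grid_le: "card (grid d N) \<le> (N + 1) ^ d"
proof -
  have "card (grid d N) \<le> card {x. set x \<subseteq> {0..int N} \<and> length x = d}"
    by (intro card_mono finite_lists_length_eq) (auto simp: grid_def)
  also have "\<dots> = (N + 1) ^ d" by (subst card_lists_length_eq) (auto simp: nat_add_distrib)
  finally show ?thesis .
qed

theorem theorem1p1: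
  fixes d k :: nat and \<epsilon> \<alpha> :: real
  assumes "k < d" and "\<epsilon> > 0" and "\<alpha> > 0"
  shows "\<exists>C'::real. \<forall>\<eta>::real. \<eta> > 0 \<longrightarrow> (\<exists>C::real. \<forall>(N::nat) (S::int list set).
            N > 0 \<longrightarrow> S \<subseteq> grid d N \<longrightarrow>
            (\<forall>p::nat. prime p \<longrightarrow> real (residue_classes p S) < \<alpha> * real p ^ k) \<longrightarrow>
            (real (card S) \<le> C' * real N powr (real k - 1 + \<epsilon>)
             \<or> (\<exists>c :: nat list \<Rightarrow> int.
                  (\<exists>e\<in>monomials_upto d C. c e \<noteq> 0)
                  \<and> (\<forall>e\<in>monomials_upto d C. real_of_int \<bar>c e\<bar> \<le> real N powr C)
                  \<and> real (card {x\<in>S. mpoly_eval d C c x = 0}) > (1 - \<eta>) * real (card S))))"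
\<comment> \<open>\<open>2 ^ d\<close> settles \<open>N = 1\<close>, where the power of
  \<open>N\<close> is 1 and the grid has at most \<open>2 ^ d\<close> points; it is chosen before
  \<open>\<eta>\<close>.\<close>
proof (rule exI[of _ "2 ^ d"], intro allI impI)
  fix \<eta> :: real assume \<eta>: "\<eta> > 0"
  have d: "d \<ge> 1" using assms(1) by simp
  \<comment> \<open>Makes \<open>2 * e * d\<close> equal to \<open>\<epsilon>/2\<close>, below the
    surplus exponent \<open>\<epsilon>\<close>.\<close>
  define e where "e = \<epsilon> / (4 * d)"
  have e: "e > 0" "2 * e * d < \<epsilon>" using assms d by (auto simp: e_def)
  have \<eta>2: "\<eta> / 2 > 0" using \<eta> by simp
  obtain \<gamma> :: real where \<gamma>: "\<gamma> > 0" and H: "\<forall>\<alpha>::real>0. \<exists>C::real>0. \<forall>R\<ge>1.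
      \<forall>\<^sub>F N in sequentially. \<forall>S\<subseteq>grid d N. 1 * real N powr (real k - 1 + \<epsilon>) \<le> card S \<longrightarrow>
      prime_weight {p\<in>sieve_primes e N. real (residue_classes p S) > \<alpha> * real p ^ k} \<le> \<gamma> * total_weight e N \<longrightarrow>
      controllable d N R (C * real R ^ k) (\<eta> / 2) S"
    using large_imp_controllable[OF e zero_less_one \<eta>2] by blast
  obtain K :: real where K: "K > 0" and ev: "\<forall>R\<ge>1.
      \<forall>\<^sub>F N in sequentially. \<forall>S\<subseteq>grid d N. 1 * real N powr (real k - 1 + \<epsilon>) \<le> card S \<longrightarrow>
      prime_weight {p\<in>sieve_primes e N. real (residue_classes p S) > \<alpha> * real p ^ k} \<le> \<gamma> * total_weight e N \<longrightarrow>
      controllable d N R (K * real R ^ k) (\<eta> / 2) S"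
    using H assms(3) by blast
  \<comment> \<open>With \<open>R \<le> 2d(q+1)\<close> this gives
    \<open>2 K R^k \<le> 2 K (2d)^k (q+1)^k < (q+1)^(k+1) \<le> (q+1)^d\<close>, at most the number
    of monomials of degree at most \<open>d * q\<close>.\<close>
  define q where "q = nat \<lceil>2 * K * (2 * d) ^ k\<rceil>"
  define r where "r = d * q"
  \<comment> \<open>Values on the grid are at most \<open>b^2 * N^(2r)\<close>; the extra factor
    \<open>N\<close> absorbs \<open>b^2\<close> once \<open>N \<ge> N0\<close>.\<close>
  define R where "R = 2 * r + 1"
  define b where "b = (r + 1) ^ d"
  have "R \<ge> 1" by (simp add: R_def)
  from ev[rule_format, OF this] obtain N1 where N1: "\<And>N S. N \<ge> N1 \<Longrightarrow> S \<subseteq> grid d N \<Longrightarrow>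
      1 * real N powr (real k - 1 + \<epsilon>) \<le> card S \<Longrightarrow>
      prime_weight {p\<in>sieve_primes e N. real (residue_classes p S) > \<alpha> * real p ^ k} \<le> \<gamma> * total_weight e N \<Longrightarrow>
      controllable d N R (K * real R ^ k) (\<eta> / 2) S"
    unfolding eventually_sequentially by blast
  define N0 where "N0 = max N1 (b ^ 2)"
  \<comment> \<open>For \<open>2 \<le> N < N0\<close> Siegel's lemma is applied to \<open>S\<close>
    itself, which has at most \<open>(N0 + 1)^d\<close> points; degree \<open>r2\<close> provides
    more than twice as many monomials.\<close>
  define r2 where "r2 = d * (2 * (N0 + 1))"
  define C where "C = real (b + r) + real ((r2 + 1) ^ d + r2)"
  have room: "2 * (K * real R ^ k) < card (monomials_upto d (real r))"
  proof -
    have q: "2 * K * (2 * real d) ^ k < real (q + 1)" unfolding q_def by (simp, linarith)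
    have "real R \<le> 2 * real d * (q + 1)" using d by (simp add: R_def r_def algebra_simps)
    then have "real R ^ k \<le> (2 * real d * (q + 1)) ^ k" by (intro power_mono) auto
    then have "2 * (K * real R ^ k) \<le> 2 * K * (2 * real d) ^ k * real (q + 1) ^ k"
      using K by (simp add: power_mult_distrib)
    also have "\<dots> < real (q + 1) * real (q + 1) ^ k" using q by (intro mult_strict_right_mono) auto
    also have "\<dots> = real (q + 1) ^ Suc k" by simp
    also have "\<dots> \<le> real (q + 1) ^ d" using assms(1) by (intro power_increasing) auto
    also have "\<dots> = real ((q + 1) ^ d)" by simp
    also have "\<dots> \<le> card (monomials_upto d (real r))"
      unfolding r_def by (intro of_nat_mono card_monomials_ge)
    finally show ?thesis .
  qed
  show "\<exists>C::real. \<forall>(N::nat) (S::int list set).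
            N > 0 \<longrightarrow> S \<subseteq> grid d N \<longrightarrow>
            (\<forall>p::nat. prime p \<longrightarrow> real (residue_classes p S) < \<alpha> * real p ^ k) \<longrightarrow>
            (real (card S) \<le> 2 ^ d * real N powr (real k - 1 + \<epsilon>)
             \<or> (\<exists>c :: nat list \<Rightarrow> int.
                  (\<exists>e\<in>monomials_upto d C. c e \<noteq> 0)
                  \<and> (\<forall>e\<in>monomials_upto d C. real_of_int \<bar>c e\<bar> \<le> real N powr C)
                  \<and> real (card {x\<in>S. mpoly_eval d C c x = 0}) > (1 - \<eta>) * real (card S)))"
  proof (rule exI[of _ C], intro allI impI)
    fix N :: nat and S :: "int list set"
    assume N: "N > 0" and S: "S \<subseteq> grid d N"
      and res: "\<forall>p::nat. prime p \<longrightarrow> real (residue_classes p S) < \<alpha> * real p ^ k"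
    have fS: "finite S" by (rule finite_subset_grid[OF S])
    let ?small = "real (card S) \<le> 2 ^ d * real N powr (real k - 1 + \<epsilon>)"
    let ?vanish = "\<lambda>c. (\<exists>e\<in>monomials_upto d C. c e \<noteq> 0)
                  \<and> (\<forall>e\<in>monomials_upto d C. real_of_int \<bar>c e\<bar> \<le> real N powr C)
                  \<and> real (card {x\<in>S. mpoly_eval d C c x = 0}) > (1 - \<eta>) * real (card S)"
    have cS: "card S \<le> (N + 1) ^ d"
      using card_grid_le[of d N] card_mono[OF finite_grid S] by linarith
    consider "?small" | "\<not> ?small" "N \<ge> 2" "N < N0" | "\<not> ?small" "N \<ge> 2" "N \<ge> N0"
    proof -
      have "?small" if "N = 1"
      proof -
        have "real (card S) \<le> real ((1 + 1) ^ d)" using cS that by (simp only: of_nat_le_iff)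
        then show ?thesis using that by simp
      qed
      moreover have "N \<ge> 2" if "N \<noteq> 1" using that N by simp
      moreover have "N < N0 \<or> N \<ge> N0" by linarith
      ultimately show thesis using that by blast
    qed
    then show "?small \<or> (\<exists>c. ?vanish c)"
    proof cases
      case 2
      have pos: "real (card S) > 0"
        using 2(1) N by (smt (verit) mult_nonneg_nonneg powr_ge_zero zero_le_power)
      have "2 * card S < card (monomials_upto d (real r2))"
      proof -
        have "2 * card S \<le> 2 * (N0 + 1) ^ d"
          using cS 2 by (intro mult_left_mono order_trans[OF cS] power_mono) auto
        also have "\<dots> \<le> (2 * (N0 + 1)) ^ d"
          unfolding power_mult_distrib using d by (intro mult_right_mono self_le_power) auto
        also have "\<dots> < (2 * (N0 + 1) + 1) ^ d" using d by (intro power_strict_mono) auto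
        also have "\<dots> \<le> card (monomials_upto d (real r2))" unfolding r2_def by (rule card_monomials_ge)
        finally show ?thesis .
      qed
      from small_polynomial[OF S this 2(2), of C] obtain c where
        "\<exists>m\<in>monomials_upto d C. c m \<noteq> 0" "\<forall>m\<in>monomials_upto d C. real_of_int \<bar>c m\<bar> \<le> real N powr C"
        "\<forall>x\<in>S. mpoly_eval d C c x = 0" by (auto simp: C_def)
      moreover from this(3) have "{x\<in>S. mpoly_eval d C c x = 0} = S" by auto
      ultimately have "?vanish c" using pos \<eta> by (simp add: algebra_simps)
      then show ?thesis by blast
    next
      case 3
      have pos: "real (card S) > 0"
        using 3(1) N by (smt (verit) mult_nonneg_nonneg powr_ge_zero zero_le_power)
      have large: "1 * real N powr (real k - 1 + \<epsilon>) \<le> card S"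
      proof -
        have "1 * real N powr (real k - 1 + \<epsilon>) \<le> 2 ^ d * real N powr (real k - 1 + \<epsilon>)"
          by (intro mult_right_mono) auto
        then show ?thesis using 3(1) by linarith
      qed
      \<comment> \<open>At the top level there are no exceptional primes; they arise only on
        slices.\<close>
      have no_bad: "{p\<in>sieve_primes e N. real (residue_classes p S) > \<alpha> * real p ^ k} = {}"
        using res sieve_primes_prime by (auto simp: not_less intro: less_imp_le)
      have bad: "prime_weight {p\<in>sieve_primes e N. real (residue_classes p S) > \<alpha> * real p ^ k} \<le> \<gamma> * total_weight e N"
        unfolding no_bad using \<gamma> total_weight_nonneg[of e N] by (simp add: prime_weight_def)
      have "N \<ge> N1" using 3 by (simp add: N0_def)
      from N1[OF this S large bad] obtain A S' where A: "A \<subseteq> S" "real (card A) \<le> K * real R ^ k"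
        and S': "S' \<subseteq> S" "(1 - \<eta> / 2) * card S \<le> card S'" and ctl: "controls d N R A S'"
        unfolding controllable_def by blast
      have "real (2 * card A) < real (card (monomials_upto d (real r)))" using A(2) room by simp
      then have "2 * card A < card (monomials_upto d (real r))" by (simp only: of_nat_less_iff)
      moreover have "A \<subseteq> grid d N" using A S by blast
      ultimately obtain c where c: "\<exists>m\<in>monomials_upto d C. c m \<noteq> 0"
        "\<forall>m\<in>monomials_upto d C. real_of_int \<bar>c m\<bar> \<le> real N powr C"
        and zero: "\<forall>x\<in>A. mpoly_eval d C c x = 0"
        and cong: "\<forall>p x y. reduce p x = reduce p y \<longrightarrow> int p dvd mpoly_eval d C c x - mpoly_eval d C c y"
        and bound: "\<forall>x\<in>grid d N. \<bar>mpoly_eval d C c x\<bar> \<le> int (b ^ 2 * N ^ (2 * r))"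
        using small_polynomial[of A d N r C] 3(2) by (auto simp: C_def b_def)
      have "b ^ 2 * N ^ (2 * r) \<le> N * N ^ (2 * r)"
        using 3 by (intro mult_right_mono) (auto simp: N0_def)
      then have "int (b ^ 2 * N ^ (2 * r)) \<le> int N ^ R" by (simp add: R_def flip: of_nat_power of_nat_mult)
      then have bound': "\<bar>mpoly_eval d C c x\<bar> \<le> int N ^ R" if "x \<in> grid d N" for x
        using bound that by fastforce
      have "mpoly_eval d C c x = 0" if "x \<in> S'" for x
        using controlsD[OF ctl, of "mpoly_eval d C c"] cong bound' zero that by blast
      then have "S' \<subseteq> {x\<in>S. mpoly_eval d C c x = 0}" using S' by auto
      then have "card S' \<le> card {x\<in>S. mpoly_eval d C c x = 0}" using fS by (intro card_mono) auto
      \<comment> \<open>Control was requested with loss \<open>\<eta>/2\<close> so that the final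
        inequality is strict.\<close>
      moreover have "(1 - \<eta>) * card S < (1 - \<eta> / 2) * card S"
        using \<eta> pos by (intro mult_strict_right_mono) auto
      ultimately have "?vanish c" using c S'(2) by linarith
      then show ?thesis by blast
    qed simp
  qed
qed

end
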